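(* Let $D\subset\mathbb R^2$ be a bounded, simply connected smooth domain. Let $\rho_0$ be a smooth density on $\overline D$ with $0<C_1^{-1}\le\rho_0\le C_1<\infty$ for some $C_1>1$. For smooth $(u,\rho)$ on $[0,T]\times\overline D$ with $u\cdot\mathbf n=0$ on $\partial D$ and $\rho|_{t=0}=\rho_0$, the inhomogeneous incompressible Euler system $$\partial_t(\rho u)+\nabla\cdot(\rho u\otimes u)+\nabla p=0,\qquad \nabla\cdot u=0,\qquad \partial_t\rho+u\cdot\nabla\rho=0$$ (for some pressure $p$) is equivalent, with $\omega=\nabla\times(\rho u)$, to the pressure-free vorticity system $$\partial_t\omega+u\cdot\nabla\omega+\nabla\Big(\tfrac12|u|^2\Big)\times\nabla\rho=0,\qquad u=\nabla^\perp\mathbf L_\rho^{-1}\omega,\qquad \partial_t\rho+u\cdot\nabla\rho=0 .$$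
   Context: In two dimensions: $\nabla^\perp\psi=(-\partial_2\psi,\partial_1\psi)$, $\nabla\times v=\partial_1v_2-\partial_2v_1$, and $a\times b=a_1b_2-a_2b_1$ for vectors $a,b\in\mathbb R^2$. $\mathbf n$ is the unit normal on $\partial D$. $\mathbf L_\rho\psi:=\nabla\cdot(\rho\nabla\psi)=\nabla\times(\rho\nabla^\perp\psi)$, and $\mathbf L_\rho^{-1}\omega$ is the unique solution $\psi$ of $\mathbf L_\rho\psi=\omega$ in $D$ with $\psi|_{\partial D}=0$. *)

theory Defs
  imports "HOL-Analysis.Analysis"
begin

text \<open>
  \<open>Ck_on k S f\<close>: \<open>f\<close> is \<open>k\<close> times continuously differentiable on \<open>S\<close>. Derivatives are taken
  relative to \<open>S\<close>. For open \<open>S\<close> this is the usual notion. For \<open>S\<close> the closure of a smoothly bounded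
  open set (or the product of such a closure with a time interval) it says that all
  derivatives up to order \<open>k\<close> exist in the interior and extend continuously to the boundary.
\<close>

primrec Ck_on :: "nat \<Rightarrow> 'a::euclidean_space set \<Rightarrow> ('a \<Rightarrow> 'b::real_normed_vector) \<Rightarrow> bool" where
  "Ck_on 0 S f \<longleftrightarrow> continuous_on S f"
| "Ck_on (Suc k) S f \<longleftrightarrow>
     (\<exists>f'. (\<forall>x\<in>S. (f has_derivative f' x) (at x within S)) \<and> (\<forall>v. Ck_on k S (\<lambda>x. f' x v)))"

definition smooth_on :: "'a::euclidean_space set \<Rightarrow> ('a \<Rightarrow> 'b::real_normed_vector) \<Rightarrow> bool" where
  "smooth_on S f \<longleftrightarrow> (\<forall>k. Ck_on k S f)"

text \<open>
  Near \<open>x\<close>, in the orthonormal coordinates given by \<open>\<tau>\<close> and \<open>\<nu>\<close>, the set \<open>D\<close> is the region strictly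
  above the graph of \<open>\<gamma>\<close>.
\<close>

definition graph_chart ::
  "(real^2) set \<Rightarrow> real^2 \<Rightarrow> real \<Rightarrow> real^2 \<Rightarrow> real^2 \<Rightarrow> (real \<Rightarrow> real) \<Rightarrow> bool" where
  "graph_chart D x r \<tau> \<nu> \<gamma> \<longleftrightarrow>
     r > 0 \<and> norm \<tau> = 1 \<and> norm \<nu> = 1 \<and> \<tau> \<bullet> \<nu> = 0 \<and> smooth_on UNIV \<gamma> \<and>
     D \<inter> ball x r = {y \<in> ball x r. y \<bullet> \<nu> > \<gamma> (y \<bullet> \<tau>)}"

definition smooth_domain :: "(real^2) set \<Rightarrow> bool" where
  "smooth_domain D \<longleftrightarrow> open D \<and> connected D \<and> D \<noteq> {} \<and>
     (\<forall>x\<in>frontier D. \<exists>r \<tau> \<nu> \<gamma>. graph_chart D x r \<tau> \<nu> \<gamma>)"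

text \<open>
  \<open>n\<close> is the outward unit normal of \<open>D\<close> at the boundary point \<open>x\<close>; the value does not depend on
  the chart.
\<close>

definition unit_normal :: "(real^2) set \<Rightarrow> real^2 \<Rightarrow> real^2 \<Rightarrow> bool" where
  "unit_normal D x n \<longleftrightarrow> x \<in> frontier D \<and>
     (\<exists>r \<tau> \<nu> \<gamma>. graph_chart D x r \<tau> \<nu> \<gamma> \<and>
        n = (deriv \<gamma> (x \<bullet> \<tau>) *\<^sub>R \<tau> - \<nu>) /\<^sub>R sqrt (1 + (deriv \<gamma> (x \<bullet> \<tau>))\<^sup>2))"

definition pderiv_at :: "2 \<Rightarrow> (real^2 \<Rightarrow> real) \<Rightarrow> real^2 \<Rightarrow> real" where
  "pderiv_at i f x = frechet_derivative f (at x) (axis i 1)"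

definition grad :: "(real^2 \<Rightarrow> real) \<Rightarrow> real^2 \<Rightarrow> real^2" where
  "grad f x = vector [pderiv_at 1 f x, pderiv_at 2 f x]"

definition perp_grad :: "(real^2 \<Rightarrow> real) \<Rightarrow> real^2 \<Rightarrow> real^2" where
  "perp_grad f x = vector [- pderiv_at 2 f x, pderiv_at 1 f x]"

definition diverg :: "(real^2 \<Rightarrow> real^2) \<Rightarrow> real^2 \<Rightarrow> real" where
  "diverg v x = pderiv_at 1 (\<lambda>y. v y $ 1) x + pderiv_at 2 (\<lambda>y. v y $ 2) x"

definition curl :: "(real^2 \<Rightarrow> real^2) \<Rightarrow> real^2 \<Rightarrow> real" where
  "curl v x = pderiv_at 1 (\<lambda>y. v y $ 2) x - pderiv_at 2 (\<lambda>y. v y $ 1) x"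

definition cross2 :: "real^2 \<Rightarrow> real^2 \<Rightarrow> real" where
  "cross2 a b = a $ 1 * b $ 2 - a $ 2 * b $ 1"

definition outer :: "real^2 \<Rightarrow> real^2 \<Rightarrow> real^2^2" where
  "outer a b = (\<chi> i j. a $ i * b $ j)"

definition tensor_div :: "(real^2 \<Rightarrow> real^2^2) \<Rightarrow> real^2 \<Rightarrow> real^2" where
  "tensor_div A x = (\<chi> i. \<Sum>j\<in>UNIV. pderiv_at j (\<lambda>y. A y $ i $ j) x)"

text \<open>The time derivative is one-sided at the end points of \<open>[0,T]\<close>.\<close>

definition dt :: "real \<Rightarrow> (real \<Rightarrow> real^2 \<Rightarrow> 'b::real_normed_vector) \<Rightarrow> real \<Rightarrow> real^2 \<Rightarrow> 'b" where
  "dt T f t x = vector_derivative (\<lambda>s. f s x) (at t within {0..T})"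

definition L_op :: "(real^2 \<Rightarrow> real) \<Rightarrow> (real^2 \<Rightarrow> real) \<Rightarrow> real^2 \<Rightarrow> real" where
  "L_op \<rho> \<psi> = diverg (\<lambda>y. \<rho> y *\<^sub>R grad \<psi> y)"

definition dirichlet_solution ::
  "(real^2) set \<Rightarrow> (real^2 \<Rightarrow> real) \<Rightarrow> (real^2 \<Rightarrow> real) \<Rightarrow> (real^2 \<Rightarrow> real) \<Rightarrow> bool" where
  "dirichlet_solution D \<rho> \<omega> \<psi> \<longleftrightarrow>
     Ck_on 2 D \<psi> \<and> continuous_on (closure D) \<psi> \<and>
     (\<forall>x\<in>D. L_op \<rho> \<psi> x = \<omega> x) \<and> (\<forall>x\<in>frontier D. \<psi> x = 0)"

text \<open>
  \<open>is_L_inv D \<rho> \<omega> \<psi>\<close> stands for \<open>\<psi> = L\<^sub>\<rho>\<^sup>-\<^sup>1 \<omega>\<close>. It is a relation because solutions are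
  functions on \<open>closure D\<close>, represented by functions on the whole plane with arbitrary values elsewhere.
\<close>

definition is_L_inv ::
  "(real^2) set \<Rightarrow> (real^2 \<Rightarrow> real) \<Rightarrow> (real^2 \<Rightarrow> real) \<Rightarrow> (real^2 \<Rightarrow> real) \<Rightarrow> bool" where
  "is_L_inv D \<rho> \<omega> \<psi> \<longleftrightarrow> dirichlet_solution D \<rho> \<omega> \<psi> \<and>
     (\<forall>\<phi>. dirichlet_solution D \<rho> \<omega> \<phi> \<longrightarrow> (\<forall>x\<in>closure D. \<phi> x = \<psi> x))"

definition transport_eq ::
  "(real^2) set \<Rightarrow> real \<Rightarrow> (real \<Rightarrow> real^2 \<Rightarrow> real^2) \<Rightarrow> (real \<Rightarrow> real^2 \<Rightarrow> real) \<Rightarrow> bool" where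
  "transport_eq D T u \<rho> \<longleftrightarrow>
     (\<forall>t\<in>{0..T}. \<forall>x\<in>D. dt T \<rho> t x + u t x \<bullet> grad (\<rho> t) x = 0)"

definition euler_system ::
  "(real^2) set \<Rightarrow> real \<Rightarrow> (real \<Rightarrow> real^2 \<Rightarrow> real^2) \<Rightarrow> (real \<Rightarrow> real^2 \<Rightarrow> real) \<Rightarrow>
    (real \<Rightarrow> real^2 \<Rightarrow> real) \<Rightarrow> bool" where
  "euler_system D T u \<rho> p \<longleftrightarrow>
     (\<forall>t\<in>{0..T}. \<forall>x\<in>D.
        dt T (\<lambda>s y. \<rho> s y *\<^sub>R u s y) t x
          + tensor_div (\<lambda>y. \<rho> t y *\<^sub>R outer (u t y) (u t y)) x + grad (p t) x = 0) \<and>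
     (\<forall>t\<in>{0..T}. \<forall>x\<in>D. diverg (u t) x = 0) \<and>
     transport_eq D T u \<rho>"

definition vorticity_system ::
  "(real^2) set \<Rightarrow> real \<Rightarrow> (real \<Rightarrow> real^2 \<Rightarrow> real^2) \<Rightarrow> (real \<Rightarrow> real^2 \<Rightarrow> real) \<Rightarrow>
    (real \<Rightarrow> real^2 \<Rightarrow> real) \<Rightarrow> bool" where
  "vorticity_system D T u \<rho> \<omega> \<longleftrightarrow>
     (\<forall>t\<in>{0..T}. \<forall>x\<in>D.
        dt T \<omega> t x + u t x \<bullet> grad (\<omega> t) x
          + cross2 (grad (\<lambda>y. (norm (u t y))\<^sup>2 / 2) x) (grad (\<rho> t) x) = 0) \<and>
     (\<forall>t\<in>{0..T}. \<exists>\<psi>. is_L_inv D (\<rho> t) (\<omega> t) \<psi> \<and> (\<forall>x\<in>D. u t x = perp_grad \<psi> x)) \<and>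
     transport_eq D T u \<rho>"

end

theory Submission
  imports Defs "HOL-Complex_Analysis.Riemann_Mapping"
begin

text \<open>
  Taking the curl of the momentum equation removes the pressure and, for \<open>div u = 0\<close>, produces exactly the
  vorticity equation; both directions therefore rest on a Poincare lemma that is smooth up to the
  boundary and smooth in time: a closed form on \<open>[0,T] \<times> closure D\<close> has a smooth potential. For fixed
  time the primitive is pulled back from the disc by the Riemann map. It is extended to the closure
  because smooth domains are locally quasiconvex, so that a function whose derivative extends
  continuously is itself \<open>C\<^sup>1\<close> up to the boundary. The time derivative of a potential is the potential of
  the time derivative of the form, which gives smoothness by induction.

  Applied to \<open>(u\<^sub>2, -u\<^sub>1)\<close> the potential is the stream function; it is constant on the connected frontier
  because \<open>u\<close> is tangential there. It is the only Dirichlet solution by the weak maximum principle, which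
  needs a positive lower bound for \<open>\<rho>\<close> at all times. That bound is a minimum principle for the transport
  equation: at a spatial minimum \<open>u \<bullet> \<nabla>\<rho> = 0\<close>, also at a boundary point since \<open>u\<close> is tangential.
\<close>

(* the import brings in a second meaning of $ *)
no_notation fps_nth (infixl \<open>$\<close> 75)

section \<open>Functions smooth up to the boundary\<close>

text \<open>At each fixed time a closed form has a potential only up to a constant, and an arbitrary
  choice of constants would be irregular in time. So potentials are normalised: \<open>P A B\<close>
  integrates \<open>A\<close> and \<open>B\<close> along paths from one base point that do not
  depend on time. Then \<open>P (Dt A) (Dt B)\<close> is exactly the time derivative of
  \<open>P A B\<close>, and the derivative of a potential is again built from \<open>A\<close>,
  \<open>B\<close> and a potential. The paths are images of radii under the inverse Riemann map.
  Their lengths are not controlled near the frontier, so local bounds on \<open>P\<close> come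
  instead from comparison with a nearby point of \<open>D\<close> along short paths. The equations
  are assumed on \<open>D\<close>, where \<open>pderiv_at\<close> is an ordinary derivative, and are
  carried to the closed cylinder by continuity. \<open>is_L_inv\<close> demands existence and
  uniqueness. Existence is read off from \<open>u\<close>: the stream function itself solves the
  Dirichlet problem. Conversely, \<open>u = perp_grad \<psi>\<close> yields
  \<open>div u = 0\<close>; the vorticity equation then says that \<open>mom\<close>, the momentum
  equation without pressure, is a closed form, and the pressure is a potential of its
  negative.\<close>

lemma Ck_on_cong:
  assumes "\<And>x. x \<in> S \<Longrightarrow> f x = g x" "Ck_on k S f"
  shows "Ck_on k S g"
proof (cases k)
  case 0
  then show ?thesis using assms continuous_on_cong by force
next
  case (Suc n)
  with assms(2) obtain f' where "\<forall>x\<in>S. (f has_derivative f' x) (at x within S)"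
    "\<forall>v. Ck_on n S (\<lambda>x. f' x v)" by auto
  moreover have "(g has_derivative f' x) (at x within S)"
    if "x \<in> S" "(f has_derivative f' x) (at x within S)" for x
    using has_derivative_transform[OF that(1) _ that(2)] assms(1) by simp
  ultimately show ?thesis unfolding Suc Ck_on.simps by blast
qed

lemma Ck_on_subset: "Ck_on k S f \<Longrightarrow> T \<subseteq> S \<Longrightarrow> Ck_on k T f"
proof (induction k arbitrary: f)
  case 0
  then show ?case using continuous_on_subset by auto
next
  case (Suc k)
  from Suc.prems(1) obtain f' where f': "\<forall>x\<in>S. (f has_derivative f' x) (at x within S)"
    "\<forall>v. Ck_on k S (\<lambda>x. f' x v)" by auto
  have "\<forall>x\<in>T. (f has_derivative f' x) (at x within T)"
    using f'(1) Suc.prems(2) has_derivative_subset by blast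
  moreover have "\<forall>v. Ck_on k T (\<lambda>x. f' x v)"
    using f'(2) Suc.IH Suc.prems(2) by blast
  ultimately show ?case by auto
qed

lemma Ck_on_imp_continuous_on: "Ck_on k S f \<Longrightarrow> continuous_on S f"
  by (cases k) (auto simp: continuous_on_eq_continuous_within dest: has_derivative_continuous)

lemma Ck_on_Suc_imp: "Ck_on (Suc k) S f \<Longrightarrow> Ck_on k S f"
proof (induction k arbitrary: f)
  case 0
  then show ?case using Ck_on_imp_continuous_on[OF 0] by simp
next
  case (Suc k)
  from Suc.prems obtain f' where "\<forall>x\<in>S. (f has_derivative f' x) (at x within S)"
    "\<forall>v. Ck_on (Suc k) S (\<lambda>x. f' x v)" by (subst (asm) Ck_on.simps(2)) blast
  then show ?case using Suc.IH by (subst Ck_on.simps(2)) blast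
qed

lemma Ck_on_const: "Ck_on k S (\<lambda>x. c)"
proof (induction k arbitrary: c)
  case (Suc k)
  then show ?case unfolding Ck_on.simps by (intro exI[of _ "\<lambda>x v. 0"]) simp
qed simp

lemma Ck_on_bounded_linear:
  assumes "bounded_linear h" "Ck_on k S f"
  shows "Ck_on k S (\<lambda>x. h (f x))"
  using assms(2)
proof (induction k arbitrary: f)
  case 0
  then show ?case using bounded_linear.continuous_on[OF assms(1)] by auto
next
  case (Suc k)
  then obtain f' where "\<forall>x\<in>S. (f has_derivative f' x) (at x within S)"
    "\<forall>v. Ck_on k S (\<lambda>x. f' x v)" by auto
  then show ?case using Suc.IH unfolding Ck_on.simps
    by (intro exI[of _ "\<lambda>x v. h (f' x v)"]) (simp add: bounded_linear.has_derivative[OF assms(1)])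
qed

lemma Ck_on_add:
  assumes "Ck_on k S f" "Ck_on k S g"
  shows "Ck_on k S (\<lambda>x. f x + g x)"
  using assms
proof (induction k arbitrary: f g)
  case 0
  then show ?case by (auto intro: continuous_intros)
next
  case (Suc k)
  then obtain f' g' where "\<forall>x\<in>S. (f has_derivative f' x) (at x within S)"
    "\<forall>v. Ck_on k S (\<lambda>x. f' x v)" "\<forall>x\<in>S. (g has_derivative g' x) (at x within S)"
    "\<forall>v. Ck_on k S (\<lambda>x. g' x v)" by auto
  then show ?case using Suc.IH unfolding Ck_on.simps
    by (intro exI[of _ "\<lambda>x v. f' x v + g' x v"]) (simp add: has_derivative_add)
qed

lemma Ck_on_bilinear:
  assumes "bounded_bilinear h" "Ck_on k S f" "Ck_on k S g"
  shows "Ck_on k S (\<lambda>x. h (f x) (g x))"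
  using assms(2,3)
proof (induction k arbitrary: f g)
  case 0
  then show ?case using bounded_bilinear.continuous_on[OF assms(1)] by auto
next
  case (Suc k)
  then obtain f' g' where *: "\<forall>x\<in>S. (f has_derivative f' x) (at x within S)"
    "\<forall>v. Ck_on k S (\<lambda>x. f' x v)" "\<forall>x\<in>S. (g has_derivative g' x) (at x within S)"
    "\<forall>v. Ck_on k S (\<lambda>x. g' x v)" by auto
  have "Ck_on k S f" "Ck_on k S g" using Suc.prems Ck_on_Suc_imp by blast+
  then show ?case using * Suc.IH unfolding Ck_on.simps(2)
    by (intro exI[of _ "\<lambda>x v. h (f x) (g' x v) + h (f' x v) (g x)"])
      (simp add: Ck_on_add bounded_bilinear.FDERIV[OF assms(1)])
qed

lemma smooth_on_const: "smooth_on S (\<lambda>x. c)"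
  by (simp add: smooth_on_def Ck_on_const)

lemma smooth_on_subset: "smooth_on S f \<Longrightarrow> T \<subseteq> S \<Longrightarrow> smooth_on T f"
  by (auto simp: smooth_on_def intro: Ck_on_subset[of _ S])

lemma smooth_on_bounded_linear: "bounded_linear h \<Longrightarrow> smooth_on S f \<Longrightarrow> smooth_on S (\<lambda>x. h (f x))"
  by (simp add: smooth_on_def Ck_on_bounded_linear)

lemma smooth_on_add: "smooth_on S f \<Longrightarrow> smooth_on S g \<Longrightarrow> smooth_on S (\<lambda>x. f x + g x)"
  by (simp add: smooth_on_def Ck_on_add)

lemma smooth_on_bilinear:
  "bounded_bilinear b \<Longrightarrow> smooth_on S f \<Longrightarrow> smooth_on S g \<Longrightarrow> smooth_on S (\<lambda>x. b (f x) (g x))"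
  by (simp add: smooth_on_def Ck_on_bilinear)

lemma smooth_on_uminus: "smooth_on S f \<Longrightarrow> smooth_on S (\<lambda>x. - f x)"
  using smooth_on_bounded_linear[OF bounded_linear_minus[OF bounded_linear_ident]] .

lemma smooth_on_diff: "smooth_on S f \<Longrightarrow> smooth_on S g \<Longrightarrow> smooth_on S (\<lambda>x. f x - g x)"
  using smooth_on_add[of S f "\<lambda>x. - g x"] smooth_on_uminus by auto

lemma smooth_on_mult:
  fixes f g :: "_ \<Rightarrow> 'a::real_normed_algebra"
  shows "smooth_on S f \<Longrightarrow> smooth_on S g \<Longrightarrow> smooth_on S (\<lambda>x. f x * g x)"
  by (rule smooth_on_bilinear[OF bounded_bilinear_mult])

lemma smooth_on_scaleR:
  fixes f :: "_ \<Rightarrow> real"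
  shows "smooth_on S f \<Longrightarrow> smooth_on S g \<Longrightarrow> smooth_on S (\<lambda>x. f x *\<^sub>R g x)"
  using smooth_on_bilinear[OF bounded_bilinear_scaleR] .

lemma smooth_on_nth: "smooth_on S f \<Longrightarrow> smooth_on S (\<lambda>x. f x $ i)"
  by (rule smooth_on_bounded_linear[OF bounded_linear_vec_nth])

lemmas smooth_intros = smooth_on_const smooth_on_add smooth_on_uminus smooth_on_diff smooth_on_mult
  smooth_on_scaleR smooth_on_nth

lemma smooth_on_imp_continuous_on: "smooth_on S f \<Longrightarrow> continuous_on S f"
  unfolding smooth_on_def using Ck_on_imp_continuous_on by blast

definition C1_deriv :: "'a::euclidean_space set \<Rightarrow> ('a \<Rightarrow> 'b::real_normed_vector) \<Rightarrow> ('a \<Rightarrow> 'a \<Rightarrow> 'b) \<Rightarrow> bool"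
  where "C1_deriv S f f' \<longleftrightarrow> (\<forall>x\<in>S. (f has_derivative f' x) (at x within S)) \<and>
    (\<forall>v. continuous_on S (\<lambda>x. f' x v))"

text \<open>At boundary points a derivative within \<open>S\<close> need not be unique; continuity up to the boundary
  is what pins it down.\<close>

definition ddir :: "'a::euclidean_space set \<Rightarrow> 'a \<Rightarrow> ('a \<Rightarrow> 'b::real_normed_vector) \<Rightarrow> 'a \<Rightarrow> 'b" where
  "ddir S v f x = (SOME f'. C1_deriv S f f') x v"

lemma Ck_on_1_iff: "Ck_on (Suc 0) S f \<longleftrightarrow> (\<exists>f'. C1_deriv S f f')"
  by (auto simp: C1_deriv_def)

lemma smooth_on_imp_C1: "smooth_on S f \<Longrightarrow> \<exists>f'. C1_deriv S f f'"
  unfolding smooth_on_def Ck_on_1_iff[symmetric] by blast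

lemma C1_deriv_ddir: "C1_deriv S f f' \<Longrightarrow> C1_deriv S f (\<lambda>x v. ddir S v f x)"
  unfolding ddir_def by (simp add: someI)

text \<open>Every point of \<open>S\<close> is a limit of interior points, where derivatives are
  unique. Hence a derivative that depends continuously on the point is unique on all of
  \<open>S\<close>, and \<open>ddir\<close> obeys the usual rules of calculus up to the
  boundary.\<close>

locale regular_set =
  fixes S :: "'a::euclidean_space set"
  assumes regular: "S \<subseteq> closure (interior S)"
begin

lemma eq_on_by_density:
  fixes f g :: "'a \<Rightarrow> 'b::real_normed_vector"
  assumes "continuous_on S f" "continuous_on S g" "\<And>x. x \<in> interior S \<Longrightarrow> f x = g x" "x \<in> S"
  shows "f x = g x"
proof -
  have c: "continuous_on S (\<lambda>x. f x - g x)" using assms by (auto intro: continuous_intros)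
  have "x \<in> closure (interior S)" using assms regular by auto
  then obtain z where z: "\<And>n. z n \<in> interior S" "z \<longlonglongrightarrow> x"
    unfolding closure_sequential by blast
  then have "(\<lambda>n. f (z n) - g (z n)) \<longlonglongrightarrow> f x - g x"
    using continuous_on_tendsto_compose[OF c z(2) assms(4)] interior_subset[of S] z(1)
    by (simp add: subset_iff)
  then have "f x - g x = 0" using z(1) assms(3) by (simp add: LIMSEQ_const_iff)
  then show ?thesis by simp
qed

lemma C1_deriv_unique:
  assumes "C1_deriv S f f'" "C1_deriv S f f''" "x \<in> S"
  shows "f' x v = f'' x v"
proof (rule eq_on_by_density[OF _ _ _ assms(3)])
  fix y assume y: "y \<in> interior S"
  then have "(f has_derivative f' y) (at y)" "(f has_derivative f'' y) (at y)"
    using assms(1,2) interior_subset unfolding C1_deriv_def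
    by (metis at_within_interior subsetD)+
  then show "f' y v = f'' y v" using has_derivative_unique by metis
qed (use assms in \<open>auto simp: C1_deriv_def\<close>)

lemma ddir_eq: "C1_deriv S f f' \<Longrightarrow> x \<in> S \<Longrightarrow> ddir S v f x = f' x v"
  using C1_deriv_unique[OF C1_deriv_ddir] by blast

lemma smooth_on_C1_deriv: "smooth_on S f \<Longrightarrow> C1_deriv S f (\<lambda>x v. ddir S v f x)"
  using smooth_on_imp_C1 C1_deriv_ddir by blast

lemma ddir_has_derivative:
  "smooth_on S f \<Longrightarrow> x \<in> S \<Longrightarrow> (f has_derivative (\<lambda>v. ddir S v f x)) (at x within S)"
  using smooth_on_C1_deriv by (auto simp: C1_deriv_def)

text \<open>Each order \<open>k\<close> in \<open>smooth_on\<close> may come with a derivative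
  \<open>f'\<close> of its own. Uniqueness identifies them all with the one function
  \<open>ddir S v f\<close>, which therefore has every order of smoothness.\<close>

lemma smooth_on_ddir: assumes "smooth_on S f" shows "smooth_on S (ddir S v f)"
  unfolding smooth_on_def
proof
  fix k
  have "Ck_on (Suc k) S f" using assms by (auto simp: smooth_on_def)
  then obtain f' where f': "\<forall>x\<in>S. (f has_derivative f' x) (at x within S)"
    "\<forall>v. Ck_on k S (\<lambda>x. f' x v)" by auto
  then have "C1_deriv S f f'" unfolding C1_deriv_def using Ck_on_imp_continuous_on by blast
  then have "f' x v = ddir S v f x" if "x \<in> S" for x
    using ddir_eq[OF _ that, symmetric] by blast
  then show "Ck_on k S (ddir S v f)" using f'(2) Ck_on_cong[of S "\<lambda>x. f' x v"] by simp
qed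

lemma ddir_cong:
  assumes "smooth_on S f" "\<And>x. x \<in> S \<Longrightarrow> f x = g x" "x \<in> S"
  shows "ddir S v f x = ddir S v g x"
proof -
  have "C1_deriv S g (\<lambda>x v. ddir S v f x)"
    using smooth_on_C1_deriv[OF assms(1)] has_derivative_transform[of _ S g f] assms(2)
    unfolding C1_deriv_def by simp
  then show ?thesis using ddir_eq[OF _ assms(3), symmetric] by blast
qed

lemma ddir_linear:
  assumes "smooth_on S f" "x \<in> S"
  shows "ddir S (a *\<^sub>R v + b *\<^sub>R w) f x = a *\<^sub>R ddir S v f x + b *\<^sub>R ddir S w f x"
  using linear_add[OF has_derivative_linear[OF ddir_has_derivative[OF assms]], of "a *\<^sub>R v" "b *\<^sub>R w"]
    linear_cmul[OF has_derivative_linear[OF ddir_has_derivative[OF assms]]] by simp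

lemma ddir_add:
  assumes "smooth_on S f" "smooth_on S g" "x \<in> S"
  shows "ddir S v (\<lambda>x. f x + g x) x = ddir S v f x + ddir S v g x"
  using smooth_on_C1_deriv[OF assms(1)] smooth_on_C1_deriv[OF assms(2)] 
  by (intro ddir_eq[OF _ assms(3), where f'="\<lambda>x v. ddir S v f x + ddir S v g x"])
    (simp add: C1_deriv_def has_derivative_add continuous_on_add)

lemma ddir_bounded_linear:
  assumes "smooth_on S f" "bounded_linear h" "x \<in> S"
  shows "ddir S v (\<lambda>x. h (f x)) x = h (ddir S v f x)"
  using smooth_on_C1_deriv[OF assms(1)] assms(2)
  by (intro ddir_eq[OF _ assms(3), where f'="\<lambda>x v. h (ddir S v f x)"])
    (simp add: C1_deriv_def bounded_linear.has_derivative[of h] bounded_linear.continuous_on[of h])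

lemma ddir_uminus:
  assumes "smooth_on S f" "x \<in> S"
  shows "ddir S v (\<lambda>x. - f x) x = - ddir S v f x"
  using ddir_bounded_linear[OF assms(1) bounded_linear_minus[OF bounded_linear_ident] assms(2)] .

lemma ddir_diff:
  assumes "smooth_on S f" "smooth_on S g" "x \<in> S"
  shows "ddir S v (\<lambda>x. f x - g x) x = ddir S v f x - ddir S v g x"
  using ddir_add[OF assms(1) smooth_on_uminus[OF assms(2)] assms(3)]
    ddir_uminus[OF assms(2,3)] by auto

lemma ddir_const: "x \<in> S \<Longrightarrow> ddir S v (\<lambda>x. c) x = 0"
  by (rule ddir_eq) (auto simp: C1_deriv_def)

lemma ddir_mult:
  fixes f g :: "'a \<Rightarrow> real"
  assumes "smooth_on S f" "smooth_on S g" "x \<in> S"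
  shows "ddir S v (\<lambda>x. f x * g x) x = f x * ddir S v g x + ddir S v f x * g x"
  using smooth_on_C1_deriv[OF assms(1)] smooth_on_C1_deriv[OF assms(2)] 
    smooth_on_imp_continuous_on[OF assms(1)] smooth_on_imp_continuous_on[OF assms(2)] 
  by (intro ddir_eq[OF _ assms(3), where f'="\<lambda>x v. f x * ddir S v g x + ddir S v f x * g x"])
    (auto simp: C1_deriv_def has_derivative_mult[of f _ _ S g] continuous_on_add continuous_on_mult)

end

section \<open>Symmetry of mixed second derivatives\<close>

lemma second_difference_mvt:
  fixes f :: "real \<Rightarrow> real \<Rightarrow> real"
  assumes "h > 0"
    and 1: "\<And>s t. s \<in> {0..h} \<Longrightarrow> t \<in> {0..h} \<Longrightarrow> ((\<lambda>s. f s t) has_real_derivative f1 s t) (at s)"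
    and 2: "\<And>s t. s \<in> {0..h} \<Longrightarrow> t \<in> {0..h} \<Longrightarrow> ((\<lambda>t. f1 s t) has_real_derivative f12 s t) (at t)"
  shows "\<exists>s\<in>{0..h}. \<exists>t\<in>{0..h}. f h h - f h 0 - f 0 h + f 0 0 = h * h * f12 s t"
proof -
  have "((\<lambda>s. f s h - f s 0) has_real_derivative f1 s h - f1 s 0) (at s)" if "0 \<le> s" "s \<le> h" for s
    using assms(1) that by (intro DERIV_diff 1) auto
  from MVT2[OF assms(1) this] obtain s
    where s: "0 < s" "s < h" "(f h h - f h 0) - (f 0 h - f 0 0) = (h - 0) * (f1 s h - f1 s 0)"
    by blast
  have "((\<lambda>t. f1 s t) has_real_derivative f12 s t) (at t)" if "0 \<le> t" "t \<le> h" for t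
    using s that by (intro 2) auto
  from MVT2[OF assms(1) this] obtain t where t: "0 < t" "t < h" "f1 s h - f1 s 0 = (h - 0) * f12 s t"
    by blast
  have "f h h - f h 0 - f 0 h + f 0 0 = h * h * f12 s t"
    using s(3) t(3) by (simp add: algebra_simps)
  then show ?thesis using s t by (intro bexI[of _ s] bexI[of _ t]) auto
qed

text \<open>The second difference of \<open>f\<close> over the parallelogram spanned by
  \<open>h *\<^sub>R v\<close> and \<open>h *\<^sub>R w\<close> equals \<open>h * h\<close> times
  either mixed derivative, each taken at some point of the parallelogram. If the two mixed
  derivatives differed at \<open>x\<close>, a small parallelogram would contradict their
  continuity.\<close>

lemma symmetric_second_derivative:
  fixes f :: "'a::real_normed_vector \<Rightarrow> real"
  assumes "open U" "x \<in> U"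
    and f: "\<And>y. y \<in> U \<Longrightarrow> (f has_derivative f' y) (at y)"
    and v: "\<And>y. y \<in> U \<Longrightarrow> ((\<lambda>y. f' y v) has_derivative fv y) (at y)"
    and w: "\<And>y. y \<in> U \<Longrightarrow> ((\<lambda>y. f' y w) has_derivative fw y) (at y)"
    and cv: "continuous_on U (\<lambda>y. fv y w)" and cw: "continuous_on U (\<lambda>y. fw y v)"
  shows "fv x w = fw x v"
proof (rule ccontr)
  assume ne: "fv x w \<noteq> fw x v"
  define e where "e = \<bar>fv x w - fw x v\<bar> / 2"
  have e: "e > 0" using ne by (simp add: e_def)
  obtain d0 where d0: "d0 > 0" "ball x d0 \<subseteq> U" using assms(1,2) openE by blast
  obtain d1 where d1: "d1 > 0" "\<And>y. y \<in> U \<Longrightarrow> dist y x < d1 \<Longrightarrow> dist (fv y w) (fv x w) < e"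
    using cv e assms(2) unfolding continuous_on_iff by metis
  obtain d2 where d2: "d2 > 0" "\<And>y. y \<in> U \<Longrightarrow> dist y x < d2 \<Longrightarrow> dist (fw y v) (fw x v) < e"
    using cw e assms(2) unfolding continuous_on_iff by metis
  define d where "d = min d0 (min d1 d2)"
  have d: "d > 0" using d0 d1 d2 by (simp add: d_def)
  \<comment> \<open>With this \<open>h\<close> the whole parallelogram lies within \<open>d\<close>
    of \<open>x\<close>; the summand 1 keeps the denominator positive when \<open>v\<close> and
    \<open>w\<close> vanish.\<close>
  define h where "h = d / (2 * (norm v + norm w + 1))"
  have N: "norm v + norm w + 1 > 0" by (smt (verit) norm_ge_zero)
  have h: "h > 0" using d N by (simp add: h_def)
  have hb: "h * (norm v + norm w) < d"
  proof -
    have "h * (norm v + norm w) \<le> h * (norm v + norm w + 1)" using h by (simp add: algebra_simps)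
    also have "\<dots> = d / 2" using N by (simp add: h_def field_simps less_imp_neq[symmetric])
    finally show ?thesis using d by linarith
  qed
  define p where "p s t = x + s *\<^sub>R v + t *\<^sub>R w" for s t
  have pd: "dist (p s t) x < d" if "s \<in> {0..h}" "t \<in> {0..h}" for s t
  proof -
    have "dist (p s t) x = norm (s *\<^sub>R v + t *\<^sub>R w)" by (simp add: p_def dist_norm algebra_simps)
    also have "\<dots> \<le> s * norm v + t * norm w" using that by (metis abs_of_nonneg atLeastAtMost_iff norm_scaleR norm_triangle_ineq)
    also have "\<dots> \<le> h * norm v + h * norm w" using that by (auto intro!: add_mono mult_right_mono)
    finally show ?thesis using hb by (simp add: algebra_simps)
  qed
  have pU: "p s t \<in> U" if "s \<in> {0..h}" "t \<in> {0..h}" for s t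
    using pd[OF that] d0 by (auto simp: d_def dist_commute)
  have ps: "((\<lambda>s. p s t) has_derivative (\<lambda>r. r *\<^sub>R v)) (at s within A)" for s t A
    unfolding p_def by (auto intro!: derivative_eq_intros)
  have pt: "((\<lambda>t. p s t) has_derivative (\<lambda>r. r *\<^sub>R w)) (at t within A)" for s t A
    unfolding p_def by (auto intro!: derivative_eq_intros)
  have ch: "((\<lambda>r. F (q r)) has_real_derivative (F' z)) (at r within A)"
    if "(F has_derivative F') (at (q r))" "(q has_derivative (\<lambda>r. r *\<^sub>R z)) (at r within A)"
    for F :: "'a \<Rightarrow> real" and F' q r z A
  proof -
    have "((\<lambda>r. F (q r)) has_derivative (\<lambda>r. F' (r *\<^sub>R z))) (at r within A)"
      using has_derivative_in_compose[OF that(2) has_derivative_at_withinI[OF that(1)]] .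
    moreover have "(\<lambda>r. F' (r *\<^sub>R z)) = (*) (F' z)"
      using linear_cmul[OF has_derivative_linear[OF that(1)]] by (auto simp: mult.commute)
    ultimately show ?thesis by (simp add: has_field_derivative_def)
  qed
  have "\<exists>s\<in>{0..h}. \<exists>t\<in>{0..h}. f (p h h) - f (p h 0) - f (p 0 h) + f (p 0 0) = h * h * fv (p s t) w"
  proof (rule second_difference_mvt[OF h])
    fix s t assume st: "s \<in> {0..h}" "t \<in> {0..h}"
    show "((\<lambda>s. f (p s t)) has_real_derivative f' (p s t) v) (at s)"
      by (rule ch[OF f[OF pU[OF st]] ps])
    show "((\<lambda>t. f' (p s t) v) has_real_derivative fv (p s t) w) (at t)"
      by (rule ch[OF v[OF pU[OF st]] pt])
  qed
  then obtain s t where st: "s\<in>{0..h}" "t\<in>{0..h}"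
    "f (p h h) - f (p h 0) - f (p 0 h) + f (p 0 0) = h * h * fv (p s t) w" by blast
  have "\<exists>t\<in>{0..h}. \<exists>s\<in>{0..h}. f (p h h) - f (p 0 h) - f (p h 0) + f (p 0 0) = h * h * fw (p s t) v"
  proof (rule second_difference_mvt[OF h])
    fix t s assume st: "t \<in> {0..h}" "s \<in> {0..h}"
    show "((\<lambda>t. f (p s t)) has_real_derivative f' (p s t) w) (at t)"
      by (rule ch[OF f[OF pU[OF st(2,1)]] pt])
    show "((\<lambda>s. f' (p s t) w) has_real_derivative fw (p s t) v) (at s)"
      by (rule ch[OF w[OF pU[OF st(2,1)]] ps])
  qed
  then obtain s' t' where st': "s'\<in>{0..h}" "t'\<in>{0..h}"
    "f (p h h) - f (p 0 h) - f (p h 0) + f (p 0 0) = h * h * fw (p s' t') v" by blast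
  have "h * h * fv (p s t) w = h * h * fw (p s' t') v" using st st' by linarith
  then have "fv (p s t) w = fw (p s' t') v" using h by simp
  moreover have "dist (fv (p s t) w) (fv x w) < e"
    using d1(2)[OF pU[OF st(1,2)]] pd[OF st(1,2)] by (simp add: d_def)
  moreover have "dist (fw (p s' t') v) (fw x v) < e"
    using d2(2)[OF pU[OF st'(1,2)]] pd[OF st'(1,2)] by (simp add: d_def)
  ultimately have "\<bar>fv x w - fw x v\<bar> < 2 * e" unfolding dist_real_def by linarith
  then show False by (simp add: e_def)
qed

context regular_set begin

lemma ddir_commute:
  fixes f :: "'a \<Rightarrow> real"
  assumes "smooth_on S f" "x \<in> S"
  shows "ddir S v (ddir S w f) x = ddir S w (ddir S v f) x"
proof (rule eq_on_by_density[OF _ _ _ assms(2)])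
  have int: "(g has_derivative (\<lambda>v. ddir S v g y)) (at y)" if "smooth_on S g" "y \<in> interior S"
    for g :: "'a \<Rightarrow> real" and y
    using ddir_has_derivative[OF that(1)] that(2) at_within_interior[OF that(2)] interior_subset
    by (metis subsetD)
  note sm = assms(1) smooth_on_ddir[OF assms(1)] smooth_on_ddir[OF smooth_on_ddir[OF assms(1)]]
  have c: "continuous_on S (ddir S v (ddir S w f))" for v w
    using sm(3) smooth_on_imp_continuous_on by blast
  show "ddir S v (ddir S w f) y = ddir S w (ddir S v f) y" if "y \<in> interior S" for y
    by (rule symmetric_second_derivative[OF open_interior that int[OF sm(1)] int[OF sm(2)] int[OF sm(2)]])
      (rule continuous_on_subset[OF c interior_subset] | assumption)+
qed (rule smooth_on_imp_continuous_on[OF smooth_on_ddir[OF smooth_on_ddir[OF assms(1)]]])+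

end

section \<open>Closed forms on simply connected domains\<close>

text \<open>\<open>H x\<close> is the integral of the form along the segment from 0 to
  \<open>x\<close>. Differentiation under the integral in direction \<open>v\<close> produces
  \<open>s * \<omega>' (s *\<^sub>R x) v x + \<omega> (s *\<^sub>R x) v\<close>. By
  \<open>sym\<close> this is the derivative in \<open>s\<close> of
  \<open>s * \<omega> (s *\<^sub>R x) v\<close>, whose increment over [0,1] is
  \<open>\<omega> x v\<close>.\<close>

lemma poincare_lemma_convex:
  fixes \<omega> :: "'a::euclidean_space \<Rightarrow> 'a \<Rightarrow> real"
  assumes "open U" "convex U" "0 \<in> U"
    and lin: "\<And>x. x \<in> U \<Longrightarrow> linear (\<omega> x)"
    and d: "\<And>x v. x \<in> U \<Longrightarrow> ((\<lambda>x. \<omega> x v) has_derivative (\<lambda>z. \<omega>' x z v)) (at x)"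
    and cont: "\<And>v z. continuous_on U (\<lambda>x. \<omega>' x z v)"
    and sym: "\<And>x v z. x \<in> U \<Longrightarrow> \<omega>' x z v = \<omega>' x v z"
  obtains H where "\<And>x. x \<in> U \<Longrightarrow> (H has_derivative \<omega> x) (at x)"
proof -
  have expand: "\<omega> x v = (\<Sum>b\<in>Basis. (v \<bullet> b) * \<omega> x b)" if "x \<in> U" for x v
  proof -
    have "\<omega> x v = \<omega> x (\<Sum>b\<in>Basis. (v \<bullet> b) *\<^sub>R b)" by (simp add: euclidean_representation)
    also have "\<dots> = (\<Sum>b\<in>Basis. (v \<bullet> b) * \<omega> x b)"
      using lin[OF that] by (simp add: linear_sum linear_cmul)
    finally show ?thesis .
  qed
  have lin1: "linear (\<lambda>z. \<omega>' x z v)" if "x \<in> U" for x v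
    using d[OF that] by (rule has_derivative_linear)
  have lin2: "linear (\<lambda>v. \<omega>' x z v)" if "x \<in> U" for x z
    using lin1[OF that, of z] sym[OF that] by simp
  have expand': "\<omega>' x z v = (\<Sum>b\<in>Basis. (v \<bullet> b) * \<omega>' x z b)" if "x \<in> U" for x v z
  proof -
    have "\<omega>' x z v = \<omega>' x z (\<Sum>b\<in>Basis. (v \<bullet> b) *\<^sub>R b)" by (simp add: euclidean_representation)
    also have "\<dots> = (\<Sum>b\<in>Basis. (v \<bullet> b) * \<omega>' x z b)"
      using lin2[OF that] by (simp add: linear_sum linear_cmul)
    finally show ?thesis .
  qed
  have inU: "s *\<^sub>R x \<in> U" if "x \<in> U" "s \<in> {0..1}" for s x
    using convexD_alt[OF assms(2,3) that(1), of s] that(2) by simp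
  have c\<omega>: "continuous_on U (\<lambda>x. \<omega> x v)" for v
    using d has_derivative_continuous at_within_open[OF _ assms(1)]
    by (metis continuous_at_imp_continuous_on)
  \<comment> \<open>The derivative of the integrand in \<open>x\<close>, as the bounded linear
    function that \<open>leibniz_rule\<close> asks for. Written over \<open>Basis\<close>, its joint
    continuity in \<open>x\<close> and \<open>s\<close> reduces to that of real functions.\<close>
  define fx where "fx x s = s *\<^sub>R (\<Sum>b\<in>Basis. (\<omega>' (s *\<^sub>R x) b x) *\<^sub>R blinfun_inner_left b) 
      + (\<Sum>b\<in>Basis. (\<omega> (s *\<^sub>R x) b) *\<^sub>R blinfun_inner_left b)" for x :: 'a and s :: real
  have fx: "blinfun_apply (fx x s) v = s * \<omega>' (s *\<^sub>R x) v x + \<omega> (s *\<^sub>R x) v"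
    if "x \<in> U" "s \<in> {0..1}" for x s v
  proof -
    have "\<omega>' (s *\<^sub>R x) v x = (\<Sum>b\<in>Basis. (v \<bullet> b) * \<omega>' (s *\<^sub>R x) b x)"
      using expand'[OF inU[OF that], of x v] sym[OF inU[OF that]] by simp
    then show ?thesis
      by (simp add: fx_def expand[OF inU[OF that], of v] blinfun.bilinear_simps blinfun_inner_left.rep_eq
          blinfun.sum_left mult.commute inner_commute)
  qed
  define H where "H x = integral (cbox 0 1) (\<lambda>s. \<omega> (s *\<^sub>R x) x)" for x
  have cs: "continuous_on (U \<times> cbox 0 1) (\<lambda>(x, s). g (s *\<^sub>R x))" if "continuous_on U g" 
    for g :: "'a \<Rightarrow> real"
    unfolding split_beta
    by (rule continuous_on_compose2[OF that]) (auto intro!: continuous_intros inU)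
  have csw: "continuous_on {0..1} (\<lambda>s. g (s *\<^sub>R x))" if "continuous_on U g" "x \<in> U"
    for g :: "'a \<Rightarrow> real" and x
    by (rule continuous_on_compose2[OF that(1)]) (auto intro!: continuous_intros inU that)
  have "(H has_derivative integral (cbox 0 1) (fx x)) (at x within U)" if x: "x \<in> U" for x
    unfolding H_def
  proof (rule leibniz_rule)
    fix y s assume ys: "y \<in> U" "s \<in> cbox (0::real) 1"
    then have s: "s \<in> {0..1}" by simp
    have 1: "((\<lambda>y. \<omega> (s *\<^sub>R y) b) has_derivative (\<lambda>z. \<omega>' (s *\<^sub>R y) (s *\<^sub>R z) b)) (at y within U)" for b
      by (rule has_derivative_compose[where f="\<lambda>y. s *\<^sub>R y" and f'="\<lambda>z. s *\<^sub>R z" and g="\<lambda>y. \<omega> y b"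
            and g'="\<lambda>z. \<omega>' (s *\<^sub>R y) z b", OF _ d[OF inU[OF ys(1) s]]])
         (auto intro!: derivative_eq_intros)
    have "((\<lambda>y. \<Sum>b\<in>Basis. (y \<bullet> b) * \<omega> (s *\<^sub>R y) b) has_derivative
        (\<lambda>z. \<Sum>b\<in>Basis. (y \<bullet> b) * \<omega>' (s *\<^sub>R y) (s *\<^sub>R z) b + (z \<bullet> b) * \<omega> (s *\<^sub>R y) b)) (at y within U)"
      by (intro has_derivative_sum has_derivative_mult 1 has_derivative_inner_left has_derivative_ident)
    moreover have "(\<lambda>z. \<Sum>b\<in>Basis. (y \<bullet> b) * \<omega>' (s *\<^sub>R y) (s *\<^sub>R z) b + (z \<bullet> b) * \<omega> (s *\<^sub>R y) b) =
        blinfun_apply (fx y s)"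
    proof
      fix z
      have "(\<Sum>b\<in>Basis. (y \<bullet> b) * \<omega>' (s *\<^sub>R y) (s *\<^sub>R z) b + (z \<bullet> b) * \<omega> (s *\<^sub>R y) b)
        = s * (\<Sum>b\<in>Basis. (y \<bullet> b) * \<omega>' (s *\<^sub>R y) z b) + (\<Sum>b\<in>Basis. (z \<bullet> b) * \<omega> (s *\<^sub>R y) b)"
        using linear_cmul[OF lin1[OF inU[OF ys(1) s]]]
        by (simp add: sum.distrib sum_distrib_left mult.left_commute)
      also have "\<dots> = blinfun_apply (fx y s) z"
        by (simp only: fx[OF ys(1) s] expand'[OF inU[OF ys(1) s], symmetric] expand[OF inU[OF ys(1) s], symmetric])
      finally show "(\<Sum>b\<in>Basis. (y \<bullet> b) * \<omega>' (s *\<^sub>R y) (s *\<^sub>R z) b + (z \<bullet> b) * \<omega> (s *\<^sub>R y) b)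
        = blinfun_apply (fx y s) z" .
    qed
    ultimately have "((\<lambda>y. \<Sum>b\<in>Basis. (y \<bullet> b) * \<omega> (s *\<^sub>R y) b) has_derivative
        blinfun_apply (fx y s)) (at y within U)" by (simp only:)
    then show "((\<lambda>y. \<omega> (s *\<^sub>R y) y) has_derivative blinfun_apply (fx y s)) (at y within U)"
      by (rule has_derivative_transform[OF ys(1), rotated])
        (simp add: expand[OF inU[OF _ s]])
  next
    fix y assume y: "y \<in> U"
    have "continuous_on {0..1} (\<lambda>s. \<omega> (s *\<^sub>R y) y)" by (rule csw[OF c\<omega> y])
    then show "(\<lambda>s. \<omega> (s *\<^sub>R y) y) integrable_on cbox 0 1"
      by (simp add: integrable_continuous_interval)
  next
    have "continuous_on (U \<times> cbox 0 1) (\<lambda>z. \<Sum>c\<in>Basis. (fst z \<bullet> c) * (case z of (x, s) \<Rightarrow> \<omega>' (s *\<^sub>R x) b c))"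
      for b by (intro continuous_intros cs cont)
    then have *: "continuous_on (U \<times> cbox 0 1) (\<lambda>z. (case z of (x, s) \<Rightarrow> \<omega>' (s *\<^sub>R x) b x))" for b
      by (rule continuous_on_eq) (auto simp: expand'[OF inU])
    have "continuous_on (U \<times> cbox 0 1) (\<lambda>z. 
        snd z *\<^sub>R (\<Sum>b\<in>Basis. (case z of (x, s) \<Rightarrow> \<omega>' (s *\<^sub>R x) b x) *\<^sub>R blinfun_inner_left b) 
      + (\<Sum>b\<in>Basis. (case z of (x, s) \<Rightarrow> \<omega> (s *\<^sub>R x) b) *\<^sub>R blinfun_inner_left b))"
      by (intro continuous_intros cs c\<omega> *)
    then show "continuous_on (U \<times> cbox 0 1) (\<lambda>(x, s). fx x s)"
      by (simp add: fx_def split_beta)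
  qed (use x assms in auto)
  moreover have "blinfun_apply (integral (cbox 0 1) (fx x)) v = \<omega> x v" if x: "x \<in> U" for x v
  proof -
    have *: "continuous_on {0..1} (\<lambda>s. \<omega>' (s *\<^sub>R x) b x)" for b
      by (rule csw[OF cont x])
    have "continuous_on {0..1} (fx x)" unfolding fx_def
      by (intro continuous_intros * csw[OF c\<omega> x])
    then have "fx x integrable_on cbox 0 1" by (simp add: integrable_continuous_interval)
    then have "blinfun_apply (integral (cbox 0 1) (fx x)) v = integral {0..1} (\<lambda>s. blinfun_apply (fx x s) v)"
      using integral_linear[of "fx x" "cbox 0 1" "\<lambda>f. blinfun_apply f v"]
      by (simp add: o_def blinfun.bounded_linear_left)
    also have "\<dots> = integral {0..1} (\<lambda>s. s * \<omega>' (s *\<^sub>R x) x v + \<omega> (s *\<^sub>R x) v)"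
      by (rule integral_cong) (simp add: fx[OF x] sym[OF inU[OF x]])
    also have "((\<lambda>s. s * \<omega>' (s *\<^sub>R x) x v + \<omega> (s *\<^sub>R x) v) has_integral (1 * \<omega> (1 *\<^sub>R x) v - 0 * \<omega> (0 *\<^sub>R x) v)) {0..1}"
    proof (rule fundamental_theorem_of_calculus)
      fix s :: real assume s: "s \<in> {0..1}"
      have "((\<lambda>s. \<omega> (s *\<^sub>R x) v) has_derivative (\<lambda>r. \<omega>' (s *\<^sub>R x) (r *\<^sub>R x) v)) (at s within {0..1})"
        by (rule has_derivative_compose[where f="\<lambda>s. s *\<^sub>R x" and f'="\<lambda>r. r *\<^sub>R x" and g="\<lambda>y. \<omega> y v"
            and g'="\<lambda>z. \<omega>' (s *\<^sub>R x) z v", OF _ d[OF inU[OF x s]]])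
          (auto intro!: derivative_eq_intros)
      then have "((\<lambda>s. \<omega> (s *\<^sub>R x) v) has_real_derivative \<omega>' (s *\<^sub>R x) x v) (at s within {0..1})"
        using linear_cmul[OF lin1[OF inU[OF x s]]] by (simp add: has_field_derivative_def mult_commute_abs)
      then show "((\<lambda>s. s * \<omega> (s *\<^sub>R x) v) has_vector_derivative s * \<omega>' (s *\<^sub>R x) x v + \<omega> (s *\<^sub>R x) v) (at s within {0..1})"
        unfolding has_real_derivative_iff_has_vector_derivative[symmetric]
        by (auto intro!: derivative_eq_intros)
    qed simp
    then have "integral {0..1} (\<lambda>s. s * \<omega>' (s *\<^sub>R x) x v + \<omega> (s *\<^sub>R x) v) = \<omega> x v" by auto
    finally show ?thesis .
  qed
  ultimately have "(H has_derivative \<omega> x) (at x)" if "x \<in> U" for x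
    using that at_within_open[OF that assms(1)] by (metis (no_types, lifting) ext)
  then show thesis using that by blast
qed

section \<open>The plane as the complex plane, and the Riemann map\<close>

definition to_complex :: "real^2 \<Rightarrow> complex" where "to_complex x = Complex (x $ 1) (x $ 2)"
definition of_complex2 :: "complex \<Rightarrow> real^2" where "of_complex2 z = vector [Re z, Im z]"

lemma to_of_complex [simp]: "to_complex (of_complex2 z) = z" "of_complex2 (to_complex x) = x"
  by (auto simp: to_complex_def of_complex2_def vec_eq_iff forall_2 complex_eq_iff)

lemma of_complex2_nth [simp]: "of_complex2 z $ 1 = Re z" "of_complex2 z $ 2 = Im z"
  by (auto simp: of_complex2_def)

lemma linear_to_complex: "linear to_complex" and linear_of_complex2: "linear of_complex2"
  by (auto simp: to_complex_def of_complex2_def vec_eq_iff forall_2 complex_eq_iff intro!: linearI)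

lemma bounded_linear_to_complex: "bounded_linear to_complex"
  and bounded_linear_of_complex2: "bounded_linear of_complex2"
  using linear_to_complex linear_of_complex2 linear_conv_bounded_linear by blast+

lemma homeomorphism_to_complex: "homeomorphism S (to_complex ` S) to_complex of_complex2"
  by (auto simp: homeomorphism_def image_image
    intro!: linear_continuous_on bounded_linear_to_complex bounded_linear_of_complex2)

lemma open_to_complex: "open S \<Longrightarrow> open (to_complex ` S)"
proof -
  assume "open S"
  moreover have "to_complex ` S = of_complex2 -` S" by (auto simp: image_iff) (metis to_of_complex(1))
  ultimately show ?thesis
    using open_vimage[of S of_complex2] linear_continuous_on[OF bounded_linear_of_complex2] by simp
qed

lemma simply_connected_to_complex: "simply_connected S \<Longrightarrow> simply_connected (to_complex ` S)"
  using homeomorphic_simply_connected homeomorphism_to_complex homeomorphic_def by blast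

lemma closure_to_complex: "closure (to_complex ` S) = to_complex ` closure S"
  by (rule closure_injective_linear_image[symmetric, OF linear_to_complex])
    (metis injI to_of_complex(2))

lemma bounded_to_complex: "bounded S \<Longrightarrow> bounded (to_complex ` S)"
  by (rule bounded_linear_image[OF _ bounded_linear_to_complex])

text \<open>For bounded open sets of the complex plane the frontier characterisation of simple
  connectedness gives this; it is transported through \<open>to_complex\<close>. It turns the
  locally constant boundary value of the stream function into a constant.\<close>

lemma connected_frontier_simply_connected:
  fixes D :: "(real^2) set"
  assumes "open D" "bounded D" "simply_connected D"
  shows "connected (frontier D)"
proof -
  have "connected (frontier (to_complex ` D))"
    using simply_connected_eq_frontier_properties[OF open_to_complex[OF assms(1)]]
      simply_connected_to_complex[OF assms(3)] bounded_to_complex[OF assms(2)] by auto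
  moreover have "frontier (to_complex ` D) = to_complex ` frontier D"
    using open_to_complex[OF assms(1)] assms(1) inj_on_image_set_diff[of to_complex UNIV "closure D" D]
    by (simp add: frontier_def interior_open closure_to_complex) (metis injI to_of_complex(2))
  moreover have "frontier D = of_complex2 ` to_complex ` frontier D" by (auto simp: image_image)
  ultimately show ?thesis
    using connected_continuous_image[OF linear_continuous_on[OF bounded_linear_of_complex2]] by metis
qed

text \<open>Boundedness excludes the whole plane, so the Riemann mapping theorem provides a
  biholomorphic map onto the disc.\<close>

lemma riemann_map_plane:
  fixes D :: "(real^2) set"
  assumes "open D" "bounded D" "simply_connected D" "D \<noteq> {}"
  obtains f g where "f holomorphic_on (to_complex ` D)" "g holomorphic_on ball 0 1"
    "\<And>x. x \<in> D \<Longrightarrow> f (to_complex x) \<in> ball 0 1" "\<And>x. x \<in> D \<Longrightarrow> g (f (to_complex x)) = to_complex x"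
    "\<And>z. z \<in> ball 0 1 \<Longrightarrow> of_complex2 (g z) \<in> D" "\<And>z. z \<in> ball 0 1 \<Longrightarrow> f (g z) = z"
proof -
  have "to_complex ` D \<noteq> UNIV" using bounded_to_complex[OF assms(2)] not_bounded_UNIV by metis
  then obtain f g where "f holomorphic_on (to_complex ` D)" "g holomorphic_on ball 0 1"
    "\<forall>z\<in>to_complex ` D. f z \<in> ball 0 1 \<and> g (f z) = z" "\<forall>z\<in>ball 0 1. g z \<in> to_complex ` D \<and> f (g z) = z"
    using Riemann_mapping_theorem[THEN iffD1, OF conjI, OF open_to_complex[OF assms(1)]
      simply_connected_to_complex[OF assms(3)]] assms(4) by (elim disjE) (simp, blast, blast)
  note fg = this
  have "of_complex2 (g z) \<in> D" if "z \<in> ball 0 1" for z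
    using fg(4) that by (metis imageE to_of_complex(2))
  then show thesis using fg by (intro that[of f g]) auto
qed

lemma linear_vec2:
  fixes L :: "real^2 \<Rightarrow> real"
  assumes "linear L"
  shows "L v = v $ 1 * L (axis 1 1) + v $ 2 * L (axis 2 1)"
proof -
  have "v = v $ 1 *\<^sub>R axis 1 1 + v $ 2 *\<^sub>R axis 2 1" by (simp add: vec_eq_iff forall_2 axis_def)
  then have "L v = L (v $ 1 *\<^sub>R axis 1 1 + v $ 2 *\<^sub>R axis 2 1)" by simp
  then show ?thesis using assms by (simp add: linear_add linear_cmul)
qed

text \<open>The form is pulled back to the disc by \<open>\<phi>\<close>, the inverse Riemann map;
  the disc is convex, so \<open>poincare_lemma_convex\<close> gives a primitive \<open>H\<close>
  there, and \<open>H\<close> composed with the Riemann map is the potential on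
  \<open>D\<close>.\<close>

lemma closed_form_exact:
  fixes D :: "(real^2) set" and G1 G2 :: "real^2 \<Rightarrow> real"
  assumes D: "open D" "bounded D" "simply_connected D" "D \<noteq> {}"
    and 1: "\<And>x. x \<in> D \<Longrightarrow> (G1 has_derivative G1' x) (at x)"
    and 2: "\<And>x. x \<in> D \<Longrightarrow> (G2 has_derivative G2' x) (at x)"
    and c1: "\<And>v. continuous_on D (\<lambda>x. G1' x v)" and c2: "\<And>v. continuous_on D (\<lambda>x. G2' x v)"
    and closed: "\<And>x. x \<in> D \<Longrightarrow> G2' x (axis 1 1) = G1' x (axis 2 1)"
  obtains p where "\<And>x. x \<in> D \<Longrightarrow> (p has_derivative (\<lambda>v. G1 x * v $ 1 + G2 x * v $ 2)) (at x)"
proof -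
  obtain f g where f: "f holomorphic_on (to_complex ` D)" and g: "g holomorphic_on ball 0 1"
    and fg: "\<And>x. x \<in> D \<Longrightarrow> f (to_complex x) \<in> ball 0 1" "\<And>x. x \<in> D \<Longrightarrow> g (f (to_complex x)) = to_complex x"
    "\<And>z. z \<in> ball 0 1 \<Longrightarrow> of_complex2 (g z) \<in> D" "\<And>z. z \<in> ball 0 1 \<Longrightarrow> f (g z) = z"
    using riemann_map_plane[OF D] by metis
  let ?B = "ball (0::complex) 1"
  define \<phi> where "\<phi> z = of_complex2 (g z)" for z
  define g1 where "g1 = deriv g"
  define g2 where "g2 = deriv (deriv g)"
  have hol: "g1 holomorphic_on ?B" "g2 holomorphic_on ?B"
    using g by (auto simp: g1_def g2_def intro!: holomorphic_deriv)
  have dg: "(g has_derivative (\<lambda>h. g1 z * h)) (at z)" "(g1 has_derivative (\<lambda>h. g2 z * h)) (at z)" if "z \<in> ?B" for z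
    using holomorphic_derivI[OF g open_ball that] holomorphic_derivI[OF hol(1) open_ball that]
    unfolding g1_def g2_def by (simp_all add: has_field_derivative_def)
  have d\<phi>: "(\<phi> has_derivative (\<lambda>h. of_complex2 (g1 z * h))) (at z)" if "z \<in> ?B" for z
    unfolding \<phi>_def using bounded_linear.has_derivative[OF bounded_linear_of_complex2 dg(1)[OF that]] .
  have \<phi>D: "\<phi> z \<in> D" if "z \<in> ?B" for z using fg(3)[OF that] by (simp add: \<phi>_def)
  have c\<phi>: "continuous_on ?B \<phi>"
    using d\<phi> has_derivative_continuous continuous_at_imp_continuous_on by blast
  have cg: "continuous_on ?B g1" "continuous_on ?B g2" using hol holomorphic_on_imp_continuous_on by auto
  \<comment> \<open>The pullback: \<open>G1 dx1 + G2 dx2\<close> at \<open>\<phi> z\<close>, applied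
    to the complex product \<open>g1 z * v\<close>, the image of \<open>v\<close> under the
    derivative of \<open>\<phi>\<close>. \<open>\<omega>'\<close> is its derivative by the product
    rule.\<close>
  define \<omega> where "\<omega> z v = G1 (\<phi> z) * Re (g1 z * v) + G2 (\<phi> z) * Im (g1 z * v)" for z v
  define \<omega>' where "\<omega>' z h v = G1 (\<phi> z) * Re (g2 z * h * v) + G1' (\<phi> z) (of_complex2 (g1 z * h)) * Re (g1 z * v)
     + (G2 (\<phi> z) * Im (g2 z * h * v) + G2' (\<phi> z) (of_complex2 (g1 z * h)) * Im (g1 z * v))" for z h v
  have lin: "linear (G1' (\<phi> z))" "linear (G2' (\<phi> z))" if "z \<in> ?B" for z
    using 1[OF \<phi>D[OF that]] 2[OF \<phi>D[OF that]] has_derivative_linear by blast+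
  obtain H where H: "\<And>z. z \<in> ?B \<Longrightarrow> (H has_derivative \<omega> z) (at z)"
  proof (rule poincare_lemma_convex[of ?B \<omega> \<omega>'])
    fix z v assume z: "z \<in> ?B"
    show "((\<lambda>z. \<omega> z v) has_derivative (\<lambda>h. \<omega>' z h v)) (at z)"
      unfolding \<omega>_def \<omega>'_def
      by (intro has_derivative_add has_derivative_mult bounded_linear.has_derivative[OF bounded_linear_Re]
          bounded_linear.has_derivative[OF bounded_linear_Im] has_derivative_mult_left dg z
          has_derivative_compose[OF d\<phi> 1] has_derivative_compose[OF d\<phi> 2] \<phi>D)
    show "\<omega>' z h v = \<omega>' z v h" for h
    proof -
      \<comment> \<open>\<open>A\<close>, \<open>B\<close>, \<open>C\<close> stand for the entries
        of the Jacobian of \<open>(G1, G2)\<close>, symmetric by \<open>closed\<close>; the terms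
        with \<open>g2\<close> are symmetric because complex multiplication commutes.\<close>
      have "a * r + (x * A + y * B) * x' + (b * t + (x * B + y * C) * y') =
        a * r + (x' * A + y' * B) * x + (b * t + (x' * B + y' * C) * y)" for a r x A y B x' b t C y' :: real
        by (simp add: algebra_simps)
      then show ?thesis
        unfolding \<omega>'_def linear_vec2[OF lin(1)[OF z], of "of_complex2 _"] linear_vec2[OF lin(2)[OF z], of "of_complex2 _"]
          of_complex2_nth closed[OF \<phi>D[OF z]] mult.assoc[of "g2 z"] mult.commute[of v h] by simp
    qed
  next
    fix v h
    have "continuous_on D G1" "continuous_on D G2"
      by (auto intro!: continuous_at_imp_continuous_on has_derivative_continuous[OF 1] has_derivative_continuous[OF 2])
    then have cG: "continuous_on ?B (\<lambda>z. G1 (\<phi> z))" "continuous_on ?B (\<lambda>z. G2 (\<phi> z))"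
      using \<phi>D continuous_on_compose2[OF _ c\<phi>] by blast+
    have cG1: "continuous_on ?B (\<lambda>z. G1' (\<phi> z) e)" for e
      by (rule continuous_on_compose2[OF c1 c\<phi>]) (use \<phi>D in blast)
    have cG2: "continuous_on ?B (\<lambda>z. G2' (\<phi> z) e)" for e
      by (rule continuous_on_compose2[OF c2 c\<phi>]) (use \<phi>D in blast)
    have "continuous_on ?B (\<lambda>z. G1 (\<phi> z) * Re (g2 z * h * v) + 
       (Re (g1 z * h) * G1' (\<phi> z) (axis 1 1) + Im (g1 z * h) * G1' (\<phi> z) (axis 2 1)) * Re (g1 z * v)
     + (G2 (\<phi> z) * Im (g2 z * h * v) + 
       (Re (g1 z * h) * G2' (\<phi> z) (axis 1 1) + Im (g1 z * h) * G2' (\<phi> z) (axis 2 1)) * Im (g1 z * v)))"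
      by (intro continuous_on_add continuous_on_mult continuous_on_Re continuous_on_Im continuous_on_const
          cg cG1 cG2 cG)
    then show "continuous_on ?B (\<lambda>z. \<omega>' z h v)"
      by (rule continuous_on_eq)
        (simp add: \<omega>'_def linear_vec2[OF lin(1), of _ "of_complex2 _"] linear_vec2[OF lin(2), of _ "of_complex2 _"])
  qed (auto simp: \<omega>_def algebra_simps intro!: linearI)
  have "((\<lambda>x. H (f (to_complex x))) has_derivative (\<lambda>v. G1 x * v $ 1 + G2 x * v $ 2)) (at x)" if x: "x \<in> D" for x
  proof -
    let ?w = "to_complex x"
    have w: "?w \<in> to_complex ` D" using x by auto
    have df: "(f has_field_derivative deriv f ?w) (at ?w)"
      using holomorphic_derivI[OF f open_to_complex[OF D(1)] w] .
    have "((\<lambda>x. f (to_complex x)) has_derivative (\<lambda>v. deriv f ?w * to_complex v)) (at x)"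
      using has_derivative_compose[OF bounded_linear_imp_has_derivative[OF bounded_linear_to_complex]
          df[unfolded has_field_derivative_def]] .
    from has_derivative_compose[OF this H[OF fg(1)[OF x]]]
    have *: "((\<lambda>x. H (f (to_complex x))) has_derivative (\<lambda>v. \<omega> (f ?w) (deriv f ?w * to_complex v))) (at x)" .
    \<comment> \<open>Differentiating \<open>g (f z) = z\<close> shows that the factors from the two
      maps cancel, so the original form reappears.\<close>
    moreover have "g1 (f ?w) * deriv f ?w = 1"
    proof -
      have "((\<lambda>z. g (f z)) has_field_derivative g1 (f ?w) * deriv f ?w) (at ?w)"
        by (rule DERIV_chain2[OF _ df]) (use dg(1)[OF fg(1)[OF x]] in \<open>simp add: has_field_derivative_def\<close>)
      moreover have "((\<lambda>z. g (f z)) has_field_derivative 1) (at ?w)"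
      proof (rule DERIV_cong_ev[THEN iffD2, OF refl _ refl])
        show "\<forall>\<^sub>F z in nhds ?w. g (f z) = z"
          using eventually_nhds_in_open[OF open_to_complex[OF D(1)] w] by eventually_elim (use fg(2) in auto)
      qed auto
      ultimately show ?thesis by (rule DERIV_unique)
    qed
    then have "g1 (f ?w) * (deriv f ?w * to_complex v) = to_complex v" for v
      by (metis mult.assoc mult_1)
    moreover have "\<phi> (f ?w) = x" using fg(2)[OF x] by (simp add: \<phi>_def)
    ultimately have "\<omega> (f ?w) (deriv f ?w * to_complex v) = G1 x * v $ 1 + G2 x * v $ 2" for v
      unfolding \<omega>_def by (metis complex.sel to_complex_def)
    with * show ?thesis by simp
  qed
  then show thesis using that by blast
qed

text \<open>Regularity is asked in the path parameter and not in the end point: integrals of closed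
  forms are differentiated in \<open>x\<close> by way of a potential, never through
  \<open>c x\<close>. The family carries neither time nor a form, so a single one serves all forms
  at all times.\<close>

definition C1_path_family :: "'a set \<Rightarrow> 'a \<Rightarrow> ('a \<Rightarrow> real \<Rightarrow> 'a) \<Rightarrow> ('a \<Rightarrow> real \<Rightarrow> 'a::real_normed_vector) \<Rightarrow> bool"
  where "C1_path_family D x0 c c' \<longleftrightarrow> x0 \<in> D \<and> (\<forall>x\<in>D. c x 0 = x0 \<and> c x 1 = x \<and> continuous_on {0..1} (c' x) \<and>
    (\<forall>s\<in>{0..1}. c x s \<in> D \<and> (c x has_vector_derivative c' x s) (at s within {0..1})))"

text \<open>The paths are the images of the radii of the disc under the inverse Riemann map, and the
  base point is the image of the centre.\<close>

lemma C1_path_family_exists: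
  fixes D :: "(real^2) set"
  assumes D: "open D" "bounded D" "simply_connected D" "D \<noteq> {}"
  shows "\<exists>x0 c c'. C1_path_family D x0 c c'"
proof -
  obtain f g where f: "f holomorphic_on (to_complex ` D)" and g: "g holomorphic_on ball 0 1"
    and fg: "\<And>x. x \<in> D \<Longrightarrow> f (to_complex x) \<in> ball 0 1" "\<And>x. x \<in> D \<Longrightarrow> g (f (to_complex x)) = to_complex x"
    "\<And>z. z \<in> ball 0 1 \<Longrightarrow> of_complex2 (g z) \<in> D" "\<And>z. z \<in> ball 0 1 \<Longrightarrow> f (g z) = z"
    using riemann_map_plane[OF D] by metis
  define W where "W x = f (to_complex x)" for x
  have W: "of_real s * W x \<in> ball 0 1" if "x \<in> D" "s \<in> {0..1}" for x s
    using fg(1)[OF that(1)] that(2) mult_le_one[of "\<bar>s\<bar>" "norm (W x)"]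
      mult_right_mono[of s 1 "norm (W x)"]
    by (auto simp: W_def norm_mult)
  have "C1_path_family D (of_complex2 (g 0)) (\<lambda>x s. of_complex2 (g (of_real s * W x)))
      (\<lambda>x s. of_complex2 (W x * deriv g (of_real s * W x)))"
    unfolding C1_path_family_def
  proof (intro conjI ballI)
    fix x assume x: "x \<in> D"
    show "of_complex2 (g (complex_of_real 1 * W x)) = x" using fg(2)[OF x] by (simp add: W_def)
    have dc: "continuous_on (ball 0 1) (deriv g)"
      using g holomorphic_deriv holomorphic_on_imp_continuous_on open_ball by blast
    show "continuous_on {0..1} (\<lambda>s. of_complex2 (W x * deriv g (of_real s * W x)))"
      by (rule bounded_linear.continuous_on[OF bounded_linear_of_complex2])
        (auto intro!: continuous_intros continuous_on_compose2[OF dc] W[OF x, simplified])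
    fix s :: real assume s: "s \<in> {0..1}"
    show "of_complex2 (g (of_real s * W x)) \<in> D" using fg(3)[OF W[OF x s]] .
    have "(g has_field_derivative deriv g (of_real s * W x)) (at (of_real s * W x))"
      using holomorphic_derivI[OF g open_ball W[OF x s]] .
    moreover have "((\<lambda>s. of_real s * W x) has_vector_derivative W x) (at s within {0..1})"
      by (auto intro!: derivative_eq_intros)
    ultimately have "((\<lambda>s. g (of_real s * W x)) has_vector_derivative (W x * deriv g (of_real s * W x))) (at s within {0..1})"
      using field_vector_diff_chain_within[of "\<lambda>s. of_real s * W x" "W x" s "{0..1}" g] 
      by (auto simp: o_def intro: has_field_derivative_at_within)
    then show "((\<lambda>s. of_complex2 (g (of_real s * W x))) has_vector_derivative of_complex2 (W x * deriv g (of_real s * W x))) (at s within {0..1})"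
      by (rule bounded_linear.has_vector_derivative[OF bounded_linear_of_complex2])
  qed (use fg in auto)
  then show ?thesis by blast
qed

section \<open>Extension of derivatives to the closure\<close>

text \<open>\<open>C\<close> bounds the speed on the unit interval relative to the distance of the
  end points, the form in which the chain rule uses it. End points lie in the ball of radius
  \<open>d\<close>, while the path may use the ball of radius \<open>e\<close>.\<close>

definition joined_by_short_paths :: "'a::real_normed_vector set \<Rightarrow> 'a \<Rightarrow> real \<Rightarrow> real \<Rightarrow> real \<Rightarrow> bool" where
  "joined_by_short_paths \<Omega> x C e d \<longleftrightarrow> (\<forall>y\<in>\<Omega> \<inter> ball x d. \<forall>z\<in>\<Omega> \<inter> ball x d.
     \<exists>g g'. g 0 = y \<and> g 1 = z \<and> (\<forall>s\<in>{0..1::real}. g s \<in> \<Omega> \<inter> ball x e \<and>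
       (g has_vector_derivative g' s) (at s within {0..1}) \<and> norm (g' s) \<le> C * norm (y - z)))"

text \<open>\<open>C\<close> is chosen before \<open>e\<close>: to prove differentiability at a
  boundary point, \<open>e\<close> shrinks while the constant stays fixed.\<close>

definition locally_quasiconvex :: "'a::real_normed_vector set \<Rightarrow> bool" where
  "locally_quasiconvex \<Omega> \<longleftrightarrow> (\<forall>x\<in>closure \<Omega>. \<exists>C>0. \<forall>e>0. \<exists>d>0. joined_by_short_paths \<Omega> x C e d)"

text \<open>The segment of the usual mean value inequality could leave \<Omega>; a short path inside
  takes its place at the cost of the factor \<open>C\<close>.\<close>

lemma short_paths_mvt:
  fixes f :: "'a::real_normed_vector \<Rightarrow> real"
  assumes p: "joined_by_short_paths \<Omega> x C e d"
    and f: "\<And>y. y \<in> \<Omega> \<Longrightarrow> (f has_derivative f' y) (at y within \<Omega>)"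
    and fb: "\<And>y v. y \<in> \<Omega> \<inter> ball x e \<Longrightarrow> \<bar>f' y v\<bar> \<le> M * norm v"
    and M: "M \<ge> 0" and yz: "y \<in> \<Omega> \<inter> ball x d" "z \<in> \<Omega> \<inter> ball x d"
  shows "\<bar>f y - f z\<bar> \<le> C * M * norm (y - z)"
proof -
  obtain g g' where "g 0 = y \<and> g 1 = z \<and> (\<forall>s\<in>{0..1::real}. g s \<in> \<Omega> \<inter> ball x e \<and>
      (g has_vector_derivative g' s) (at s within {0..1}) \<and> norm (g' s) \<le> C * norm (y - z))"
    using p[unfolded joined_by_short_paths_def, rule_format, OF yz] by (elim exE)
  then have g: "g 0 = y" "g 1 = z" and gs: "\<And>s. s \<in> {0..1::real} \<Longrightarrow> g s \<in> \<Omega> \<inter> ball x e"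
    "\<And>s. s \<in> {0..1} \<Longrightarrow> (g has_vector_derivative g' s) (at s within {0..1})"
    "\<And>s. s \<in> {0..1} \<Longrightarrow> norm (g' s) \<le> C * norm (y - z)"
    by blast+
  have "norm (f (g 0) - f (g 1)) \<le> C * M * norm (y - z) * norm (0 - 1 :: real)"
  proof (rule field_differentiable_bound[of "{0..1}" "\<lambda>s. f (g s)" "\<lambda>s. f' (g s) (g' s)"])
    fix s :: real assume s: "s \<in> {0..1}"
    have gO: "g s \<in> \<Omega>" using gs(1)[OF s] by simp
    have df: "(f has_derivative f' (g s)) (at (g s) within g ` {0..1})"
      by (rule has_derivative_subset[OF f[OF gO]]) (use gs(1) in blast)
    from has_derivative_in_compose[OF gs(2)[OF s, unfolded has_vector_derivative_def] df]
    have "((\<lambda>s. f (g s)) has_derivative (\<lambda>r. f' (g s) (r *\<^sub>R g' s))) (at s within {0..1})" .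
    then show "((\<lambda>s. f (g s)) has_field_derivative f' (g s) (g' s)) (at s within {0..1})"
      using linear_cmul[OF has_derivative_linear[OF df]]
      by (simp add: has_field_derivative_def mult_commute_abs)
    have "norm (f' (g s) (g' s)) \<le> M * norm (g' s)" using fb gs(1)[OF s] by auto
    also have "\<dots> \<le> M * (C * norm (y - z))" using gs(3)[OF s] M by (rule mult_left_mono)
    finally show "norm (f' (g s) (g' s)) \<le> C * M * norm (y - z)" by (simp add: mult_ac)
  qed auto
  then show ?thesis using g by simp
qed

text \<open>A locally bounded derivative makes \<open>f\<close> Lipschitz near each point of the
  closure. A Lebesgue number for the resulting cover of the compact closure gives uniform
  continuity, and a uniformly continuous function extends.\<close>

lemma continuous_extension_to_closure:
  fixes \<Omega> :: "'a::euclidean_space set" and f :: "'a \<Rightarrow> real"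
  assumes "bounded \<Omega>" "locally_quasiconvex \<Omega>"
    and f: "\<And>y. y \<in> \<Omega> \<Longrightarrow> (f has_derivative f' y) (at y within \<Omega>)"
    and b: "\<And>x. x \<in> closure \<Omega> \<Longrightarrow> \<exists>e>0. \<exists>M. \<forall>y\<in>\<Omega> \<inter> ball x e. \<forall>v. \<bar>f' y v\<bar> \<le> M * norm v"
  shows "\<exists>F. continuous_on (closure \<Omega>) F \<and> (\<forall>x\<in>\<Omega>. F x = f x)"
proof -
  have "uniformly_continuous_on \<Omega> f"
    unfolding uniformly_continuous_on_def
  proof (intro allI impI)
    fix e :: real assume e: "e > 0"
    define \<G> where "\<G> = {ball x r | x r. \<forall>y\<in>\<Omega> \<inter> ball x r. \<forall>z\<in>\<Omega> \<inter> ball x r. \<bar>f y - f z\<bar> < e}"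
    have "\<exists>G\<in>\<G>. x \<in> G" if x: "x \<in> closure \<Omega>" for x
    proof -
      obtain e1 M0 where e1: "e1 > 0" and M0: "\<forall>y\<in>\<Omega> \<inter> ball x e1. \<forall>v. \<bar>f' y v\<bar> \<le> M0 * norm v"
        using b[OF x] by blast
      define M where "M = \<bar>M0\<bar>"
      have M: "\<bar>f' y v\<bar> \<le> M * norm v" if "y \<in> \<Omega> \<inter> ball x e1" for y v
      proof -
        have "\<bar>f' y v\<bar> \<le> M0 * norm v" using M0 that by blast
        also have "\<dots> \<le> M * norm v" unfolding M_def by (intro mult_right_mono) auto
        finally show ?thesis .
      qed
      obtain C d where C: "C > 0" and d: "d > 0" and p: "joined_by_short_paths \<Omega> x C e1 d"
        using assms(2) x e1 unfolding locally_quasiconvex_def by blast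
      have L: "\<bar>f y - f z\<bar> \<le> C * M * norm (y - z)" if "y \<in> \<Omega> \<inter> ball x d" "z \<in> \<Omega> \<inter> ball x d" for y z
        by (rule short_paths_mvt[OF p f M _ that]) (auto simp: M_def)
      \<comment> \<open>Points of this ball are at most \<open>2 * r\<close> apart, so the Lipschitz
        constant \<open>C * M\<close> gives a difference below \<open>e\<close>; the summand 1
        covers the case \<open>M = 0\<close>.\<close>
      define r where "r = min d (e / (2 * (C * M + 1)))"
      have CM: "C * M \<ge> 0" using C by (simp add: M_def)
      have r: "r > 0" using d e CM by (simp add: r_def)
      have "\<bar>f y - f z\<bar> < e" if "y \<in> \<Omega> \<inter> ball x r" "z \<in> \<Omega> \<inter> ball x r" for y z
      proof -
        have "norm (y - z) \<le> 2 * r" using that dist_triangle3[of y z x] by (simp add: dist_norm)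
        then have "C * M * norm (y - z) \<le> C * M * (2 * r)" using CM by (rule mult_left_mono)
        also have "\<dots> < (C * M + 1) * (2 * r)" using r by (simp add: algebra_simps)
        also have "\<dots> \<le> (C * M + 1) * (2 * (e / (2 * (C * M + 1))))"
          using CM by (intro mult_left_mono) (auto simp: r_def)
        also have "\<dots> = e" using CM by (simp add: field_simps add_nonneg_eq_0_iff)
        finally show ?thesis using L[of y z] that by (force simp: r_def)
      qed
      then have "ball x r \<in> \<G>" unfolding \<G>_def by blast
      then show ?thesis using r by (meson centre_in_ball)
    qed
    then have cov: "closure \<Omega> \<subseteq> \<Union>\<G>" by blast
    have op: "open G" if "G \<in> \<G>" for G using that by (auto simp: \<G>_def)
    have "compact (closure \<Omega>)" using assms(1) by (simp add: compact_closure)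
    from Heine_Borel_lemma[OF this cov op] obtain \<delta> where "\<delta> > 0" and 
      \<delta>: "\<And>x. x \<in> closure \<Omega> \<Longrightarrow> \<exists>G\<in>\<G>. ball x \<delta> \<subseteq> G" by blast
    have "dist (f x') (f x) < e" if xx: "x \<in> \<Omega>" "x' \<in> \<Omega>" "dist x' x < \<delta>" for x x'
    proof -
      obtain G where "G \<in> \<G>" "ball x \<delta> \<subseteq> G" using \<delta> xx(1) closure_subset by blast
      moreover from this obtain w r where w: "G = ball w r"
        "\<forall>y\<in>\<Omega> \<inter> ball w r. \<forall>z\<in>\<Omega> \<inter> ball w r. \<bar>f y - f z\<bar> < e" by (auto simp: \<G>_def)
      moreover have "x \<in> ball x \<delta>" "x' \<in> ball x \<delta>" using xx \<open>\<delta> > 0\<close> by (auto simp: dist_commute)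
      ultimately have "x \<in> \<Omega> \<inter> ball w r" "x' \<in> \<Omega> \<inter> ball w r" using xx(1,2) by blast+
      then show ?thesis using w(2) unfolding dist_real_def by blast
    qed
    then show "\<exists>d>0. \<forall>x\<in>\<Omega>. \<forall>x'\<in>\<Omega>. dist x' x < d \<longrightarrow> dist (f x') (f x) < e"
      using \<open>\<delta> > 0\<close> by blast
  qed
  then obtain F where "uniformly_continuous_on (closure \<Omega>) F" "\<And>x. x \<in> \<Omega> \<Longrightarrow> f x = F x"
    using uniformly_continuous_on_extension_on_closure by metis
  then show ?thesis using uniformly_continuous_imp_continuous by metis
qed

text \<open>Turns control of a derivative in finitely many fixed directions into control of its
  operator norm.\<close>

lemma linear_bound_Basis:
  fixes L :: "'a::euclidean_space \<Rightarrow> real"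
  assumes "linear L"
  shows "\<bar>L v\<bar> \<le> (\<Sum>b\<in>Basis. \<bar>L b\<bar>) * norm v"
proof -
  have "L v = L (\<Sum>b\<in>Basis. (v \<bullet> b) *\<^sub>R b)" by (simp add: euclidean_representation)
  also have "\<dots> = (\<Sum>b\<in>Basis. (v \<bullet> b) * L b)"
    using assms by (simp add: linear_sum linear_cmul)
  also have "\<bar>\<dots>\<bar> \<le> (\<Sum>b\<in>Basis. \<bar>(v \<bullet> b) * L b\<bar>)" by (rule sum_abs)
  also have "\<dots> \<le> (\<Sum>b\<in>Basis. \<bar>L b\<bar> * norm v)"
    by (intro sum_mono) (simp add: abs_mult mult.commute[of _ "norm v"] mult_right_mono Basis_le_norm)
  finally show ?thesis by (simp add: sum_distrib_right)
qed

text \<open>Subtracting the candidate \<open>f' x\<close> leaves \<open>h\<close>, whose derivative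
  is small on \<Omega> near \<open>x\<close>. Along short paths \<open>h\<close> is then Lipschitz
  with a small constant, and the estimate passes to pairs of closure points, in particular to pairs
  with \<open>x\<close>, by limits.\<close>

lemma has_derivative_extension_to_closure:
  fixes \<Omega> :: "'a::euclidean_space set" and f :: "'a \<Rightarrow> real"
  assumes qc: "locally_quasiconvex \<Omega>"
    and f: "\<And>y. y \<in> \<Omega> \<Longrightarrow> (f has_derivative f' y) (at y within \<Omega>)"
    and c: "continuous_on (closure \<Omega>) f"
    and c': "\<And>v. continuous_on (closure \<Omega>) (\<lambda>y. f' y v)"
    and lin: "\<And>y. y \<in> closure \<Omega> \<Longrightarrow> linear (f' y)"
    and x: "x \<in> closure \<Omega>"
  shows "(f has_derivative f' x) (at x within closure \<Omega>)"
  unfolding has_derivative_within_alt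
proof (intro conjI allI impI)
  show "bounded_linear (f' x)" using lin[OF x] by (simp add: linear_conv_bounded_linear)
  fix \<epsilon> :: real assume \<epsilon>: "\<epsilon> > 0"
  obtain C where C: "C > 0" and short: "\<And>e. e > 0 \<Longrightarrow> \<exists>d>0. joined_by_short_paths \<Omega> x C e d"
    using qc x unfolding locally_quasiconvex_def by blast
  \<comment> \<open>Short paths multiply the bound \<open>M\<close> on the derivative of
    \<open>h\<close> by \<open>C\<close>, which makes the Lipschitz constant exactly
    \<epsilon>.\<close>
  define M where "M = \<epsilon> / C"
  have M: "M > 0" using C \<epsilon> by (simp add: M_def)
  have "continuous_on (closure \<Omega>) (\<lambda>y. \<Sum>b\<in>Basis. \<bar>f' y b - f' x b\<bar>)"
    by (intro continuous_intros c')
  then obtain e where e: "e > 0" and eb: "\<And>y. y \<in> closure \<Omega> \<Longrightarrow> dist y x < e \<Longrightarrow>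
      dist (\<Sum>b\<in>Basis. \<bar>f' y b - f' x b\<bar>) (\<Sum>b\<in>Basis. \<bar>f' x b - f' x b\<bar>) < M"
    unfolding continuous_on_iff using x M by meson
  define h where "h y = f y - f' x y" for y
  have h: "(h has_derivative (\<lambda>v. f' y v - f' x v)) (at y within \<Omega>)" if "y \<in> \<Omega>" for y
    unfolding h_def using f[OF that] lin[OF x]
    by (intro has_derivative_diff) (auto intro: linear_imp_has_derivative)
  have hb: "\<bar>f' y v - f' x v\<bar> \<le> M * norm v" if y: "y \<in> \<Omega> \<inter> ball x e" for y v
  proof -
    have yc: "y \<in> closure \<Omega>" using y closure_subset by blast
    have "\<bar>f' y v - f' x v\<bar> \<le> (\<Sum>b\<in>Basis. \<bar>f' y b - f' x b\<bar>) * norm v"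
      by (rule linear_bound_Basis[of "\<lambda>v. f' y v - f' x v"]) (intro linear_compose_sub lin yc x)
    also have "\<dots> \<le> M * norm v"
      using eb[OF yc] y by (intro mult_right_mono) (auto simp: dist_real_def dist_commute)
    finally show ?thesis .
  qed
  obtain d where d: "d > 0" and p: "joined_by_short_paths \<Omega> x C e d" using short[OF e] by blast
  have L: "\<bar>h y - h z\<bar> \<le> C * M * norm (y - z)" if "y \<in> \<Omega> \<inter> ball x d" "z \<in> \<Omega> \<inter> ball x d" for y z
    by (rule short_paths_mvt[OF p h hb _ that]) (use M in auto)
  show "\<exists>d>0. \<forall>y\<in>closure \<Omega>. norm (y - x) < d \<longrightarrow> norm (f y - f x - f' x (y - x)) \<le> \<epsilon> * norm (y - x)"
  proof (intro exI[of _ d] conjI d ballI impI)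
    fix y assume y: "y \<in> closure \<Omega>" "norm (y - x) < d"
    obtain Y Z where Y: "\<And>n. Y n \<in> \<Omega>" "Y \<longlonglongrightarrow> y" and Z: "\<And>n. Z n \<in> \<Omega>" "Z \<longlonglongrightarrow> x"
      using y(1) x unfolding closure_sequential by blast
    have hc: "continuous_on (closure \<Omega>) h"
      unfolding h_def using lin[OF x]
      by (intro continuous_intros c linear_continuous_on) (simp add: linear_conv_bounded_linear)
    have lim: "(\<lambda>n. \<bar>h (Y n) - h (Z n)\<bar>) \<longlonglongrightarrow> \<bar>h y - h x\<bar>"
      using Y Z x y closure_subset[of \<Omega>]
      by (intro tendsto_intros continuous_on_tendsto_compose[OF hc]) (auto intro!: always_eventually)
    have lim2: "(\<lambda>n. C * M * norm (Y n - Z n)) \<longlonglongrightarrow> C * M * norm (y - x)"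
      by (intro tendsto_intros Y Z)
    have "eventually (\<lambda>n. Y n \<in> ball x d) sequentially" "eventually (\<lambda>n. Z n \<in> ball x d) sequentially"
      using topological_tendstoD[OF Y(2), of "ball x d"] topological_tendstoD[OF Z(2), of "ball x d"] y(2) d
      by (auto simp: dist_norm norm_minus_commute)
    then have "eventually (\<lambda>n. \<bar>h (Y n) - h (Z n)\<bar> \<le> C * M * norm (Y n - Z n)) sequentially"
      by eventually_elim (use L Y Z in blast)
    from tendsto_le[OF _ lim2 lim this] have "\<bar>h y - h x\<bar> \<le> C * M * norm (y - x)" by simp
    moreover have "C * M = \<epsilon>" using C by (simp add: M_def)
    moreover have "h y - h x = f y - f x - f' x (y - x)"
      using lin[OF x] by (simp add: h_def linear_diff)
    ultimately show "norm (f y - f x - f' x (y - x)) \<le> \<epsilon> * norm (y - x)" by simp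
  qed
qed

text \<open>A short path in \<open>D\<close> is run together with uniform motion in time. The time
  part contributes 1 and the space part \<open>C\<close> to the new constant; half of
  \<open>e\<close> is reserved for each component.\<close>

lemma locally_quasiconvex_Times:
  fixes D :: "'a::real_normed_vector set"
  assumes "locally_quasiconvex D"
  shows "locally_quasiconvex ({0..T::real} \<times> D)"
  unfolding locally_quasiconvex_def
proof
  fix p assume "p \<in> closure ({0..T} \<times> D)"
  then obtain t x where p: "p = (t, x)" and x: "x \<in> closure D" by (auto simp: closure_Times)
  obtain C where C: "C > 0" and path: "\<And>e. e > 0 \<Longrightarrow> \<exists>d>0. joined_by_short_paths D x C e d"
    using assms x unfolding locally_quasiconvex_def by blast
  show "\<exists>C>0. \<forall>e>0. \<exists>d>0. joined_by_short_paths ({0..T} \<times> D) p C e d"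
  proof (rule exI[of _ "1 + C"], intro conjI allI impI)
    fix e :: real assume e: "e > 0"
    obtain d where d: "d > 0" and dp: "joined_by_short_paths D x C (e/2) d"
      using path[of "e/2"] e by auto
    show "\<exists>d>0. joined_by_short_paths ({0..T} \<times> D) p (1 + C) e d"
      unfolding joined_by_short_paths_def
    proof (rule exI[of _ "min d (e/2)"], intro conjI ballI)
      fix Y Z assume YZ: "Y \<in> ({0..T} \<times> D) \<inter> ball p (min d (e/2))" "Z \<in> ({0..T} \<times> D) \<inter> ball p (min d (e/2))"
      obtain a y b z where [simp]: "Y = (a, y)" "Z = (b, z)" by fastforce
      have ab: "dist t a < min d (e/2)" "dist x y < min d (e/2)" "dist t b < min d (e/2)" "dist x z < min d (e/2)"
        using YZ dist_fst_le[of p Y] dist_snd_le[of p Y] dist_fst_le[of p Z] dist_snd_le[of p Z]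
        by (auto simp: p)
      then have yz: "y \<in> D \<inter> ball x d" "z \<in> D \<inter> ball x d" using YZ by auto
      obtain g g' where "g 0 = y \<and> g 1 = z \<and> (\<forall>s\<in>{0..1::real}. g s \<in> D \<inter> ball x (e/2) \<and>
          (g has_vector_derivative g' s) (at s within {0..1}) \<and> norm (g' s) \<le> C * norm (y - z))"
        using dp[unfolded joined_by_short_paths_def, rule_format, OF yz] by (elim exE)
      then have g: "g 0 = y" "g 1 = z" and
        gs: "\<And>s. s \<in> {0..1::real} \<Longrightarrow> g s \<in> D \<inter> ball x (e/2)"
        "\<And>s. s \<in> {0..1} \<Longrightarrow> (g has_vector_derivative g' s) (at s within {0..1})"
        "\<And>s. s \<in> {0..1} \<Longrightarrow> norm (g' s) \<le> C * norm (y - z)" by blast+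
      define \<tau> where "\<tau> s = a + s * (b - a)" for s
      have \<tau>c: "\<tau> s \<in> X" if "convex X" "a \<in> X" "b \<in> X" "s \<in> {0..1}" for X s
        using convexD_alt[OF that(1-3), of s] that(4) by (simp add: \<tau>_def algebra_simps)
      have "(\<tau> s, g s) \<in> ({0..T} \<times> D) \<inter> ball p e" if s: "s \<in> {0..1}" for s
      proof -
        have "\<tau> s \<in> {0..T}" using YZ by (intro \<tau>c s) auto
        moreover have "\<tau> s \<in> ball t (e/2)" using ab by (intro \<tau>c s) auto
        moreover have "dist p (\<tau> s, g s) \<le> dist t (\<tau> s) + dist x (g s)"
          by (simp add: p dist_Pair_Pair sqrt_sum_squares_le_sum)
        ultimately show ?thesis using gs(1)[OF s] by auto
      qed
      moreover have "((\<lambda>s. (\<tau> s, g s)) has_vector_derivative (b - a, g' s)) (at s within {0..1})" if "s \<in> {0..1}" for s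
      proof (rule has_vector_derivative_Pair[OF _ gs(2)[OF that]])
        show "(\<tau> has_vector_derivative b - a) (at s within {0..1})"
          unfolding \<tau>_def has_real_derivative_iff_has_vector_derivative[symmetric]
          by (auto intro!: derivative_eq_intros)
      qed
      moreover have "norm (b - a, g' s) \<le> (1 + C) * norm (Y - Z)" if "s \<in> {0..1}" for s
      proof -
        have "norm (b - a, g' s) \<le> norm (b - a) + norm (g' s)" by (rule norm_Pair_le)
        also have "\<dots> \<le> norm (Y - Z) + C * norm (Y - Z)"
        proof (rule add_mono)
          show "norm (b - a) \<le> norm (Y - Z)"
            using norm_fst_le[of "a - b" "y - z"] by (simp add: abs_minus_commute)
          have "C * norm (y - z) \<le> C * norm (Y - Z)"
            using norm_snd_le[of "y - z" "a - b"] C by (intro mult_left_mono) auto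
          then show "norm (g' s) \<le> C * norm (Y - Z)" using gs(3)[OF that] by linarith
        qed
        finally show ?thesis by (simp add: algebra_simps)
      qed
      ultimately show "\<exists>g g'. g 0 = Y \<and> g 1 = Z \<and> (\<forall>s\<in>{0..1::real}. g s \<in> ({0..T} \<times> D) \<inter> ball p e \<and>
       (g has_vector_derivative g' s) (at s within {0..1}) \<and> norm (g' s) \<le> (1 + C) * norm (Y - Z))"
        by (intro exI[of _ "\<lambda>s. (\<tau> s, g s)"] exI[of _ "\<lambda>s. (b - a, g' s)"]) (simp add: g \<tau>_def)
    qed (use d e in auto)
  qed (use C in auto)
qed

section \<open>Smooth domains are locally quasiconvex\<close>

lemma orthonormal_plane:
  fixes \<tau> \<nu> :: "real^2"
  assumes "norm \<tau> = 1" "norm \<nu> = 1" "\<tau> \<bullet> \<nu> = 0"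
  obtains \<sigma> where "\<sigma>\<^sup>2 = 1" "\<nu> $ 1 = - \<sigma> * \<tau> $ 2" "\<nu> $ 2 = \<sigma> * \<tau> $ 1" "(\<tau> $ 1)\<^sup>2 + (\<tau> $ 2)\<^sup>2 = 1"
proof -
  let ?a = "\<tau> $ 1" and ?b = "\<tau> $ 2" and ?c = "\<nu> $ 1" and ?d = "\<nu> $ 2"
  have 1: "?a\<^sup>2 + ?b\<^sup>2 = 1" "?c\<^sup>2 + ?d\<^sup>2 = 1" "?a * ?c + ?b * ?d = 0"
    using assms by (simp_all add: norm_eq_1 inner_vec_def sum_2 power2_eq_square)
  \<comment> \<open>The determinant of the frame: \<nu> is \<tau> turned by a right angle, up to
    this sign.\<close>
  define \<sigma> where "\<sigma> = ?a * ?d - ?b * ?c"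
  have "?c = - \<sigma> * ?b" "?d = \<sigma> * ?a" "\<sigma>\<^sup>2 = 1" using 1 unfolding \<sigma>_def by algebra+
  then show thesis using that 1 by blast
qed

lemma orthonormal_expand:
  fixes \<tau> \<nu> y :: "real^2"
  assumes "norm \<tau> = 1" "norm \<nu> = 1" "\<tau> \<bullet> \<nu> = 0"
  shows "y = (y \<bullet> \<tau>) *\<^sub>R \<tau> + (y \<bullet> \<nu>) *\<^sub>R \<nu>"
proof -
  obtain \<sigma> where "\<sigma>\<^sup>2 = 1" "\<nu> $ 1 = - \<sigma> * \<tau> $ 2" "\<nu> $ 2 = \<sigma> * \<tau> $ 1" "(\<tau> $ 1)\<^sup>2 + (\<tau> $ 2)\<^sup>2 = 1"
    using orthonormal_plane[OF assms] .
  then show ?thesis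
    unfolding vec_eq_iff forall_2 inner_vec_def sum_2
    by simp algebra
qed

lemma smooth_on_real_deriv:
  fixes \<gamma> :: "real \<Rightarrow> real"
  assumes "smooth_on UNIV \<gamma>"
  shows "(\<gamma> has_real_derivative deriv \<gamma> s) (at s)" "continuous_on UNIV (deriv \<gamma>)"
proof -
  obtain f' where f': "C1_deriv UNIV \<gamma> f'" using smooth_on_imp_C1[OF assms] by blast
  have d: "(\<gamma> has_real_derivative f' s 1) (at s)" for s
  proof -
    have h: "(\<gamma> has_derivative f' s) (at s)" using f' by (auto simp: C1_deriv_def)
    have "f' s r = f' s 1 * r" for r
      using linear_cmul[OF has_derivative_linear[OF h], of r 1] by (simp add: mult.commute)
    then have "f' s = (*) (f' s 1)" by blast
    then show ?thesis using h unfolding has_field_derivative_def by metis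
  qed
  then have e: "deriv \<gamma> s = f' s 1" for s using DERIV_imp_deriv by blast
  show "(\<gamma> has_real_derivative deriv \<gamma> s) (at s)" using d e by simp
  show "continuous_on UNIV (deriv \<gamma>)" using f' by (simp add: C1_deriv_def e[abs_def])
qed

text \<open>In the coordinates \<open>y \<bullet> \<tau>\<close> and height above the graph, a chart
  turns \<open>D\<close> into a half plane, where segments stay inside. The short path is the curve
  that is a segment in these coordinates; the bound \<open>K\<close> on the slope of \<gamma> bounds
  its speed. Near interior points segments themselves serve.\<close>

lemma locally_quasiconvex_smooth_domain:
  assumes "smooth_domain D"
  shows "locally_quasiconvex D"
  unfolding locally_quasiconvex_def
proof
  fix x assume x: "x \<in> closure D"
  have "open D" using assms by (simp add: smooth_domain_def)
  show "\<exists>C>0. \<forall>e>0. \<exists>d>0. joined_by_short_paths D x C e d"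
  proof (cases "x \<in> D")
    case True
    then obtain r where r: "r > 0" "ball x r \<subseteq> D" using \<open>open D\<close> openE by blast
    have "\<exists>g g'. g 0 = y \<and> g 1 = z \<and> (\<forall>s\<in>{0..1::real}. g s \<in> D \<inter> ball x e \<and>
       (g has_vector_derivative g' s) (at s within {0..1}) \<and> norm (g' s) \<le> 1 * norm (y - z))"
      if yz: "y \<in> ball x (min r e)" "z \<in> ball x (min r e)" for e y z
    proof (rule exI[of _ "\<lambda>s. y + s *\<^sub>R (z - y)"], rule exI[of _ "\<lambda>s. z - y"], intro conjI ballI)
      fix s :: real assume s: "s \<in> {0..1}"
      have "y + s *\<^sub>R (z - y) \<in> ball x (min r e)"
        using convexD_alt[OF convex_ball yz, of s] s by (simp add: algebra_simps)
      then show "y + s *\<^sub>R (z - y) \<in> D \<inter> ball x e" using r by auto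
      show "((\<lambda>s. y + s *\<^sub>R (z - y)) has_vector_derivative z - y) (at s within {0..1})"
        by (auto intro!: derivative_eq_intros)
    qed (auto simp: norm_minus_commute)
    then have "joined_by_short_paths D x 1 e (min r e)" for e
      unfolding joined_by_short_paths_def by blast
    then show ?thesis using r by (metis min_less_iff_conj zero_less_one)
  next
    case False
    then have "x \<in> frontier D" using x \<open>open D\<close> by (simp add: frontier_def interior_open)
    then obtain r \<tau> \<nu> \<gamma> where "graph_chart D x r \<tau> \<nu> \<gamma>"
      using assms unfolding smooth_domain_def by blast
    then have r: "r > 0" and on: "norm \<tau> = 1" "norm \<nu> = 1" "\<tau> \<bullet> \<nu> = 0" and sm: "smooth_on UNIV \<gamma>"
      and Dr: "D \<inter> ball x r = {y \<in> ball x r. y \<bullet> \<nu> > \<gamma> (y \<bullet> \<tau>)}"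
      by (auto simp: graph_chart_def)
    have on': "\<tau> \<bullet> \<tau> = 1" "\<nu> \<bullet> \<nu> = 1" "\<nu> \<bullet> \<tau> = 0"
      using on by (auto simp: norm_eq_1 inner_commute)
    let ?I = "cball (x \<bullet> \<tau>) 1"
    note \<gamma>d = smooth_on_real_deriv[OF sm]
    have "compact (deriv \<gamma> ` ?I)"
      by (intro compact_continuous_image continuous_on_subset[OF \<gamma>d(2)]) auto
    then obtain K where K: "K > 0" and Kb: "\<And>s. s \<in> ?I \<Longrightarrow> \<bar>deriv \<gamma> s\<bar> \<le> K"
      using bounded_pos[of "deriv \<gamma> ` ?I"] compact_imp_bounded by auto
    have lip: "\<bar>\<gamma> a - \<gamma> b\<bar> \<le> K * \<bar>a - b\<bar>" if "a \<in> ?I" "b \<in> ?I" for a b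
      using field_differentiable_bound[of ?I \<gamma> "deriv \<gamma>" K a b] that Kb
      by (auto intro: has_field_derivative_at_within \<gamma>d(1))
    \<comment> \<open>Bounds for the speed: 1 for the motion along \<tau>, \<open>K\<close> for the
      change of the graph below the point, and \<open>1 + K\<close> for the change of height above
      it.\<close>
    define C where "C = 2 + 2 * K"
    have C: "C > 0" using K by (simp add: C_def)
    \<comment> \<open>The condition \<open>d * (2 * C + 1) \<le> min e r\<close> keeps the path in
      the chart and in the ball of radius \<open>e\<close>: it starts within \<open>d\<close> of
      \<open>x\<close> and travels at most \<open>C * (2 * d)\<close>.\<close>
    have main: "\<exists>g g'. g 0 = y \<and> g 1 = z \<and> (\<forall>s\<in>{0..1::real}. g s \<in> D \<inter> ball x e \<and>
       (g has_vector_derivative g' s) (at s within {0..1}) \<and> norm (g' s) \<le> C * norm (y - z))"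
      if d: "d \<le> 1" "d \<le> r" "d * (2 * C + 1) \<le> min e r" "d > 0" and yz: "y \<in> D \<inter> ball x d" "z \<in> D \<inter> ball x d" for e d y z
    proof -
      \<comment> \<open>Height above the graph, positive on \<open>D\<close> within the chart. It is
        interpolated linearly, so it stays positive along the path.\<close>
      define a where "a w = w \<bullet> \<nu> - \<gamma> (w \<bullet> \<tau>)" for w
      have apos: "a w > 0" if w: "w \<in> D \<inter> ball x d" for w
      proof -
        have "w \<in> D \<inter> ball x r" using w d by auto
        then have "w \<in> {y \<in> ball x r. y \<bullet> \<nu> > \<gamma> (y \<bullet> \<tau>)}" using Dr by blast
        then show ?thesis by (simp add: a_def)
      qed
      define h where "h = (z - y) \<bullet> \<tau>"
      define X where "X s = y \<bullet> \<tau> + s * h" for s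
      define A where "A s = a y + s * (a z - a y)" for s
      define g where "g s = X s *\<^sub>R \<tau> + (\<gamma> (X s) + A s) *\<^sub>R \<nu>" for s
      define g' where "g' s = h *\<^sub>R \<tau> + (deriv \<gamma> (X s) * h + (a z - a y)) *\<^sub>R \<nu>" for s
      have inI: "w \<bullet> \<tau> \<in> ?I" if "w \<in> ball x d" for w
      proof -
        have "\<bar>(w - x) \<bullet> \<tau>\<bar> \<le> norm (w - x)" using Cauchy_Schwarz_ineq2[of "w - x" \<tau>] on by simp
        then show ?thesis using that d by (simp add: dist_norm dist_real_def norm_minus_commute inner_diff_left abs_minus_commute)
      qed
      have X: "X s \<in> ?I" if "s \<in> {0..1}" for s
        using convexD_alt[OF convex_cball inI inI, of y z s] yz that
        by (simp add: X_def h_def algebra_simps inner_diff_left)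
      have hle: "\<bar>h\<bar> \<le> norm (y - z)" 
        using Cauchy_Schwarz_ineq2[of "z - y" \<tau>] on by (simp add: h_def norm_minus_commute)
      have "\<bar>(z - y) \<bullet> \<nu>\<bar> \<le> norm (y - z)" 
        using Cauchy_Schwarz_ineq2[of "z - y" \<nu>] on by (simp add: norm_minus_commute)
      moreover have "\<bar>\<gamma> (z \<bullet> \<tau>) - \<gamma> (y \<bullet> \<tau>)\<bar> \<le> K * norm (y - z)"
      proof -
        have "\<bar>\<gamma> (z \<bullet> \<tau>) - \<gamma> (y \<bullet> \<tau>)\<bar> \<le> K * \<bar>h\<bar>"
          using lip[of "z \<bullet> \<tau>" "y \<bullet> \<tau>"] inI yz by (simp add: h_def inner_diff_left)
        also have "\<dots> \<le> K * norm (y - z)" using hle K by (intro mult_left_mono) auto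
        finally show ?thesis .
      qed
      ultimately have ale: "\<bar>a z - a y\<bar> \<le> (1 + K) * norm (y - z)"
        by (simp add: a_def inner_diff_left algebra_simps)
      have dg: "(g has_vector_derivative g' s) (at s within B)" for s B
      proof -
        have X': "(X has_real_derivative h) (at s within B)" and A': "(A has_real_derivative a z - a y) (at s within B)"
          unfolding X_def A_def by (auto intro!: derivative_eq_intros)
        have F: "((\<lambda>s. \<gamma> (X s) + A s) has_real_derivative deriv \<gamma> (X s) * h + (a z - a y)) (at s within B)"
          by (intro DERIV_add DERIV_chain2[OF \<gamma>d(1) X'] A')
        show ?thesis unfolding g_def g'_def
          using has_vector_derivative_add[OF has_vector_derivative_scaleR[OF X' has_vector_derivative_const]
            has_vector_derivative_scaleR[OF F has_vector_derivative_const]] by simp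
      qed
      have ng: "norm (g' s) \<le> C * norm (y - z)" if "s \<in> {0..1}" for s
      proof -
        have "norm (g' s) \<le> \<bar>h\<bar> + \<bar>deriv \<gamma> (X s) * h + (a z - a y)\<bar>"
          unfolding g'_def using norm_triangle_ineq[of "h *\<^sub>R \<tau>" "(deriv \<gamma> (X s) * h + (a z - a y)) *\<^sub>R \<nu>"] on by simp
        also have "\<dots> \<le> \<bar>h\<bar> + (\<bar>deriv \<gamma> (X s) * h\<bar> + \<bar>a z - a y\<bar>)" by linarith
        also have "\<bar>deriv \<gamma> (X s) * h\<bar> \<le> K * norm (y - z)"
          unfolding abs_mult using Kb[OF X[OF that]] hle K by (intro mult_mono) auto
        finally show ?thesis using hle ale by (simp add: C_def algebra_simps)
      qed
      have g01: "g 0 = y" "g 1 = z"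
        using orthonormal_expand[OF on, of y] orthonormal_expand[OF on, of z]
        by (simp_all add: g_def X_def A_def a_def h_def inner_diff_left)
      have gb: "g s \<in> ball x (min e r)" if s: "s \<in> {0..1}" for s
      proof -
        have "norm (g s - g 0) \<le> C * norm (y - z) * norm (s - 0)"
        proof (rule differentiable_bound[of "{0..1}" g "\<lambda>s r. r *\<^sub>R g' s"])
          fix t :: real assume t: "t \<in> {0..1}"
          show "(g has_derivative (\<lambda>r. r *\<^sub>R g' t)) (at t within {0..1})"
            using dg by (simp add: has_vector_derivative_def)
          show "onorm (\<lambda>r. r *\<^sub>R g' t) \<le> C * norm (y - z)"
            using ng[OF t] by (intro onorm_le) (simp add: mult_left_mono mult.commute[of _ "norm (g' t)"] mult_right_mono)
        qed (use s in auto)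
        also have "\<dots> \<le> C * norm (y - z) * 1" using s C by (intro mult_left_mono) auto
        also have "norm (y - z) < 2 * d"
          using yz norm_triangle_ineq4[of "y - x" "z - x"] by (auto simp: dist_norm norm_minus_commute)
        finally have "norm (g s - y) < C * (2 * d)" using C g01 by simp
        moreover have "norm (y - x) < d" using yz by (simp add: dist_norm norm_minus_commute)
        moreover have "norm (g s - x) \<le> norm (g s - y) + norm (y - x)"
          using norm_triangle_ineq[of "g s - y" "y - x"] by simp
        ultimately have "norm (g s - x) < min e r" using d(3) by (simp add: algebra_simps)
        then show ?thesis by (simp add: dist_norm norm_minus_commute)
      qed
      have gD: "g s \<in> D" if s: "s \<in> {0..1}" for s
      proof -
        have "A s > 0"
        proof -
          have "A s = (1 - s) * a y + s * a z" by (simp add: A_def algebra_simps)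
          then show ?thesis using apos[OF yz(1)] apos[OF yz(2)] s
            by (cases "s = 0") (auto intro!: add_nonneg_pos)
        qed
        moreover have "g s \<bullet> \<tau> = X s" "g s \<bullet> \<nu> = \<gamma> (X s) + A s"
          using on on' by (simp_all add: g_def inner_add_left)
        ultimately have "g s \<in> {y \<in> ball x r. y \<bullet> \<nu> > \<gamma> (y \<bullet> \<tau>)}" using gb[OF s] by simp
        then show ?thesis using Dr by blast
      qed
      show ?thesis
        by (rule exI[of _ g], rule exI[of _ g']) (use g01 gb gD dg ng in auto)
    qed
    show ?thesis
    proof (rule exI[of _ C], intro conjI C allI impI)
      fix e :: real assume e: "e > 0"
      define d where "d = Min {1, r, min e r / (2 * C + 1)}"
      have "d \<le> 1" "d \<le> r" "d \<le> min e r / (2 * C + 1)" "d > 0" using r C e by (auto simp: d_def)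
      moreover then have "d * (2 * C + 1) \<le> min e r"
        using C by (simp add: pos_le_divide_eq)
      ultimately show "\<exists>d>0. joined_by_short_paths D x C e d"
        unfolding joined_by_short_paths_def
        using main by (intro exI[of _ d]) blast
    qed
  qed
qed

section \<open>Potentials on the closed space-time cylinder\<close>

definition path_integral :: "(real \<Rightarrow> real^2) \<Rightarrow> (real \<Rightarrow> real^2) \<Rightarrow> (real \<times> (real^2) \<Rightarrow> real) \<Rightarrow>
    (real \<times> (real^2) \<Rightarrow> real) \<Rightarrow> real \<Rightarrow> real" where
  "path_integral c c' A B t = integral {0..1} (\<lambda>s. A (t, c s) * c' s $ 1 + B (t, c s) * c' s $ 2)"

locale space_time_domain =
  fixes D :: "(real^2) set" and T :: real
  assumes smooth: "smooth_domain D" and bounded_D: "bounded D" and simply_connected_D: "simply_connected D"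
    and T_pos: "T > 0"
begin

abbreviation Q :: "(real \<times> (real^2)) set" where "Q \<equiv> {0..T} \<times> closure D"
abbreviation Dt :: "(real \<times> (real^2) \<Rightarrow> 'b::real_normed_vector) \<Rightarrow> real \<times> (real^2) \<Rightarrow> 'b" where
  "Dt \<equiv> ddir Q (1, 0)"
abbreviation D1 :: "(real \<times> (real^2) \<Rightarrow> 'b::real_normed_vector) \<Rightarrow> real \<times> (real^2) \<Rightarrow> 'b" where
  "D1 \<equiv> ddir Q (0, axis 1 1)"
abbreviation D2 :: "(real \<times> (real^2) \<Rightarrow> 'b::real_normed_vector) \<Rightarrow> real \<times> (real^2) \<Rightarrow> 'b" where
  "D2 \<equiv> ddir Q (0, axis 2 1)"

lemma open_D: "open D" and connected_D: "connected D" and nonempty_D: "D \<noteq> {}"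
  using smooth by (auto simp: smooth_domain_def)

lemma D_subset: "x \<in> D \<Longrightarrow> x \<in> closure D"
  using closure_subset by blast

lemma closure_cylinder: "closure ({0..T} \<times> D) = Q"
  by (simp add: closure_Times)

lemma compact_Q: "compact Q"
  using bounded_D by (intro compact_Times) (auto simp: compact_closure)

sublocale regular_set Q
proof
  have "{0<..<T} \<times> D \<subseteq> interior Q"
    by (rule interior_maximal) (use closure_subset[of D] open_D in \<open>auto intro!: open_Times\<close>)
  from closure_mono[OF this] show "Q \<subseteq> closure (interior Q)"
    using T_pos by (simp add: closure_Times)
qed

lemma slice_space:
  assumes "smooth_on Q f" "t \<in> {0..T}" "x \<in> D"
  shows "((\<lambda>y. f (t, y)) has_derivative (\<lambda>v. ddir Q (0, v) f (t, x))) (at x)"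
proof -
  have "(f has_derivative (\<lambda>v. ddir Q v f (t, x))) (at (t, x) within (\<lambda>y. (t, y)) ` D)"
    by (rule has_derivative_subset[OF ddir_has_derivative[OF assms(1)]]) (use assms D_subset in auto)
  moreover have "((\<lambda>y. (t, y)) has_derivative (\<lambda>v. (0, v))) (at x within D)"
    by (auto intro!: derivative_eq_intros)
  ultimately have "((\<lambda>y. f (t, y)) has_derivative (\<lambda>v. ddir Q (0, v) f (t, x))) (at x within D)"
    using has_derivative_in_compose by fastforce
  then show ?thesis using at_within_open[OF assms(3) open_D] by simp
qed

lemma slice_time:
  assumes "smooth_on Q f" "t \<in> {0..T}" "x \<in> closure D"
  shows "((\<lambda>s. f (s, x)) has_vector_derivative Dt f (t, x)) (at t within {0..T})"
proof -
  have tx: "(t, x) \<in> Q" using assms by auto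
  have d: "(f has_derivative (\<lambda>v. ddir Q v f (t, x))) (at (t, x) within (\<lambda>s. (s, x)) ` {0..T})"
    by (rule has_derivative_subset[OF ddir_has_derivative[OF assms(1) tx]]) (use assms in auto)
  moreover have "((\<lambda>s. (s, x)) has_derivative (\<lambda>r. (r, 0))) (at t within {0..T})"
    by (auto intro!: derivative_eq_intros)
  ultimately have "((\<lambda>s. f (s, x)) has_derivative (\<lambda>r. ddir Q (r, 0) f (t, x))) (at t within {0..T})"
    using has_derivative_in_compose by fastforce
  moreover have "(\<lambda>r. ddir Q (r, 0) f (t, x)) = (\<lambda>r. r *\<^sub>R Dt f (t, x))"
  proof
    fix r
    show "ddir Q (r, 0) f (t, x) = r *\<^sub>R Dt f (t, x)"
      using linear_cmul[OF has_derivative_linear[OF d], of r "(1, 0)"]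
      by (simp only: scaleR_Pair scaleR_zero_right real_scaleR_def mult_1_right)
  qed
  ultimately show ?thesis unfolding has_vector_derivative_def by (simp only:)
qed

lemma ddir_expand:
  fixes f :: "real \<times> (real^2) \<Rightarrow> real"
  assumes "smooth_on Q f" "z \<in> Q"
  shows "ddir Q (\<tau>, v) f z = \<tau> * Dt f z + v $ 1 * D1 f z + v $ 2 * D2 f z"
proof -
  have *: "(\<tau>, v) = 1 *\<^sub>R (\<tau> *\<^sub>R (1, 0) + (v $ 1) *\<^sub>R (0, axis 1 1)) + (v $ 2) *\<^sub>R (0, axis 2 1)"
    by (simp add: vec_eq_iff forall_2 axis_def)
  show ?thesis
    unfolding * ddir_linear[OF assms] by simp
qed

text \<open>Together with \<open>dt_eq\<close> this is the dictionary between the operators of the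
  two systems, which differentiate functions on the whole plane, and \<open>ddir\<close> on the
  closed cylinder. Agreement on \<open>D\<close> suffices because \<open>D\<close> is open.\<close>

lemma pderiv_at_eq:
  assumes "smooth_on Q f" "t \<in> {0..T}" "x \<in> D" "\<And>y. y \<in> D \<Longrightarrow> g y = f (t, y)"
  shows "pderiv_at i g x = ddir Q (0, axis i 1) f (t, x)"
proof -
  have "(g has_derivative (\<lambda>v. ddir Q (0, v) f (t, x))) (at x)"
    using has_derivative_transform_within_open[OF slice_space[OF assms(1-3)] open_D assms(3)] assms(4)
    by simp
  then have "frechet_derivative g (at x) = (\<lambda>v. ddir Q (0, v) f (t, x))"
    using frechet_derivative_at by fastforce
  then show ?thesis by (simp add: pderiv_at_def)
qed

lemma dt_eq:
  assumes "smooth_on Q f" "t \<in> {0..T}" "x \<in> closure D" "\<And>s. s \<in> {0..T} \<Longrightarrow> g s x = f (s, x)"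
  shows "dt T g t x = Dt f (t, x)"
proof -
  have "((\<lambda>s. g s x) has_vector_derivative Dt f (t, x)) (at t within {0..T})"
    using has_vector_derivative_transform[OF assms(2) _ slice_time[OF assms(1-3)], of "\<lambda>s. g s x"] assms(4)
    by simp
  then show ?thesis unfolding dt_def
    using vector_derivative_within_cbox[of 0 T] T_pos assms(2) by (simp add: cbox_interval)
qed

text \<open>The form is \<open>A dx1 + B dx2\<close> with time as a parameter. Closedness concerns
  the space variables alone, so a potential is determined up to a function of time.\<close>

definition closed_form :: "(real \<times> (real^2) \<Rightarrow> real) \<Rightarrow> (real \<times> (real^2) \<Rightarrow> real) \<Rightarrow> bool" where
  "closed_form A B \<longleftrightarrow> smooth_on Q A \<and> smooth_on Q B \<and> (\<forall>z\<in>Q. D1 B z = D2 A z)"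

text \<open>Mixed derivatives commute. This is what allows the time derivative of a potential to be
  a potential of the same kind.\<close>

lemma closed_form_Dt: assumes "closed_form A B" shows "closed_form (Dt A) (Dt B)"
proof -
  have sm: "smooth_on Q A" "smooth_on Q B" and c: "\<And>z. z \<in> Q \<Longrightarrow> D1 B z = D2 A z"
    using assms by (auto simp: closed_form_def)
  have "D1 (Dt B) z = D2 (Dt A) z" if z: "z \<in> Q" for z
    using ddir_cong[OF smooth_on_ddir[OF sm(2)] c z, of "(1, 0)"]
      ddir_commute[OF sm(1) z] ddir_commute[OF sm(2) z] by simp
  then show ?thesis by (simp add: closed_form_def smooth_on_ddir sm)
qed

text \<open>The path does not depend on \<open>t\<close>, so the time derivative falls on
  \<open>A\<close> and \<open>B\<close> alone; at fixed time the integrand is the derivative of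
  \<open>p (c s)\<close>, which gives the increment of any potential \<open>p\<close>.\<close>

lemma path_integral_derivatives:
  assumes AB: "smooth_on Q A" "smooth_on Q B" and t: "t \<in> {0..T}"
    and c: "\<And>s. s \<in> {0..1} \<Longrightarrow> c s \<in> D" "\<And>s. s \<in> {0..1} \<Longrightarrow> (c has_vector_derivative c' s) (at s within {0..1})"
    "continuous_on {0..1} c'"
  shows path_integral_Dt: "(path_integral c c' A B has_vector_derivative path_integral c c' (Dt A) (Dt B) t) (at t within {0..T})"
    and path_integral_gradient: "\<And>p. (\<And>x. x \<in> D \<Longrightarrow> (p has_derivative (\<lambda>v. A (t, x) * v $ 1 + B (t, x) * v $ 2)) (at x)) \<Longrightarrow>
      path_integral c c' A B t = p (c 1) - p (c 0)"
proof -
  have cc: "continuous_on {0..1} c"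
    using c(2) has_vector_derivative_continuous continuous_on_eq_continuous_within by blast
  have con: "continuous_on ({0..T} \<times> {0..1}) (\<lambda>(t, s). F (t, c s) * c' s $ 1 + G (t, c s) * c' s $ 2)"
    if "smooth_on Q F" "smooth_on Q G" for F G
  proof -
    have *: "continuous_on ({0..T} \<times> {0..1}) (\<lambda>p. F (fst p, c (snd p)))" if "smooth_on Q F" for F :: "real \<times> (real^2) \<Rightarrow> real"
      by (rule continuous_on_compose2[OF smooth_on_imp_continuous_on[OF that]])
        (use c(1) D_subset in \<open>auto intro!: continuous_intros continuous_on_compose2[OF cc]\<close>)
    have **: "continuous_on ({0..T} \<times> {0..1}) (\<lambda>p. c' (snd p) $ i)" for i
      by (intro continuous_intros continuous_on_compose2[OF c(3)]) auto
    show ?thesis unfolding split_beta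
      by (intro continuous_on_add continuous_on_mult * ** that)
  qed
  have cont1: "continuous_on {0..1} (\<lambda>s. F (t, c s) * c' s $ 1 + G (t, c s) * c' s $ 2)"
    if "smooth_on Q F" "smooth_on Q G" "t \<in> {0..T}" for F G t
  proof -
    have p: "continuous_on {0..1} (Pair t)" by (intro continuous_intros)
    have "Pair t ` {0..1} \<subseteq> {0..T} \<times> {0..1}" using that(3) by auto
    from continuous_on_compose2[OF con[OF that(1,2)] p this] show ?thesis by simp
  qed
  have "((\<lambda>t. integral (cbox 0 1) (\<lambda>s. A (t, c s) * c' s $ 1 + B (t, c s) * c' s $ 2)) has_vector_derivative
      integral (cbox 0 1) (\<lambda>s. Dt A (t, c s) * c' s $ 1 + Dt B (t, c s) * c' s $ 2)) (at t within {0..T})"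
  proof (rule leibniz_rule_vector_derivative[where fx="\<lambda>t s. Dt A (t, c s) * c' s $ 1 + Dt B (t, c s) * c' s $ 2"])
    fix t s :: real assume "t \<in> {0..T}" "s \<in> cbox 0 1"
    then show "((\<lambda>t. A (t, c s) * c' s $ 1 + B (t, c s) * c' s $ 2) has_vector_derivative
        Dt A (t, c s) * c' s $ 1 + Dt B (t, c s) * c' s $ 2) (at t within {0..T})"
      using slice_time[OF AB(1), of t "c s"] slice_time[OF AB(2), of t "c s"] c(1)[of s] D_subset
      unfolding has_real_derivative_iff_has_vector_derivative[symmetric]
      by (auto intro!: derivative_eq_intros)
  next
    show "(\<lambda>s. A (t, c s) * c' s $ 1 + B (t, c s) * c' s $ 2) integrable_on cbox 0 1" if "t \<in> {0..T}" for t
      using cont1[OF AB that] by (simp add: integrable_continuous_interval)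
    show "continuous_on ({0..T} \<times> cbox 0 1) (\<lambda>(t, s). Dt A (t, c s) * c' s $ 1 + Dt B (t, c s) * c' s $ 2)"
      using con[OF smooth_on_ddir[OF AB(1)] smooth_on_ddir[OF AB(2)]] by simp
  qed (use t in auto)
  then show "(path_integral c c' A B has_vector_derivative path_integral c c' (Dt A) (Dt B) t) (at t within {0..T})"
    by (simp add: path_integral_def[abs_def])
  fix p assume p: "\<And>x. x \<in> D \<Longrightarrow> (p has_derivative (\<lambda>v. A (t, x) * v $ 1 + B (t, x) * v $ 2)) (at x)"
  have "((\<lambda>s. A (t, c s) * c' s $ 1 + B (t, c s) * c' s $ 2) has_integral p (c 1) - p (c 0)) {0..1}"
  proof (rule fundamental_theorem_of_calculus)
    fix s :: real assume s: "s \<in> {0..1}"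
    have "((\<lambda>s. p (c s)) has_derivative (\<lambda>r. A (t, c s) * (r *\<^sub>R c' s) $ 1 + B (t, c s) * (r *\<^sub>R c' s) $ 2)) (at s within {0..1})"
      using has_derivative_compose[OF c(2)[OF s, unfolded has_vector_derivative_def] p[OF c(1)[OF s]]] .
    then show "((\<lambda>s. p (c s)) has_vector_derivative A (t, c s) * c' s $ 1 + B (t, c s) * c' s $ 2) (at s within {0..1})"
      by (simp add: has_vector_derivative_def algebra_simps)
  qed simp
  then show "path_integral c c' A B t = p (c 1) - p (c 0)"
    unfolding path_integral_def by (rule integral_unique)
qed

lemma closed_form_spatial_potential:
  assumes "closed_form A B" "t \<in> {0..T}"
  obtains p where "\<And>x. x \<in> D \<Longrightarrow> (p has_derivative (\<lambda>v. A (t, x) * v $ 1 + B (t, x) * v $ 2)) (at x)"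
proof -
  have sm: "smooth_on Q A" "smooth_on Q B" and c: "\<And>z. z \<in> Q \<Longrightarrow> D1 B z = D2 A z"
    using assms by (auto simp: closed_form_def)
  have con: "continuous_on D (\<lambda>x. ddir Q (0, v) f (t, x))" if "smooth_on Q f" for f :: "real \<times> (real^2) \<Rightarrow> real" and v
    by (rule continuous_on_compose2[OF smooth_on_imp_continuous_on[OF smooth_on_ddir[OF that]]])
      (use assms D_subset in \<open>auto intro!: continuous_intros\<close>)
  show thesis
    by (rule closed_form_exact[OF open_D bounded_D simply_connected_D nonempty_D
       slice_space[OF sm(1) assms(2)] slice_space[OF sm(2) assms(2)] con[OF sm(1)] con[OF sm(2)]])
     (use c assms(2) D_subset in \<open>auto intro: that\<close>)
qed

text \<open>At each time the path integral differs by a constant from some potential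
  \<open>p\<close> of that time, hence has the right gradient; no relation between the
  \<open>p\<close> of different times enters. The time derivative comes from differentiation under
  the integral. Since the spatial derivative is jointly continuous, the partial derivatives combine
  to a total one. \<open>P\<close> is obtained for all forms at once because the formula for
  \<open>P A B\<close> mentions \<open>P (Dt A) (Dt B)\<close>.\<close>

lemma open_cylinder_potential:
  obtains P where "\<And>A B t x. closed_form A B \<Longrightarrow> t \<in> {0..T} \<Longrightarrow> x \<in> D \<Longrightarrow>
    (P A B has_derivative (\<lambda>(\<tau>, v). \<tau> * P (Dt A) (Dt B) (t, x) + (A (t, x) * v $ 1 + B (t, x) * v $ 2))) (at (t, x) within {0..T} \<times> D)"
proof -
  obtain x0 c c' where fam: "C1_path_family D x0 c c'"
    using C1_path_family_exists[OF open_D bounded_D simply_connected_D nonempty_D] by blast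
  have c: "c x 0 = x0" "c x (1::real) = x" "\<And>s. s \<in> {0..1} \<Longrightarrow> c x s \<in> D"
    "\<And>s. s \<in> {0..1} \<Longrightarrow> (c x has_vector_derivative c' x s) (at s within {0..1})"
    "continuous_on {0..1} (c' x)" if "x \<in> D" for x
    using fam that unfolding C1_path_family_def by blast+
  define P where "P A B z = path_integral (c (snd z)) (c' (snd z)) A B (fst z)" for A B z
  have "(P A B has_derivative (\<lambda>(\<tau>, v). \<tau> * P (Dt A) (Dt B) (t, x) + (A (t, x) * v $ 1 + B (t, x) * v $ 2))) (at (t, x) within {0..T} \<times> D)"
    if cl: "closed_form A B" and t: "t \<in> {0..T}" and x: "x \<in> D" for A B t x
  proof -
    have sm: "smooth_on Q A" "smooth_on Q B" using cl by (auto simp: closed_form_def)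
    \<comment> \<open>\<open>has_derivative_partialsI\<close> works on a convex set in space, hence
      the passage through a ball inside \<open>D\<close>.\<close>
    obtain r where r: "r > 0" "ball x r \<subseteq> D" using open_D x openE by blast
    define fy where "fy t x = A (t, x) *\<^sub>R blinfun_inner_left (axis 1 1 :: real^2) + B (t, x) *\<^sub>R blinfun_inner_left (axis 2 1)" for t x
    have fy: "blinfun_apply (fy t x) v = A (t, x) * v $ 1 + B (t, x) * v $ 2" for t x v
      by (simp add: fy_def blinfun.bilinear_simps blinfun_inner_left.rep_eq inner_commute[of _ v] cart_eq_inner_axis)
    have d1: "((\<lambda>s. P A B (s, x)) has_derivative (\<lambda>\<tau>. \<tau> * P (Dt A) (Dt B) (t, x))) (at t within {0..T})"
      using path_integral_Dt[OF sm t c(3-5)[OF x]] by (simp add: P_def has_vector_derivative_def)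
    have d2: "((\<lambda>y. P A B (s, y)) has_derivative blinfun_apply (fy s y)) (at y within ball x r)"
      if s: "s \<in> {0..T}" and y: "y \<in> ball x r" for s y
    proof -
      obtain p where p: "\<And>x. x \<in> D \<Longrightarrow> (p has_derivative (\<lambda>v. A (s, x) * v $ 1 + B (s, x) * v $ 2)) (at x)"
        using closed_form_spatial_potential[OF cl s] by blast
      have "P A B (s, w) = p w - p x0" if w: "w \<in> D" for w
        using path_integral_gradient[OF sm s c(3-5)[OF w], of p] p c(1,2)[OF w] by (simp add: P_def)
      moreover have "((\<lambda>w. p w - p x0) has_derivative blinfun_apply (fy s y)) (at y)"
        using has_derivative_diff[OF p has_derivative_const, of y "p x0"] y r by (auto simp: fy[abs_def])
      ultimately have "((\<lambda>w. P A B (s, w)) has_derivative blinfun_apply (fy s y)) (at y)"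
        using has_derivative_transform_within_open[of "\<lambda>w. p w - p x0" _ y UNIV D "\<lambda>w. P A B (s, w)"] open_D y r
        by auto
      then show ?thesis by (rule has_derivative_at_withinI)
    qed
    have "continuous_on ({0..T} \<times> ball x r) (\<lambda>z. F z)" if "smooth_on Q F" for F :: "real \<times> (real^2) \<Rightarrow> real"
      by (rule continuous_on_subset[OF smooth_on_imp_continuous_on[OF that]]) (use r D_subset in auto)
    then have "continuous_on ({0..T} \<times> ball x r) (\<lambda>(t, x). fy t x)"
      using sm unfolding fy_def split_beta prod.collapse
      by (intro continuous_on_add continuous_on_scaleR continuous_on_const) auto
    then have cfy: "continuous (at (t, x) within {0..T} \<times> ball x r) (\<lambda>(t, x). fy t x)"
      using t r by (auto simp: continuous_on_eq_continuous_within)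
    have xr: "x \<in> ball x r" using r by simp
    have "((\<lambda>(s, y). P A B (s, y)) has_derivative (\<lambda>(\<tau>, v). \<tau> * P (Dt A) (Dt B) (t, x) + blinfun_apply (fy t x) v))
      (at (t, x) within {0..T} \<times> ball x r)"
      by (rule has_derivative_partialsI[OF d1 d2 cfy xr convex_ball])
    moreover have "at (t, x) within {0..T} \<times> ball x r = at (t, x) within {0..T} \<times> D"
      by (rule at_within_nhd[of _ "UNIV \<times> ball x r"]) (use r in \<open>auto intro: open_Times\<close>)
    ultimately show ?thesis by (simp add: fy)
  qed
  then show thesis by (rule that)
qed

lemma locally_quasiconvex_cylinder: "locally_quasiconvex ({0..T} \<times> D)"
  by (rule locally_quasiconvex_Times[OF locally_quasiconvex_smooth_domain[OF smooth]])

lemma smooth_bounded: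
  fixes f :: "real \<times> (real^2) \<Rightarrow> real"
  assumes "smooth_on Q f"
  obtains M where "M \<ge> 0" "\<And>z. z \<in> Q \<Longrightarrow> \<bar>f z\<bar> \<le> M"
proof -
  have "bounded (f ` Q)"
    using compact_continuous_image[OF smooth_on_imp_continuous_on[OF assms] compact_Q] compact_imp_bounded by blast
  then show thesis using that unfolding bounded_iff
    by (metis abs_ge_zero dual_order.trans imageI real_norm_def all_not_in_conv order_refl)
qed

lemma gradient_form_bound:
  fixes v :: "real^2"
  assumes "\<bar>a\<bar> \<le> M" "\<bar>b\<bar> \<le> N"
  shows "\<bar>a * v $ 1 + b * v $ 2\<bar> \<le> (M + N) * norm v"
proof -
  have "\<bar>a * v $ 1 + b * v $ 2\<bar> \<le> \<bar>a\<bar> * \<bar>v $ 1\<bar> + \<bar>b\<bar> * \<bar>v $ 2\<bar>" by (metis abs_mult abs_triangle_ineq)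
  also have "\<dots> \<le> M * norm v + N * norm v"
    using assms component_le_norm_cart[of v] by (intro add_mono mult_mono) auto
  finally show ?thesis by (simp add: algebra_simps)
qed

text \<open>The derivative of \<open>P A B\<close> consists of \<open>A\<close>, \<open>B\<close>
  and \<open>P (Dt A) (Dt B)\<close>. Once every such \<open>P\<close> is bounded near the closure,
  every \<open>P\<close> extends continuously to \<open>Q\<close>, and then so do the derivatives.
  Smoothness follows by an induction over all closed forms at once.\<close>

lemma smooth_potential:
  assumes "closed_form A B"
  obtains p where "smooth_on Q p" "\<And>z. z \<in> Q \<Longrightarrow> D1 p z = A z" "\<And>z. z \<in> Q \<Longrightarrow> D2 p z = B z"
proof -
  let ?\<Omega> = "{0..T} \<times> D"
  obtain P where P: "\<And>A B t x. closed_form A B \<Longrightarrow> t \<in> {0..T} \<Longrightarrow> x \<in> D \<Longrightarrow>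
    (P A B has_derivative (\<lambda>(\<tau>, v). \<tau> * P (Dt A) (Dt B) (t, x) + (A (t, x) * v $ 1 + B (t, x) * v $ 2))) (at (t, x) within ?\<Omega>)"
    by (rule open_cylinder_potential) (rule that; simp)
  \<comment> \<open>A bound uniform in time and local in space. At one point \<open>z\<close> of
    \<open>D\<close> near \<open>x0\<close> the function is continuous on the compact time interval;
    short paths compare other points with \<open>z\<close>, since the spatial gradient
    \<open>(A, B)\<close> is bounded.\<close>
  have Pb: "\<exists>e>0. \<exists>M. \<forall>t\<in>{0..T}. \<forall>x\<in>D \<inter> ball x0 e. \<bar>P A B (t, x)\<bar> \<le> M"
    if cl: "closed_form A B" and x0: "x0 \<in> closure D" for A B x0
  proof -
    obtain C d where Cd: "C > 0" "d > 0" "joined_by_short_paths D x0 C 1 d"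
      using locally_quasiconvex_smooth_domain[OF smooth] x0 zero_less_one unfolding locally_quasiconvex_def by metis
    obtain z where z: "z \<in> D \<inter> ball x0 d"
      using x0 Cd(2) unfolding closure_approachable by (auto simp: dist_commute)
    obtain MA MB where M: "MA \<ge> 0" "\<And>z. z \<in> Q \<Longrightarrow> \<bar>A z\<bar> \<le> MA" "MB \<ge> 0" "\<And>z. z \<in> Q \<Longrightarrow> \<bar>B z\<bar> \<le> MB"
      using smooth_bounded cl unfolding closed_form_def by metis
    have "continuous_on ?\<Omega> (P A B)"
      using has_derivative_continuous[OF P[OF cl]] unfolding continuous_on_eq_continuous_within by blast
    then have "continuous_on {0..T} (\<lambda>t. P A B (t, z))"
      by (rule continuous_on_compose2) (use z in \<open>auto intro!: continuous_intros\<close>)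
    then have "bounded ((\<lambda>t. P A B (t, z)) ` {0..T})"
      using compact_continuous_image compact_imp_bounded compact_Icc by blast
    then obtain N where "\<forall>t\<in>{0..T}. \<bar>P A B (t, z)\<bar> \<le> N"
      unfolding bounded_iff by auto
    then have N: "\<And>t. t \<in> {0..T} \<Longrightarrow> \<bar>P A B (t, z)\<bar> \<le> N" by blast
    have "\<bar>P A B (t, x)\<bar> \<le> N + C * (MA + MB) * (2 * d)" if t: "t \<in> {0..T}" and x: "x \<in> D \<inter> ball x0 d" for t x
    proof -
      have "\<bar>P A B (t, x) - P A B (t, z)\<bar> \<le> C * (MA + MB) * norm (x - z)"
      proof (rule short_paths_mvt[OF Cd(3) _ _ _ x z])
        fix y assume y: "y \<in> D"
        have *: "(P A B has_derivative (\<lambda>(\<tau>, v). \<tau> * P (Dt A) (Dt B) (t, y) + (A (t, y) * v $ 1 + B (t, y) * v $ 2))) 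
            (at (t, y) within (\<lambda>y. (t, y)) ` D)"
          by (rule has_derivative_subset[OF P[OF cl t y]]) (use t in auto)
        have "((\<lambda>y. (t, y)) has_derivative (\<lambda>v. (0, v))) (at y within D)"
          by (auto intro!: derivative_eq_intros)
        from has_derivative_in_compose[OF this *]
        show "((\<lambda>y. P A B (t, y)) has_derivative (\<lambda>v. A (t, y) * v $ 1 + B (t, y) * v $ 2)) (at y within D)"
          by simp
      next
        fix y and v :: "real^2" assume "y \<in> D \<inter> ball x0 1"
        then show "\<bar>A (t, y) * v $ 1 + B (t, y) * v $ 2\<bar> \<le> (MA + MB) * norm v"
          using t D_subset by (intro gradient_form_bound M) auto
      qed (use M in auto)
      also have "norm (x - z) \<le> 2 * d" using x z dist_triangle3[of x z x0] by (simp add: dist_norm)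
      then have "C * (MA + MB) * norm (x - z) \<le> C * (MA + MB) * (2 * d)"
        using Cd(1) M by (intro mult_left_mono) auto
      finally show ?thesis using N[OF t] by linarith
    qed
    then show ?thesis using Cd(2) by blast
  qed
  have "\<exists>F. continuous_on Q F \<and> (\<forall>z\<in>?\<Omega>. F z = P A B z)" if cl: "closed_form A B" for A B
  proof -
    have "\<exists>F. continuous_on (closure ?\<Omega>) F \<and> (\<forall>z\<in>?\<Omega>. F z = P A B z)"
    proof (rule continuous_extension_to_closure[OF _ locally_quasiconvex_cylinder])
      show "bounded ?\<Omega>" using bounded_D by (intro bounded_Times) auto
    next
      fix z assume "z \<in> ?\<Omega>"
      then show "(P A B has_derivative (\<lambda>w. fst w * P (Dt A) (Dt B) z + (A z * snd w $ 1 + B z * snd w $ 2))) (at z within ?\<Omega>)"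
        using P[OF cl, of "fst z" "snd z"] by (auto simp: case_prod_beta')
    next
      fix z assume z: "z \<in> closure ?\<Omega>"
      then have z2: "snd z \<in> closure D" by (auto simp: closure_cylinder)
      obtain e M where e: "e > 0" and M: "\<And>t x. t \<in> {0..T} \<Longrightarrow> x \<in> D \<inter> ball (snd z) e \<Longrightarrow> \<bar>P (Dt A) (Dt B) (t, x)\<bar> \<le> M"
        using Pb[OF closed_form_Dt[OF cl] z2] by blast
      obtain MA MB where MAB: "MA \<ge> 0" "\<And>z. z \<in> Q \<Longrightarrow> \<bar>A z\<bar> \<le> MA" "MB \<ge> 0" "\<And>z. z \<in> Q \<Longrightarrow> \<bar>B z\<bar> \<le> MB"
        using smooth_bounded cl unfolding closed_form_def by metis
      have "\<bar>fst w * P (Dt A) (Dt B) y + (A y * snd w $ 1 + B y * snd w $ 2)\<bar> \<le> (M + (MA + MB)) * norm w"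
        if y: "y \<in> ?\<Omega> \<inter> ball z e" for y and w :: "real \<times> (real^2)"
      proof -
        have "dist (snd z) (snd y) < e" using y dist_snd_le[of z y] by auto
        then have 1: "\<bar>P (Dt A) (Dt B) y\<bar> \<le> M" using M[of "fst y" "snd y"] y by auto
        have "\<bar>fst w * P (Dt A) (Dt B) y\<bar> \<le> norm w * M"
          unfolding abs_mult using 1 norm_fst_le[of "fst w" "snd w"] by (intro mult_mono) auto
        moreover have "\<bar>A y * snd w $ 1 + B y * snd w $ 2\<bar> \<le> (MA + MB) * norm w"
        proof -
          have "\<bar>A y * snd w $ 1 + B y * snd w $ 2\<bar> \<le> (MA + MB) * norm (snd w)"
            using y D_subset by (intro gradient_form_bound MAB) auto
          also have "\<dots> \<le> (MA + MB) * norm w"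
            using norm_snd_le[of "snd w" "fst w"] MAB by (intro mult_left_mono) auto
          finally show ?thesis .
        qed
        ultimately show ?thesis by (simp add: algebra_simps)
      qed
      then show "\<exists>e>0. \<exists>M. \<forall>y\<in>?\<Omega> \<inter> ball z e. \<forall>w::real \<times> (real^2). \<bar>fst w * P (Dt A) (Dt B) y + (A y * snd w $ 1 + B y * snd w $ 2)\<bar> \<le> M * norm w"
        using e by blast
    qed
    then show ?thesis by (simp add: closure_cylinder)
  qed
  \<comment> \<open>The extensions \<open>R A B\<close> are chosen for all forms together, because
    the derivative of one involves the extension for the time-differentiated form.\<close>
  then have "\<forall>A B. \<exists>F. closed_form A B \<longrightarrow> continuous_on Q F \<and> (\<forall>z\<in>?\<Omega>. F z = P A B z)" by blast
  then obtain R where R: "\<And>A B. closed_form A B \<Longrightarrow> continuous_on Q (R A B)"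
    "\<And>A B z. closed_form A B \<Longrightarrow> z \<in> ?\<Omega> \<Longrightarrow> R A B z = P A B z" by metis
  have dR: "(R A B has_derivative (\<lambda>w. fst w * R (Dt A) (Dt B) z + (A z * snd w $ 1 + B z * snd w $ 2))) (at z within Q)"
    if cl: "closed_form A B" and z: "z \<in> Q" for A B z
  proof -
    have con: "continuous_on Q A" "continuous_on Q B" using cl smooth_on_imp_continuous_on by (auto simp: closed_form_def)
    have "(R A B has_derivative (\<lambda>w. fst w * R (Dt A) (Dt B) z + (A z * snd w $ 1 + B z * snd w $ 2))) (at z within closure ?\<Omega>)"
    proof (rule has_derivative_extension_to_closure[OF locally_quasiconvex_cylinder])
      fix y assume y: "y \<in> ?\<Omega>"
      have "(P A B has_derivative (\<lambda>w. fst w * R (Dt A) (Dt B) y + (A y * snd w $ 1 + B y * snd w $ 2))) (at y within ?\<Omega>)"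
        using P[OF cl, of "fst y" "snd y"] y R(2)[OF closed_form_Dt[OF cl] y] by (auto simp: case_prod_beta')
      then show "(R A B has_derivative (\<lambda>w. fst w * R (Dt A) (Dt B) y + (A y * snd w $ 1 + B y * snd w $ 2))) (at y within ?\<Omega>)"
        by (rule has_derivative_transform[OF y, rotated]) (use R(2)[OF cl] in auto)
    next
      show "continuous_on (closure ?\<Omega>) (R A B)" using R(1)[OF cl] by (simp add: closure_cylinder)
      show "continuous_on (closure ?\<Omega>) (\<lambda>y. fst w * R (Dt A) (Dt B) y + (A y * snd w $ 1 + B y * snd w $ 2))" for w :: "real \<times> (real^2)"
        unfolding closure_cylinder using con R(1)[OF closed_form_Dt[OF cl]]
        by (intro continuous_on_add continuous_on_mult continuous_on_const)
      show "linear (\<lambda>w::real \<times> (real^2). fst w * R (Dt A) (Dt B) y + (A y * snd w $ 1 + B y * snd w $ 2))" for y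
        by (rule linearI) (simp_all add: algebra_simps)
    qed (use z closure_cylinder in auto)
    then show ?thesis by (simp add: closure_cylinder)
  qed
  \<comment> \<open>The order rises by one at each step: the time component of the derivative of
    \<open>R A B\<close> is \<open>R (Dt A) (Dt B)\<close>, covered by the induction hypothesis for
    another closed form, and the space components are smooth.\<close>
  have Ck: "Ck_on k Q (R A B)" if "closed_form A B" for k A B
    using that
  proof (induction k arbitrary: A B)
    case 0
    then show ?case using R by simp
  next
    case (Suc k)
    have "smooth_on Q A" "smooth_on Q B" using Suc.prems by (auto simp: closed_form_def)
    then have sm: "Ck_on k Q A" "Ck_on k Q B" by (auto simp: smooth_on_def)
    have "Ck_on k Q (\<lambda>z. fst w * R (Dt A) (Dt B) z + (A z * snd w $ 1 + B z * snd w $ 2))" for w :: "real \<times> (real^2)"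
      by (intro Ck_on_add Ck_on_bilinear[OF bounded_bilinear_mult] Ck_on_const sm Suc.IH closed_form_Dt Suc.prems)
    then show ?case using dR[OF Suc.prems] unfolding Ck_on.simps
      by (intro exI[of _ "\<lambda>z (w::real \<times> (real^2)). fst w * R (Dt A) (Dt B) z + (A z * snd w $ 1 + B z * snd w $ 2)"]) simp
  qed
  have smR: "smooth_on Q (R A B)" using Ck[OF assms] by (simp add: smooth_on_def)
  have "C1_deriv Q (R A B) (\<lambda>z w. fst w * R (Dt A) (Dt B) z + (A z * snd w $ 1 + B z * snd w $ 2))"
    unfolding C1_deriv_def
  proof (intro conjI allI ballI dR[OF assms])
    fix w :: "real \<times> (real^2)"
    have "continuous_on Q A" "continuous_on Q B" using assms smooth_on_imp_continuous_on by (auto simp: closed_form_def)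
    then show "continuous_on Q (\<lambda>z. fst w * R (Dt A) (Dt B) z + (A z * snd w $ 1 + B z * snd w $ 2))"
      using R(1)[OF closed_form_Dt[OF assms]]
      by (intro continuous_on_add continuous_on_mult continuous_on_const)
  qed auto
  from ddir_eq[OF this] show thesis
    by (intro that[OF smR]) (auto simp: axis_def)
qed

end

section \<open>Uniqueness for the Dirichlet problem\<close>

text \<open>If \<open>l\<close> were positive, \<open>g'\<close> would be positive just to the right
  of 0, and the mean value theorem would give values above \<open>g 0\<close>.\<close>

lemma second_derivative_test_max:
  fixes g :: "real \<Rightarrow> real"
  assumes d: "d > 0" and g: "\<And>s. \<bar>s\<bar> < d \<Longrightarrow> (g has_real_derivative g' s) (at s)"
    and g2: "(g' has_real_derivative l) (at 0)"
    and max: "\<And>s. \<bar>s\<bar> < d \<Longrightarrow> g s \<le> g 0"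
  shows "g' 0 = 0" "l \<le> 0"
proof -
  show 0: "g' 0 = 0"
    by (rule DERIV_local_max[OF g d]) (use d max in auto)
  show "l \<le> 0"
  proof (rule ccontr)
    assume "\<not> l \<le> 0"
    then obtain e where e: "e > 0" "\<And>h. 0 < h \<Longrightarrow> h < e \<Longrightarrow> g' 0 < g' (0 + h)"
      using has_real_derivative_pos_inc_right[OF g2] by auto
    define h where "h = min d e / 2"
    have h: "0 < h" "h < d" "h < e" using d e by (auto simp: h_def)
    obtain z where z: "0 < z" "z < h" "g h - g 0 = (h - 0) * g' z"
      using MVT2[OF h(1), of g g'] g h by auto
    then have "g' z > 0" using e(2)[of z] h 0 by auto
    then have "g h > g 0" using z h by (smt (verit) mult_pos_pos)
    then show False using max[of h] h by auto
  qed
qed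

text \<open>On an open set derivatives are unique, so the anonymous derivatives inside
  \<open>Ck_on 2\<close> may be replaced by \<open>pderiv_at\<close>.\<close>

lemma Ck2_pderiv:
  assumes "open D" "Ck_on 2 D w"
  shows "\<And>x. x \<in> D \<Longrightarrow> (w has_derivative (\<lambda>v. pderiv_at 1 w x * v $ 1 + pderiv_at 2 w x * v $ 2)) (at x)"
    and "\<And>x. x \<in> D \<Longrightarrow> (pderiv_at i w has_derivative
      (\<lambda>v. pderiv_at 1 (pderiv_at i w) x * v $ 1 + pderiv_at 2 (pderiv_at i w) x * v $ 2)) (at x)"
    and "\<And>j. continuous_on D (pderiv_at j (pderiv_at i w))"
proof -
  have fr: "pderiv_at j f x = f' (axis j 1)" if "(f has_derivative f') (at x)" for f f' x j
    unfolding pderiv_at_def using frechet_derivative_at[OF that] by simp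
  have step: "(f has_derivative (\<lambda>v. pderiv_at 1 f x * v $ 1 + pderiv_at 2 f x * v $ 2)) (at x)"
    if "(f has_derivative f') (at x)" for f f' x
  proof -
    have "f' = (\<lambda>v. pderiv_at 1 f x * v $ 1 + pderiv_at 2 f x * v $ 2)"
      unfolding fr[OF that] by (rule ext) (metis linear_vec2[OF has_derivative_linear[OF that]] mult.commute)
    then show ?thesis using that by simp
  qed
  obtain w' where w': "\<forall>x\<in>D. (w has_derivative w' x) (at x within D)" "\<forall>v. Ck_on 1 D (\<lambda>x. w' x v)"
    using assms(2) unfolding numeral_2_eq_2 One_nat_def Ck_on.simps(2)[of "Suc 0"] by blast
  have dw: "(w has_derivative w' x) (at x)" if "x \<in> D" for x
    using w' that at_within_open[OF that assms(1)] by auto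
  show "(w has_derivative (\<lambda>v. pderiv_at 1 w x * v $ 1 + pderiv_at 2 w x * v $ 2)) (at x)" if "x \<in> D" for x
    using step[OF dw[OF that]] .
  have "Ck_on 1 D (\<lambda>x. w' x (axis i 1))" using w' by blast
  then obtain w2 where w2: "\<forall>x\<in>D. ((\<lambda>x. w' x (axis i 1)) has_derivative w2 x) (at x within D)"
    "\<forall>v. continuous_on D (\<lambda>x. w2 x v)" unfolding One_nat_def Ck_on.simps by blast
  have d2: "(pderiv_at i w has_derivative w2 x) (at x)" if "x \<in> D" for x
  proof -
    have "((\<lambda>x. w' x (axis i 1)) has_derivative w2 x) (at x)"
      using w2(1) that at_within_open[OF that assms(1)] by auto
    then show ?thesis
      by (rule has_derivative_transform_within_open[OF _ assms(1) that]) (use fr[OF dw] in simp)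
  qed
  show "(pderiv_at i w has_derivative (\<lambda>v. pderiv_at 1 (pderiv_at i w) x * v $ 1 + pderiv_at 2 (pderiv_at i w) x * v $ 2)) (at x)"
    if "x \<in> D" for x using step[OF d2[OF that]] .
  show "continuous_on D (pderiv_at j (pderiv_at i w))" for j
    by (rule continuous_on_eq[of _ "\<lambda>x. w2 x (axis j 1)"]) (use w2(2) fr[OF d2] in auto)
qed

lemma pderiv_at_eqI: "(f has_derivative f') (at x) \<Longrightarrow> pderiv_at i f x = f' (axis i 1)"
  unfolding pderiv_at_def using frechet_derivative_at by metis

lemma L_op_expand:
  assumes "open D" "Ck_on 2 D w" "x \<in> D" "(\<rho> has_derivative \<rho>') (at x)"
  shows "L_op \<rho> w x = \<rho> x * (pderiv_at 1 (pderiv_at 1 w) x + pderiv_at 2 (pderiv_at 2 w) x)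
    + \<rho>' (axis 1 1) * pderiv_at 1 w x + \<rho>' (axis 2 1) * pderiv_at 2 w x"
proof -
  have "((\<lambda>y. \<rho> y * pderiv_at i w y) has_derivative
     (\<lambda>v. \<rho> x * (pderiv_at 1 (pderiv_at i w) x * v $ 1 + pderiv_at 2 (pderiv_at i w) x * v $ 2) + \<rho>' v * pderiv_at i w x)) (at x)" for i
    by (intro has_derivative_mult assms(4) Ck2_pderiv(2)[OF assms(1-3)])
  from pderiv_at_eqI[OF this]
  have *: "pderiv_at j (\<lambda>y. \<rho> y * pderiv_at i w y) x = \<rho> x * (pderiv_at 1 (pderiv_at i w) x * axis j 1 $ 1 + pderiv_at 2 (pderiv_at i w) x * axis j 1 $ 2) + \<rho>' (axis j 1) * pderiv_at i w x" for i j .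
  show ?thesis
    unfolding L_op_def diverg_def grad_def by (simp add: *) (simp add: axis_def algebra_simps)
qed

text \<open>The comparison function \<open>exp (\<alpha> x\<^sub>1)\<close> is a strict subsolution once \<open>\<alpha>\<close> dominates
  \<open>sup \<bar>\<partial>\<^sub>1 \<rho>\<bar> / inf \<rho>\<close>.\<close>

lemma weak_maximum_principle:
  fixes D :: "(real^2) set"
  assumes D: "open D" "bounded D" and w: "Ck_on 2 D w" "continuous_on (closure D) w"
    and \<rho>: "\<And>x. x \<in> D \<Longrightarrow> (\<rho> has_derivative \<rho>' x) (at x)"
    and c: "c > 0" "\<And>x. x \<in> D \<Longrightarrow> c \<le> \<rho> x" and M: "\<And>x. x \<in> D \<Longrightarrow> \<bar>\<rho>' x (axis 1 1)\<bar> \<le> M"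
    and L: "\<And>x. x \<in> D \<Longrightarrow> L_op \<rho> w x = 0" and fr: "\<And>x. x \<in> frontier D \<Longrightarrow> w x \<le> 0"
    and y: "y \<in> D"
  shows "w y \<le> 0"
proof (rule ccontr)
  assume neg: "\<not> w y \<le> 0"
  \<comment> \<open>Chosen so that \<open>c * \<alpha>\<close> exceeds \<open>\<bar>M\<bar>\<close>,
    the bound on the derivative of the density in direction 1.\<close>
  define \<alpha> where "\<alpha> = (\<bar>M\<bar> + 1) / c"
  have \<alpha>: "\<alpha> > 0" "c * \<alpha> > \<bar>M\<bar>" using c by (auto simp: \<alpha>_def)
  define h where "h x = exp (\<alpha> * x $ 1)" for x :: "real^2"
  have hpos: "h x > 0" for x by (simp add: h_def)
  have hc: "continuous_on (closure D) h" unfolding h_def by (intro continuous_intros)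
  have comp: "compact (closure D)" using D by (simp add: compact_closure)
  have ne: "closure D \<noteq> {}" using y by auto
  obtain H where H: "\<And>x. x \<in> closure D \<Longrightarrow> h x \<le> H"
    using continuous_attains_sup[OF comp ne hc] by blast
  have Hpos: "H > 0" using H[of y] hpos[of y] y closure_subset by force
  \<comment> \<open>The perturbation lowers \<open>w\<close> by at most
    \<open>\<epsilon> * H = w y / 2\<close>, so \<open>v y\<close> stays positive.\<close>
  define \<epsilon> where "\<epsilon> = w y / (2 * H)"
  have \<epsilon>: "\<epsilon> > 0" using neg Hpos by (simp add: \<epsilon>_def)
  \<comment> \<open>Subtracting \<open>H\<close> makes \<open>v \<le> w\<close> on the closure. So
    \<open>v\<close> is nonpositive on the frontier, and its positive maximum is attained inside
    \<open>D\<close>.\<close>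
  define v where "v x = w x + \<epsilon> * (h x - H)" for x
  have "continuous_on (closure D) v" unfolding v_def by (intro continuous_intros w hc)
  then obtain x where x: "x \<in> closure D" and vmax: "\<And>z. z \<in> closure D \<Longrightarrow> v z \<le> v x"
    using continuous_attains_sup[OF comp ne] by blast
  have "v y = w y / 2 + \<epsilon> * h y" using Hpos by (simp add: v_def \<epsilon>_def field_simps)
  moreover have "\<epsilon> * h y > 0" using \<epsilon> hpos[of y] by simp
  ultimately have "v y > 0" using neg by linarith
  then have "v x > 0" using vmax[of y] y closure_subset by force
  have "v x \<le> w x" using H[OF x] \<epsilon> by (simp add: v_def mult_nonneg_nonpos)
  then have "x \<notin> frontier D" using fr[of x] \<open>v x > 0\<close> by linarith
  then have xD: "x \<in> D" using x D(1) by (simp add: frontier_def interior_open)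
  obtain d where d: "d > 0" "ball x d \<subseteq> D" using D(1) xD openE by blast
  have line: "x + s *\<^sub>R axis i 1 \<in> D" if "\<bar>s\<bar> < d" for s and i :: 2
    using d(2) that by (auto simp: dist_norm subset_iff)
  have ld: "((\<lambda>s. f (x + s *\<^sub>R axis i 1)) has_real_derivative f' (axis i 1)) (at s)"
    if "(f has_derivative f') (at (x + s *\<^sub>R axis i 1))" for f f' s and i :: 2
  proof -
    have "((\<lambda>s. x + s *\<^sub>R axis i 1) has_derivative (\<lambda>r. r *\<^sub>R axis i 1)) (at s)"
      by (auto intro!: derivative_eq_intros)
    from has_derivative_compose[OF this that] show ?thesis
      using linear_cmul[OF has_derivative_linear[OF that]]
      by (simp add: has_field_derivative_def mult_commute_abs)
  qed
  have hd: "(h has_derivative (\<lambda>v. h z * (\<alpha> * v $ 1))) (at z)" for z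
    unfolding h_def by (auto intro!: derivative_eq_intros bounded_linear_imp_has_derivative bounded_linear_vec_nth)
  have test: "pderiv_at i w x + \<epsilon> * (h x * (\<alpha> * axis i 1 $ 1)) = 0"
     "pderiv_at i (pderiv_at i w) x + \<epsilon> * (h x * (\<alpha> * axis i 1 $ 1)) * (\<alpha> * axis i 1 $ 1) \<le> 0" for i
  proof -
    define g where "g s = v (x + s *\<^sub>R axis i 1)" for s
    define g' where "g' s = pderiv_at i w (x + s *\<^sub>R axis i 1) + \<epsilon> * (h (x + s *\<^sub>R axis i 1) * (\<alpha> * axis i 1 $ 1))" for s
    define l where "l = pderiv_at i (pderiv_at i w) x + \<epsilon> * (h x * (\<alpha> * axis i 1 $ 1)) * (\<alpha> * axis i 1 $ 1)"
    have lin: "pderiv_at 1 f z * axis i 1 $ 1 + pderiv_at 2 f z * axis i 1 $ 2 = pderiv_at i f z" for f z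
      using exhaust_2[of i] by (auto simp: axis_def)
    have 1: "(g has_real_derivative g' s) (at s)" if "\<bar>s\<bar> < d" for s
    proof -
      have "((\<lambda>s. w (x + s *\<^sub>R axis i 1)) has_real_derivative pderiv_at i w (x + s *\<^sub>R axis i 1)) (at s)"
        using ld[OF Ck2_pderiv(1)[OF D(1) w(1) line[OF that, of i]]] by (simp add: lin)
      with ld[where s=s and i=i, OF hd] show ?thesis
        unfolding g_def g'_def v_def by (auto intro!: derivative_eq_intros)
    qed
    have 2: "(g' has_real_derivative l) (at 0)"
    proof -
      have "((\<lambda>s. pderiv_at i w (x + s *\<^sub>R axis i 1)) has_real_derivative pderiv_at i (pderiv_at i w) x) (at 0)"
        using ld[where s=0 and i=i, OF Ck2_pderiv(2)[OF D(1) w(1) line[of 0 i], of i]] d(1) by (simp add: lin)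
      with ld[where s=0 and i=i, OF hd] show ?thesis
        unfolding g'_def l_def by (auto intro!: derivative_eq_intros)
    qed
    have 3: "g s \<le> g 0" if "\<bar>s\<bar> < d" for s
      using vmax[of "x + s *\<^sub>R axis i 1"] line[OF that, of i] closure_subset[of D] by (auto simp: g_def)
    from second_derivative_test_max[OF d(1) 1 2 3]
    show "pderiv_at i w x + \<epsilon> * (h x * (\<alpha> * axis i 1 $ 1)) = 0"
     "pderiv_at i (pderiv_at i w) x + \<epsilon> * (h x * (\<alpha> * axis i 1 $ 1)) * (\<alpha> * axis i 1 $ 1) \<le> 0"
      by (simp_all add: g'_def l_def)
  qed
  define k where "k = \<epsilon> * h x * \<alpha>"
  have k: "k > 0" using \<epsilon> hpos \<alpha> by (simp add: k_def)
  have t: "pderiv_at 1 w x = - k" "pderiv_at 2 w x = 0" "pderiv_at 1 (pderiv_at 1 w) x \<le> - (k * \<alpha>)"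
    "pderiv_at 2 (pderiv_at 2 w) x \<le> 0"
    using test[of 1] test[of 2] by (simp_all add: axis_def k_def mult_ac)
  \<comment> \<open>The conditions for a maximum of \<open>v\<close>, rewritten for
    \<open>w\<close>, are inserted into \<open>L_op \<rho> w x = 0\<close>: the second-order part is
    at most \<open>- c * k * \<alpha>\<close>, which outweighs the first-order term of size
    \<open>\<bar>M\<bar> * k\<close>.\<close>
  have "0 = \<rho> x * (pderiv_at 1 (pderiv_at 1 w) x + pderiv_at 2 (pderiv_at 2 w) x) - \<rho>' x (axis 1 1) * k"
    using L_op_expand[OF D(1) w(1) xD \<rho>[OF xD]] L[OF xD] t by simp
  also have "\<dots> \<le> \<rho> x * (- (k * \<alpha>)) + \<bar>M\<bar> * k"
  proof -
    have "\<rho> x * (pderiv_at 1 (pderiv_at 1 w) x + pderiv_at 2 (pderiv_at 2 w) x) \<le> \<rho> x * (- (k * \<alpha>))"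
      using t c(1) c(2)[OF xD] by (intro mult_left_mono) auto
    moreover have "- \<rho>' x (axis 1 1) * k \<le> \<bar>M\<bar> * k"
      using M[OF xD] k by (intro mult_right_mono) auto
    ultimately show ?thesis by simp
  qed
  also have "\<dots> \<le> c * (- (k * \<alpha>)) + \<bar>M\<bar> * k"
    using c(2)[OF xD] k \<alpha> by (simp add: mult_right_mono)
  also have "\<dots> = k * (\<bar>M\<bar> - c * \<alpha>)" by (simp add: algebra_simps)
  also have "\<dots> < 0" using k \<alpha> by (simp add: mult_pos_neg)
  finally show False by simp
qed

lemma L_op_diff:
  assumes "open D" "Ck_on 2 D v" "Ck_on 2 D w" "x \<in> D" "(\<rho> has_derivative \<rho>') (at x)"
  shows "L_op \<rho> (\<lambda>x. v x - w x) x = L_op \<rho> v x - L_op \<rho> w x" "Ck_on 2 D (\<lambda>x. v x - w x)"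
proof -
  show C: "Ck_on 2 D (\<lambda>x. v x - w x)"
    using Ck_on_add[OF assms(2) Ck_on_bounded_linear[OF bounded_linear_minus[OF bounded_linear_ident] assms(3)]] by simp
  have 1: "pderiv_at i (\<lambda>x. v x - w x) y = pderiv_at i v y - pderiv_at i w y" if "y \<in> D" for i y
    using pderiv_at_eqI[OF has_derivative_diff[OF Ck2_pderiv(1)[OF assms(1,2) that] Ck2_pderiv(1)[OF assms(1,3) that]], of i]
      exhaust_2[of i] by (auto simp: axis_def)
  have 2: "pderiv_at j (pderiv_at i (\<lambda>x. v x - w x)) x = pderiv_at j (pderiv_at i v) x - pderiv_at j (pderiv_at i w) x" for i j
  proof -
    have "(pderiv_at i (\<lambda>x. v x - w x) has_derivative 
     (\<lambda>z. (pderiv_at 1 (pderiv_at i v) x * z $ 1 + pderiv_at 2 (pderiv_at i v) x * z $ 2) -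
       (pderiv_at 1 (pderiv_at i w) x * z $ 1 + pderiv_at 2 (pderiv_at i w) x * z $ 2))) (at x)"
      by (rule has_derivative_transform_within_open[OF _ assms(1,4)])
        (rule has_derivative_diff[OF Ck2_pderiv(2)[OF assms(1,2,4)] Ck2_pderiv(2)[OF assms(1,3,4)]], simp add: 1)
    from pderiv_at_eqI[OF this, of j] show ?thesis
      using exhaust_2[of j] by (auto simp: axis_def)
  qed
  show "L_op \<rho> (\<lambda>x. v x - w x) x = L_op \<rho> v x - L_op \<rho> w x"
    unfolding L_op_expand[OF assms(1) C assms(4,5)] L_op_expand[OF assms(1,2,4,5)] L_op_expand[OF assms(1,3,4,5)]
    by (simp add: 1[OF assms(4)] 2 algebra_simps)
qed

lemma dirichlet_solution_unique:
  fixes D :: "(real^2) set"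
  assumes D: "open D" "bounded D"
    and \<rho>: "\<And>x. x \<in> D \<Longrightarrow> (\<rho> has_derivative \<rho>' x) (at x)"
    and c: "c > 0" "\<And>x. x \<in> D \<Longrightarrow> c \<le> \<rho> x" and M: "\<And>x. x \<in> D \<Longrightarrow> \<bar>\<rho>' x (axis 1 1)\<bar> \<le> M"
    and sol: "dirichlet_solution D \<rho> \<omega> \<phi>" "dirichlet_solution D \<rho> \<omega> \<psi>" and x: "x \<in> closure D"
  shows "\<phi> x = \<psi> x"
proof -
  have le: "v x \<le> w x" if v: "dirichlet_solution D \<rho> \<omega> v" and w: "dirichlet_solution D \<rho> \<omega> w" for v w
  proof (cases "x \<in> D")
    case True
    have C: "Ck_on 2 D v" "Ck_on 2 D w" using v w by (auto simp: dirichlet_solution_def)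
    have "v x - w x \<le> 0"
    proof (rule weak_maximum_principle[OF D L_op_diff(2)[OF D(1) C True \<rho>[OF True]] _ \<rho> c M _ _ True])
      show "continuous_on (closure D) (\<lambda>x. v x - w x)"
        using v w by (auto simp: dirichlet_solution_def intro!: continuous_intros)
      show "L_op \<rho> (\<lambda>x. v x - w x) x = 0" if "x \<in> D" for x
        using L_op_diff(1)[OF D(1) C that \<rho>[OF that]] v w that by (simp add: dirichlet_solution_def)
      show "v x - w x \<le> 0" if "x \<in> frontier D" for x
        using v w that by (simp add: dirichlet_solution_def)
    qed
    then show ?thesis by simp
  next
    case False
    then show ?thesis using x v w D(1) by (auto simp: dirichlet_solution_def frontier_def interior_open)
  qed
  show ?thesis using le[OF sol] le[OF sol(2,1)] by simp
qed

section \<open>Boundary curves\<close>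

text \<open>The points below the graph form an open set disjoint from \<open>D\<close>, so none of
  them is in the closure; a point on the graph enters \<open>D\<close> when pushed slightly along
  \<nu>.\<close>

lemma frontier_in_chart:
  assumes D: "open D" and ch: "graph_chart D x r \<tau> \<nu> \<gamma>" and y: "y \<in> ball x r"
  shows "y \<in> frontier D \<longleftrightarrow> y \<bullet> \<nu> = \<gamma> (y \<bullet> \<tau>)"
proof -
  have on: "norm \<tau> = 1" "norm \<nu> = 1" "\<tau> \<bullet> \<nu> = 0" and sm: "smooth_on UNIV \<gamma>"
    and Dr: "D \<inter> ball x r = {y \<in> ball x r. y \<bullet> \<nu> > \<gamma> (y \<bullet> \<tau>)}"
    using ch by (auto simp: graph_chart_def)
  have on': "\<nu> \<bullet> \<nu> = 1" "\<nu> \<bullet> \<tau> = 0" using on by (auto simp: norm_eq_1 inner_commute)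
  have inD: "z \<in> D \<longleftrightarrow> z \<bullet> \<nu> > \<gamma> (z \<bullet> \<tau>)" if "z \<in> ball x r" for z
    using Dr that by blast
  have fD: "y \<in> frontier D \<longleftrightarrow> y \<in> closure D \<and> y \<notin> D" using D by (simp add: frontier_def interior_open)
  show ?thesis
  proof
    assume "y \<in> frontier D"
    then have yc: "y \<in> closure D" "y \<notin> D" using fD by auto
    have "\<not> y \<bullet> \<nu> < \<gamma> (y \<bullet> \<tau>)"
    proof
      assume less: "y \<bullet> \<nu> < \<gamma> (y \<bullet> \<tau>)"
      let ?N = "{z. z \<bullet> \<nu> < \<gamma> (z \<bullet> \<tau>)} \<inter> ball x r"
      have "continuous_on UNIV (\<lambda>z. \<gamma> (z \<bullet> \<tau>))"
        by (rule continuous_on_compose2[OF smooth_on_imp_continuous_on[OF sm]]) (auto intro!: continuous_intros)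
      then have "open ?N" by (intro open_Int open_Collect_less continuous_intros) auto
      moreover have "?N \<inter> D = {}" using inD by force
      ultimately have "?N \<inter> closure D = {}" using open_Int_closure_eq_empty by blast
      then show False using yc less y by auto
    qed
    then show "y \<bullet> \<nu> = \<gamma> (y \<bullet> \<tau>)" using inD[OF y] yc by linarith
  next
    assume eq: "y \<bullet> \<nu> = \<gamma> (y \<bullet> \<tau>)"
    have "y \<in> closure D"
      unfolding closure_approachable
    proof (intro allI impI)
      fix e :: real assume e: "e > 0"
      define a where "a = min e (r - dist x y) / 2"
      have a: "a > 0" "a < e" "a < r - dist x y" using e y by (auto simp: a_def min_def field_simps)
      let ?z = "y + a *\<^sub>R \<nu>"
      have dz: "dist ?z y = a" using a on by (simp add: dist_norm)
      have "dist x ?z < r" using dist_triangle[of x ?z y] dz a by (simp add: dist_commute)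
      moreover have "?z \<bullet> \<tau> = y \<bullet> \<tau>" "?z \<bullet> \<nu> = y \<bullet> \<nu> + a"
        using on' on(3) by (simp_all add: inner_add_left)
      ultimately have "?z \<in> D" using inD[of ?z] eq a by auto
      then show "\<exists>z\<in>D. dist z y < e" using dz a(2) by (intro bexI[of _ ?z]) simp_all
    qed
    moreover have "y \<notin> D" using inD[OF y] eq by simp
    ultimately show "y \<in> frontier D" using fD by simp
  qed
qed

text \<open>Collects what is used about the boundary, parametrised as a graph. The tangency clause
  turns the slip condition into a multiple of \<open>c' s\<close>. The last clause, that the curve
  covers the whole frontier near \<open>x\<close>, leads from constancy along the curve to local
  constancy on the frontier.\<close>

lemma boundary_curve:
  assumes D: "smooth_domain D" and x: "x \<in> frontier D"
  obtains c c' :: "real \<Rightarrow> real^2" and s0 d where "d > 0" "c s0 = x"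
    "\<And>s. \<bar>s - s0\<bar> < d \<Longrightarrow> c s \<in> frontier D"
    "\<And>s. (c has_vector_derivative c' s) (at s)"
    "\<And>s w. \<bar>s - s0\<bar> < d \<Longrightarrow> \<forall>n. unit_normal D (c s) n \<longrightarrow> w \<bullet> n = 0 \<Longrightarrow> \<exists>k. w = k *\<^sub>R c' s"
    "\<And>y. y \<in> frontier D \<Longrightarrow> dist x y < d \<Longrightarrow> \<exists>s. \<bar>s - s0\<bar> < d \<and> y = c s"
proof -
  have op: "open D" using D by (simp add: smooth_domain_def)
  obtain r \<tau> \<nu> \<gamma> where ch: "graph_chart D x r \<tau> \<nu> \<gamma>" using D x unfolding smooth_domain_def by blast
  then have r: "r > 0" and on: "norm \<tau> = 1" "norm \<nu> = 1" "\<tau> \<bullet> \<nu> = 0" and sm: "smooth_on UNIV \<gamma>"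
    and Dr: "D \<inter> ball x r = {y \<in> ball x r. y \<bullet> \<nu> > \<gamma> (y \<bullet> \<tau>)}"
    by (auto simp: graph_chart_def)
  have on': "\<tau> \<bullet> \<tau> = 1" "\<nu> \<bullet> \<nu> = 1" "\<nu> \<bullet> \<tau> = 0" using on by (auto simp: norm_eq_1 inner_commute)
  note fr = frontier_in_chart[OF op ch]
  define c where "c s = s *\<^sub>R \<tau> + \<gamma> s *\<^sub>R \<nu>" for s
  define c' where "c' s = \<tau> + deriv \<gamma> s *\<^sub>R \<nu>" for s
  define s0 where "s0 = x \<bullet> \<tau>"
  have cin: "c s \<bullet> \<tau> = s" "c s \<bullet> \<nu> = \<gamma> s" for s using on on' by (simp_all add: c_def inner_add_left)
  have cy: "y = c (y \<bullet> \<tau>)" if "y \<in> ball x r" "y \<in> frontier D" for y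
    using orthonormal_expand[OF on, of y] fr[OF that(1)] that(2) by (simp add: c_def)
  have cx: "c s0 = x" using cy[of x] r x by (simp add: s0_def)
  have dc: "(c has_vector_derivative c' s) (at s)" for s
    unfolding c_def c'_def
    using has_vector_derivative_add[OF has_vector_derivative_scaleR[OF DERIV_ident has_vector_derivative_const[of \<tau>]]
       has_vector_derivative_scaleR[OF smooth_on_real_deriv(1)[OF sm, of s] has_vector_derivative_const[of \<nu>]]] by simp
  have "continuous (at s0) c" using has_vector_derivative_continuous[OF dc] .
  then obtain d0 where d0: "d0 > 0" "\<And>s. dist s s0 < d0 \<Longrightarrow> dist (c s) x < r"
    using r cx unfolding continuous_at_eps_delta by (metis dist_norm)
  \<comment> \<open>The bound \<open>d0\<close> keeps the curve in the chart, the bound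
    \<open>r\<close> keeps the frontier points to be covered in it.\<close>
  define d where "d = min d0 r"
  have d: "d > 0" using d0 r by (simp add: d_def)
  have ball: "c s \<in> ball x r" if "\<bar>s - s0\<bar> < d" for s
    using d0(2)[of s] that by (simp add: dist_real_def d_def dist_commute)
  have frc: "c s \<in> frontier D" if "\<bar>s - s0\<bar> < d" for s
    using fr[OF ball[OF that]] by (simp add: cin)
  have tang: "\<exists>k. w = k *\<^sub>R c' s" if s: "\<bar>s - s0\<bar> < d" and w: "\<forall>n. unit_normal D (c s) n \<longrightarrow> w \<bullet> n = 0" for s w
  proof -
    let ?q = "r - dist x (c s)" and ?n = "(deriv \<gamma> (c s \<bullet> \<tau>) *\<^sub>R \<tau> - \<nu>) /\<^sub>R sqrt (1 + (deriv \<gamma> (c s \<bullet> \<tau>))\<^sup>2)"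
    have sub: "ball (c s) ?q \<subseteq> ball x r"
    proof
      fix z assume "z \<in> ball (c s) ?q"
      then show "z \<in> ball x r" using dist_triangle[of x z "c s"] by simp
    qed
    have "D \<inter> ball (c s) ?q = {y \<in> ball (c s) ?q. y \<bullet> \<nu> > \<gamma> (y \<bullet> \<tau>)}" using Dr sub by blast
    then have "graph_chart D (c s) ?q \<tau> \<nu> \<gamma>"
      using ball[OF s] on sm by (simp add: graph_chart_def)
    then have "unit_normal D (c s) ?n" using frc[OF s] unfolding unit_normal_def by blast
    then have "w \<bullet> ?n = 0" using w by blast
    moreover have "sqrt (1 + (deriv \<gamma> (c s \<bullet> \<tau>))\<^sup>2) > 0" by (simp add: add_pos_nonneg)
    ultimately have "w \<bullet> \<nu> = deriv \<gamma> s * (w \<bullet> \<tau>)" by (simp add: cin inner_diff_right)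
    then have "w = (w \<bullet> \<tau>) *\<^sub>R c' s"
      using orthonormal_expand[OF on, of w] by (simp add: c'_def scaleR_add_right mult.commute)
    then show ?thesis by blast
  qed
  have cov: "\<exists>s. \<bar>s - s0\<bar> < d \<and> y = c s" if y: "y \<in> frontier D" "dist x y < d" for y
  proof (intro exI conjI)
    show "y = c (y \<bullet> \<tau>)" using cy y by (simp add: d_def)
    have "\<bar>(y - x) \<bullet> \<tau>\<bar> \<le> norm (y - x)" using Cauchy_Schwarz_ineq2[of "y - x" \<tau>] on by simp
    then show "\<bar>y \<bullet> \<tau> - s0\<bar> < d" using y by (simp add: s0_def inner_diff_left dist_norm norm_minus_commute)
  qed
  show thesis by (rule that[of d c s0 c', OF d cx frc dc tang cov])
qed

lemma Ck_on_slice: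
  fixes f :: "'a::euclidean_space \<times> 'c::euclidean_space \<Rightarrow> 'b::real_normed_vector"
  assumes "Ck_on k (A \<times> B) f" "t \<in> A"
  shows "Ck_on k B (\<lambda>x. f (t, x))"
  using assms(1)
proof (induction k arbitrary: f)
  case 0
  then have "continuous_on (A \<times> B) f" by simp
  then have "continuous_on B (\<lambda>x. f (t, x))"
    by (rule continuous_on_compose2) (use assms(2) in \<open>auto intro!: continuous_intros\<close>)
  then show ?case by simp
next
  case (Suc k)
  then obtain f' where f': "\<forall>z\<in>A \<times> B. (f has_derivative f' z) (at z within A \<times> B)"
    "\<forall>v. Ck_on k (A \<times> B) (\<lambda>z. f' z v)" by auto
  have "((\<lambda>x. f (t, x)) has_derivative (\<lambda>v. f' (t, x) (0, v))) (at x within B)" if "x \<in> B" for x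
  proof -
    have "((\<lambda>x. (t, x)) has_derivative (\<lambda>v. (0, v))) (at x within B)" by (auto intro!: derivative_eq_intros)
    moreover have "(f has_derivative f' (t, x)) (at (t, x) within (\<lambda>x. (t, x)) ` B)"
      by (rule has_derivative_subset[of _ _ _ "A \<times> B"]) (use f' that assms(2) in auto)
    ultimately show ?thesis using has_derivative_in_compose by fastforce
  qed
  moreover have "Ck_on k B (\<lambda>x. f' (t, x) (0, v))" for v
    using Suc.IH[of "\<lambda>z. f' z (0, v)"] f' by blast
  ultimately show ?case unfolding Ck_on.simps
    by (intro exI[of _ "\<lambda>x v. f' (t, x) (0, v)"]) simp
qed

context space_time_domain begin

lemma eq_on_Q:
  fixes f g :: "real \<times> (real^2) \<Rightarrow> real"
  assumes "continuous_on Q f" "continuous_on Q g" "\<And>t x. t \<in> {0..T} \<Longrightarrow> x \<in> D \<Longrightarrow> f (t, x) = g (t, x)" "z \<in> Q"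
  shows "f z = g z"
proof -
  have "continuous_on (closure ({0..T} \<times> D)) (\<lambda>z. f z - g z)"
    unfolding closure_cylinder by (intro continuous_intros assms)
  then have "f z - g z = 0"
    by (rule continuous_constant_on_closure) (use assms(3,4) closure_cylinder in auto)
  then show ?thesis by simp
qed

text \<open>At frontier points only the derivative within \<open>Q\<close> is available. Since the
  curve stays in \<open>Q\<close> for parameters near \<open>s\<close>, the chain rule still yields
  a two-sided derivative.\<close>

lemma slice_frontier_curve:
  fixes f :: "real \<times> (real^2) \<Rightarrow> real"
  assumes f: "smooth_on Q f" and t: "t \<in> {0..T}"
    and c: "\<And>s. \<bar>s - s0\<bar> < d \<Longrightarrow> c s \<in> frontier D" "\<And>s. (c has_vector_derivative c' s) (at s)"
    and s: "\<bar>s - s0\<bar> < d"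
  shows "((\<lambda>s. f (t, c s)) has_real_derivative c' s $ 1 * D1 f (t, c s) + c' s $ 2 * D2 f (t, c s)) (at s)"
proof -
  let ?N = "ball s0 d"
  have sN: "s \<in> ?N" using s by (simp add: dist_real_def abs_minus_commute)
  have cQ: "(t, c s) \<in> Q" if "s \<in> ?N" for s
    using c(1)[of s] that t frontier_subset_closed[of "closure D"] by (auto simp: dist_real_def frontier_def abs_minus_commute)
  have "((\<lambda>s. (t, c s)) has_derivative (\<lambda>h. (0, h *\<^sub>R c' s))) (at s within ?N)"
    using c(2)[of s] unfolding has_vector_derivative_def
    by (intro has_derivative_Pair has_derivative_const) (rule has_derivative_at_withinI)
  moreover have "(f has_derivative (\<lambda>v. ddir Q v f (t, c s))) (at (t, c s) within (\<lambda>s. (t, c s)) ` ?N)"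
    by (rule has_derivative_subset[OF ddir_has_derivative[OF f cQ[OF sN]]]) (use cQ in auto)
  ultimately have "((\<lambda>s. f (t, c s)) has_derivative (\<lambda>h. ddir Q (0, h *\<^sub>R c' s) f (t, c s))) (at s within ?N)"
    by (rule has_derivative_in_compose)
  moreover have "(\<lambda>h. ddir Q (0, h *\<^sub>R c' s) f (t, c s)) = (*) (c' s $ 1 * D1 f (t, c s) + c' s $ 2 * D2 f (t, c s))"
  proof
    fix h
    show "ddir Q (0, h *\<^sub>R c' s) f (t, c s) = (c' s $ 1 * D1 f (t, c s) + c' s $ 2 * D2 f (t, c s)) * h"
      unfolding ddir_expand[OF f cQ[OF sN], of 0 "h *\<^sub>R c' s"] by (simp add: algebra_simps)
  qed
  ultimately show ?thesis using at_within_open[OF sN open_ball] by (simp add: has_field_derivative_def)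
qed

end

section \<open>Euler flows and vorticity\<close>

locale euler_flow = space_time_domain +
  fixes u :: "real \<Rightarrow> real^2 \<Rightarrow> real^2" and \<rho> :: "real \<Rightarrow> real^2 \<Rightarrow> real"
  assumes smooth_u: "smooth_on Q (\<lambda>(t, x). u t x)" and smooth_\<rho>: "smooth_on Q (\<lambda>(t, x). \<rho> t x)"
    and slip: "\<forall>t\<in>{0..T}. \<forall>x\<in>frontier D. \<forall>n. unit_normal D x n \<longrightarrow> u t x \<bullet> n = 0"
begin

text \<open>The fields of the flow as functions of pairs, the form on which \<open>smooth_on\<close>
  and \<open>ddir\<close> act: \<open>m\<close> is the momentum density, \<open>vort\<close> its
  curl, \<open>kin\<close> half the squared speed, and \<open>mom\<close> the left side of the
  momentum equation without the pressure gradient.\<close>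

definition r :: "real \<times> (real^2) \<Rightarrow> real" where "r z = \<rho> (fst z) (snd z)"
definition U :: "2 \<Rightarrow> real \<times> (real^2) \<Rightarrow> real" where "U i z = u (fst z) (snd z) $ i"
definition m :: "2 \<Rightarrow> real \<times> (real^2) \<Rightarrow> real" where "m i z = r z * U i z"
definition vort :: "real \<times> (real^2) \<Rightarrow> real" where "vort z = D1 (m 2) z - D2 (m 1) z"
definition kin :: "real \<times> (real^2) \<Rightarrow> real" where "kin z = (U 1 z * U 1 z + U 2 z * U 2 z) * (1/2)"
definition mom :: "2 \<Rightarrow> real \<times> (real^2) \<Rightarrow> real" where
  "mom i z = Dt (m i) z + (D1 (\<lambda>z. m i z * U 1 z) z + D2 (\<lambda>z. m i z * U 2 z) z)"

lemma smooth_r: "smooth_on Q r"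
  using smooth_\<rho> by (simp add: r_def[abs_def] case_prod_beta')

lemma smooth_u': "smooth_on Q (\<lambda>z. u (fst z) (snd z))"
  using smooth_u by (simp add: case_prod_beta')

lemma smooth_U: "smooth_on Q (U i)"
  unfolding U_def[abs_def] by (rule smooth_on_nth[OF smooth_u'])

lemma smooth_m: "smooth_on Q (m i)"
  unfolding m_def[abs_def] by (intro smooth_intros smooth_r smooth_U)

lemma smooth_vort: "smooth_on Q vort"
  unfolding vort_def[abs_def] by (intro smooth_intros smooth_on_ddir smooth_m)

lemma smooth_kin: "smooth_on Q kin"
  unfolding kin_def[abs_def] by (intro smooth_intros smooth_U)

lemma smooth_mom: "smooth_on Q (mom i)"
  unfolding mom_def[abs_def] by (intro smooth_intros smooth_on_ddir smooth_m smooth_U)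

lemma continuous_ddir: "smooth_on Q f \<Longrightarrow> continuous_on Q (ddir Q v f)"
  by (rule smooth_on_imp_continuous_on[OF smooth_on_ddir])

lemma transport_on_Q:
  assumes "transport_eq D T u \<rho>" "z \<in> Q"
  shows "Dt r z + (U 1 z * D1 r z + U 2 z * D2 r z) = 0"
proof (rule eq_on_Q[OF _ _ _ assms(2)])
  show "continuous_on Q (\<lambda>z. Dt r z + (U 1 z * D1 r z + U 2 z * D2 r z))"
    by (intro continuous_intros continuous_ddir smooth_r smooth_on_imp_continuous_on[OF smooth_U])
  fix t x assume tx: "t \<in> {0..T}" "x \<in> D"
  have "dt T \<rho> t x = Dt r (t, x)"
    by (rule dt_eq[OF smooth_r tx(1) D_subset[OF tx(2)]]) (simp add: r_def)
  moreover have "pderiv_at i (\<rho> t) x = ddir Q (0, axis i 1) r (t, x)" for i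
    by (rule pderiv_at_eq[OF smooth_r tx]) (simp add: r_def)
  moreover have "dt T \<rho> t x + u t x \<bullet> grad (\<rho> t) x = 0"
    using assms(1) tx unfolding transport_eq_def by blast
  ultimately show "Dt r (t, x) + (U 1 (t, x) * D1 r (t, x) + U 2 (t, x) * D2 r (t, x)) = 0"
    by (simp add: grad_def inner_vec_def sum_2 U_def)
qed simp

section \<open>Positivity of the density\<close>

lemma slip_curve:
  assumes "t \<in> {0..T}" "\<exists>k. u t y = k *\<^sub>R w"
    "w $ 1 * a + w $ 2 * b = 0"
  shows "U 1 (t, y) * a + U 2 (t, y) * b = 0"
proof -
  obtain k where "u t y = k *\<^sub>R w" using assms by blast
  then have "U 1 (t, y) * a + U 2 (t, y) * b = k * (w $ 1 * a + w $ 2 * b)"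
    by (simp add: U_def algebra_simps)
  then show ?thesis using assms(3) by simp
qed

lemma spatial_min_critical:
  assumes f: "smooth_on Q f" and t: "t \<in> {0..T}" and x: "x \<in> closure D"
    and min: "\<And>y. y \<in> closure D \<Longrightarrow> f (t, x) \<le> f (t, y)"
  shows "U 1 (t, x) * D1 f (t, x) + U 2 (t, x) * D2 f (t, x) = 0"
proof (cases "x \<in> D")
  case True
  have "(\<lambda>v. ddir Q (0, v) f (t, x)) = (\<lambda>v. 0)"
    by (rule differential_zero_maxmin[OF True open_D slice_space[OF f t True]])
      (use min D_subset in auto)
  then have "ddir Q (0, v) f (t, x) = 0" for v by metis
  then show ?thesis by simp
next
  case False
  then have "x \<in> frontier D" using x open_D by (simp add: frontier_def interior_open)
  then obtain c c' s0 d where c: "d > 0" "c s0 = x" "\<And>s. \<bar>s - s0\<bar> < d \<Longrightarrow> c s \<in> frontier D"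
    "\<And>s. (c has_vector_derivative c' s) (at s)"
    "\<And>s w. \<bar>s - s0\<bar> < d \<Longrightarrow> \<forall>n. unit_normal D (c s) n \<longrightarrow> w \<bullet> n = 0 \<Longrightarrow> \<exists>k. w = k *\<^sub>R c' s"
    by (rule boundary_curve[OF smooth]) blast
  have s0: "\<bar>s0 - s0\<bar> < d" using c(1) by simp
  have d: "((\<lambda>s. f (t, c s)) has_real_derivative c' s0 $ 1 * D1 f (t, c s0) + c' s0 $ 2 * D2 f (t, c s0)) (at s0)"
    by (rule slice_frontier_curve[OF f t c(3,4) s0])
  have "c' s0 $ 1 * D1 f (t, c s0) + c' s0 $ 2 * D2 f (t, c s0) = 0"
  proof (rule DERIV_local_min[OF d c(1)], intro allI impI)
    fix s assume "\<bar>s0 - s\<bar> < d"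
    then have "c s \<in> closure D" using c(3)[of s] by (simp add: abs_minus_commute frontier_def)
    then show "f (t, c s0) \<le> f (t, c s)" using min c(2) by simp
  qed
  then show ?thesis using slip_curve[OF t c(5)[OF s0, of "u t x"]] slip t c(2) \<open>x \<in> frontier D\<close> by auto
qed

text \<open>Adding \<open>\<epsilon> * t\<close> makes the minimum principle strict: at a minimum of
  \<open>F\<close> with \<open>t > 0\<close> the time derivative would be \<epsilon>, so
  \<open>F\<close> would be smaller just before. Hence the minimum lies at time 0, where the initial
  bound applies.\<close>

lemma density_lower_bound:
  assumes tr: "transport_eq D T u \<rho>" and init: "\<And>x. x \<in> closure D \<Longrightarrow> c \<le> \<rho> 0 x" and z: "z \<in> Q"
  shows "c \<le> r z"
proof (rule field_le_epsilon)
  fix e :: real assume e: "e > 0"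
  \<comment> \<open>The perturbation is then at most \<open>e\<close> on the whole time
    interval.\<close>
  define \<epsilon> where "\<epsilon> = e / T"
  have \<epsilon>: "\<epsilon> > 0" using e T_pos by (simp add: \<epsilon>_def)
  define F where "F z = r z + \<epsilon> * fst z" for z
  have cF: "continuous_on Q F" unfolding F_def
    by (intro continuous_intros smooth_on_imp_continuous_on[OF smooth_r])
  obtain z0 where z0: "z0 \<in> Q" and min: "\<And>y. y \<in> Q \<Longrightarrow> F z0 \<le> F y"
    using continuous_attains_inf[OF compact_Q _ cF] z by blast
  obtain t x where [simp]: "z0 = (t, x)" by fastforce
  have t: "t \<in> {0..T}" and x: "x \<in> closure D" using z0 by auto
  have "U 1 (t, x) * D1 r (t, x) + U 2 (t, x) * D2 r (t, x) = 0"
  proof (rule spatial_min_critical[OF smooth_r t x])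
    show "r (t, x) \<le> r (t, y)" if "y \<in> closure D" for y
      using min[of "(t, y)"] t that by (simp add: F_def)
  qed
  then have dt0: "Dt r (t, x) = 0" using transport_on_Q[OF tr z0] by simp
  have "t = 0"
  proof (rule ccontr)
    assume "t \<noteq> 0"
    then have tp: "t > 0" using t by simp
    have "((\<lambda>s. r (s, x)) has_real_derivative 0) (at t within {0..T})"
      using slice_time[OF smooth_r t x] dt0 by (simp add: has_real_derivative_iff_has_vector_derivative)
    then have "((\<lambda>s. F (s, x)) has_real_derivative \<epsilon>) (at t within {0..T})"
      unfolding F_def by (auto intro!: derivative_eq_intros)
    from has_real_derivative_pos_inc_left[OF this \<epsilon>] obtain d where d: "d > 0"
      "\<And>h. h > 0 \<Longrightarrow> t - h \<in> {0..T} \<Longrightarrow> h < d \<Longrightarrow> F (t - h, x) < F (t, x)" by blast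
    define h where "h = min d t / 2"
    have "h > 0" "t - h \<in> {0..T}" "h < d" using d(1) tp t by (auto simp: h_def)
    then show False using d(2)[of h] min[of "(t - h, x)"] x by auto
  qed
  then have "c \<le> F z0" using init[OF x] by (simp add: F_def r_def)
  also have "\<dots> \<le> F z" using min z by blast
  also have "\<dots> \<le> r z + e"
  proof -
    have "\<epsilon> * fst z \<le> \<epsilon> * T" using z \<epsilon> by (intro mult_left_mono) auto
    then show ?thesis using T_pos by (simp add: F_def \<epsilon>_def)
  qed
  finally show "c \<le> r z + e" .
qed

text \<open>The identity behind both directions. For \<open>div u = 0\<close>, \<open>mom\<close> is
  the momentum density differentiated along the flow. Its curl is \<open>vort\<close> differentiated
  along the flow plus products of first derivatives of \<open>u\<close> and \<open>m\<close>. With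
  \<open>m = r u\<close>, the products quadratic in the derivatives of \<open>u\<close> carry the
  factor \<open>div u\<close> and vanish; the rest is the cross product of the gradients of
  \<open>kin\<close> and \<open>r\<close>.\<close>

lemma curl_momentum:
  assumes div0: "\<And>z. z \<in> Q \<Longrightarrow> D1 (U 1) z + D2 (U 2) z = 0" and z: "z \<in> Q"
  shows "D1 (mom 2) z - D2 (mom 1) z =
    Dt vort z + (U 1 z * D1 vort z + U 2 z * D2 vort z) + (D1 kin z * D2 r z - D2 kin z * D1 r z)"
proof -
  note sm = smooth_m smooth_U smooth_r smooth_on_ddir smooth_on_add smooth_on_diff smooth_on_mult
  define F where "F i z = Dt (m i) z + (U 1 z * D1 (m i) z + U 2 z * D2 (m i) z)" for i z
  have momF: "mom i z = F i z" if z: "z \<in> Q" for i z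
  proof -
    have "mom i z = Dt (m i) z + (U 1 z * D1 (m i) z + U 2 z * D2 (m i) z) + m i z * (D1 (U 1) z + D2 (U 2) z)"
      unfolding mom_def ddir_mult[OF smooth_m smooth_U z] by (simp add: algebra_simps)
    then show ?thesis using div0[OF z] by (simp add: F_def)
  qed
  have dF: "ddir Q v (mom i) z = ddir Q v (Dt (m i)) z + (U 1 z * ddir Q v (D1 (m i)) z + ddir Q v (U 1) z * D1 (m i) z
     + (U 2 z * ddir Q v (D2 (m i)) z + ddir Q v (U 2) z * D2 (m i) z))" for v i
  proof -
    have "ddir Q v (mom i) z = ddir Q v (F i) z"
      by (rule ddir_cong[OF smooth_mom momF z])
    also have "\<dots> = ddir Q v (\<lambda>z. Dt (m i) z + (U 1 z * D1 (m i) z + U 2 z * D2 (m i) z)) z"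
      by (simp add: F_def[abs_def])
    finally show ?thesis by (simp add: ddir_add ddir_mult sm z)
  qed
  have dvort: "ddir Q v vort z = ddir Q v (D1 (m 2)) z - ddir Q v (D2 (m 1)) z" for v
    unfolding vort_def[abs_def] by (simp add: ddir_diff sm z)
  have dm: "ddir Q v (m i) z = r z * ddir Q v (U i) z + ddir Q v r z * U i z" for v i
    unfolding m_def[abs_def] by (simp add: ddir_mult sm z)
  have dkin: "ddir Q v kin z = U 1 z * ddir Q v (U 1) z + U 2 z * ddir Q v (U 2) z" for v
  proof -
    have UU: "smooth_on Q (\<lambda>z. U i z * U i z)" for i by (intro smooth_on_mult smooth_U)
    show ?thesis
      unfolding kin_def[abs_def] ddir_mult[OF smooth_on_add[OF UU UU] smooth_on_const z] ddir_add[OF UU UU z]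
        ddir_mult[OF smooth_U smooth_U z] ddir_const[OF z] by (simp add: algebra_simps)
  qed
  have comm: "D1 (Dt (m 2)) z = Dt (D1 (m 2)) z" "D2 (Dt (m 1)) z = Dt (D2 (m 1)) z"
    "D1 (D2 (m 2)) z = D2 (D1 (m 2)) z" "D2 (D1 (m 1)) z = D1 (D2 (m 1)) z"
    using ddir_commute[OF smooth_m z] by blast+
  \<comment> \<open>After this second use of \<open>div u = 0\<close> the claim is a polynomial
    identity in first and second derivatives.\<close>
  have d22: "D2 (U 2) z = - D1 (U 1) z" using div0[OF z] by simp
  show ?thesis
    unfolding dF dvort comm dkin unfolding dm d22 by (simp add: algebra_simps)
qed

lemma curl_eq_vort:
  assumes "t \<in> {0..T}" "x \<in> D"
  shows "curl (\<lambda>x. \<rho> t x *\<^sub>R u t x) x = vort (t, x)"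
proof -
  have "pderiv_at j (\<lambda>y. (\<rho> t y *\<^sub>R u t y) $ i) x = ddir Q (0, axis j 1) (m i) (t, x)" for i j
    by (rule pderiv_at_eq[OF smooth_m assms]) (simp add: m_def r_def U_def)
  then show ?thesis by (simp add: curl_def vort_def)
qed

lemma vorticity_equation_iff:
  assumes tx: "t \<in> {0..T}" "x \<in> D"
  shows "dt T (\<lambda>t. curl (\<lambda>x. \<rho> t x *\<^sub>R u t x)) t x + u t x \<bullet> grad (curl (\<lambda>x. \<rho> t x *\<^sub>R u t x)) x
      + cross2 (grad (\<lambda>y. (norm (u t y))\<^sup>2 / 2) x) (grad (\<rho> t) x) =
    Dt vort (t, x) + (U 1 (t, x) * D1 vort (t, x) + U 2 (t, x) * D2 vort (t, x))
      + (D1 kin (t, x) * D2 r (t, x) - D2 kin (t, x) * D1 r (t, x))"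
proof -
  have "dt T (\<lambda>t. curl (\<lambda>x. \<rho> t x *\<^sub>R u t x)) t x = Dt vort (t, x)"
    by (rule dt_eq[OF smooth_vort tx(1) D_subset[OF tx(2)]]) (rule curl_eq_vort[OF _ tx(2)])
  moreover have "pderiv_at i (curl (\<lambda>x. \<rho> t x *\<^sub>R u t x)) x = ddir Q (0, axis i 1) vort (t, x)" for i
    by (rule pderiv_at_eq[OF smooth_vort tx]) (rule curl_eq_vort[OF tx(1)])
  moreover have "pderiv_at i (\<lambda>y. (norm (u t y))\<^sup>2 / 2) x = ddir Q (0, axis i 1) kin (t, x)" for i
    by (rule pderiv_at_eq[OF smooth_kin tx])
      (simp add: kin_def U_def power2_norm_eq_inner inner_vec_def sum_2)
  moreover have "pderiv_at i (\<rho> t) x = ddir Q (0, axis i 1) r (t, x)" for i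
    by (rule pderiv_at_eq[OF smooth_r tx]) (simp add: r_def)
  ultimately show ?thesis
    by (simp add: grad_def cross2_def inner_vec_def sum_2 U_def)
qed

lemma momentum_component:
  assumes tx: "t \<in> {0..T}" "x \<in> D"
  shows "(dt T (\<lambda>s y. \<rho> s y *\<^sub>R u s y) t x + tensor_div (\<lambda>y. \<rho> t y *\<^sub>R outer (u t y) (u t y)) x) $ i = mom i (t, x)"
proof -
  have sm: "smooth_on Q (\<lambda>z. r z *\<^sub>R u (fst z) (snd z))" by (intro smooth_intros smooth_r smooth_u')
  have "dt T (\<lambda>s y. \<rho> s y *\<^sub>R u s y) t x = Dt (\<lambda>z. r z *\<^sub>R u (fst z) (snd z)) (t, x)"
    by (rule dt_eq[OF sm tx(1) D_subset[OF tx(2)]]) (simp add: r_def)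
  also have "\<dots> $ i = Dt (\<lambda>z. (r z *\<^sub>R u (fst z) (snd z)) $ i) (t, x)"
    by (rule ddir_bounded_linear[OF sm bounded_linear_vec_nth, symmetric]) (use tx D_subset in auto)
  also have "(\<lambda>z. (r z *\<^sub>R u (fst z) (snd z)) $ i) = m i"
    by (simp add: m_def[abs_def] U_def)
  finally have 1: "dt T (\<lambda>s y. \<rho> s y *\<^sub>R u s y) t x $ i = Dt (m i) (t, x)" .
  have "pderiv_at j (\<lambda>y. (\<rho> t y *\<^sub>R outer (u t y) (u t y)) $ i $ j) x = ddir Q (0, axis j 1) (\<lambda>z. m i z * U j z) (t, x)" for j
    by (rule pderiv_at_eq[OF smooth_on_mult[OF smooth_m smooth_U] tx]) (simp add: m_def r_def U_def outer_def)
  then show ?thesis using 1 by (simp add: tensor_div_def sum_2 mom_def)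
qed

lemma diverg_eq:
  assumes tx: "t \<in> {0..T}" "x \<in> D"
  shows "diverg (u t) x = D1 (U 1) (t, x) + D2 (U 2) (t, x)"
proof -
  have "pderiv_at j (\<lambda>y. u t y $ i) x = ddir Q (0, axis j 1) (U i) (t, x)" for i j
    by (rule pderiv_at_eq[OF smooth_U tx]) (simp add: U_def)
  then show ?thesis by (simp add: diverg_def)
qed

lemma divergence_free_on_Q:
  assumes "\<And>t x. t \<in> {0..T} \<Longrightarrow> x \<in> D \<Longrightarrow> diverg (u t) x = 0" "z \<in> Q"
  shows "D1 (U 1) z + D2 (U 2) z = 0"
  by (rule eq_on_Q[OF _ _ _ assms(2)])
    (use assms(1) diverg_eq in \<open>auto intro!: continuous_intros continuous_ddir smooth_U\<close>)

text \<open>For \<open>grad \<psi> = (u2, - u1)\<close> the flux \<open>\<rho> grad \<psi>\<close>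
  is \<open>(m 2, - m 1)\<close>, whose divergence is the curl of \<open>\<rho> u\<close>. So the
  stream function, shifted to vanish on the frontier, solves the Dirichlet problem; the density
  bound \<open>c\<close> serves uniqueness.\<close>

lemma stream_function:
  assumes div0: "\<And>z. z \<in> Q \<Longrightarrow> D1 (U 1) z + D2 (U 2) z = 0" and t: "t \<in> {0..T}"
    and c: "c > 0" "\<And>z. z \<in> Q \<Longrightarrow> c \<le> r z"
  shows "\<exists>\<psi>. is_L_inv D (\<rho> t) (curl (\<lambda>x. \<rho> t x *\<^sub>R u t x)) \<psi> \<and> (\<forall>x\<in>D. u t x = perp_grad \<psi> x)"
proof -
  have "closed_form (U 2) (\<lambda>z. - U 1 z)"
    unfolding closed_form_def
  proof (intro conjI ballI smooth_on_uminus smooth_U)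
    show "D1 (\<lambda>z. - U 1 z) z = D2 (U 2) z" if "z \<in> Q" for z
      using div0[OF that] ddir_uminus[OF smooth_U[of 1] that, of "(0, axis 1 1)"] by linarith
  qed
  then obtain \<Psi> where sm: "smooth_on Q \<Psi>" and d: "\<And>z. z \<in> Q \<Longrightarrow> D1 \<Psi> z = U 2 z" "\<And>z. z \<in> Q \<Longrightarrow> D2 \<Psi> z = - U 1 z"
    by (rule smooth_potential) blast
  have loc: "\<forall>\<^sub>F y in at x within frontier D. \<Psi> (t, x) = \<Psi> (t, y)" if x: "x \<in> frontier D" for x
  proof -
    obtain c c' s0 d where c: "d > 0" "c s0 = x" "\<And>s. \<bar>s - s0\<bar> < d \<Longrightarrow> c s \<in> frontier D"
      "\<And>s. (c has_vector_derivative c' s) (at s)"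
      "\<And>s w. \<bar>s - s0\<bar> < d \<Longrightarrow> \<forall>n. unit_normal D (c s) n \<longrightarrow> w \<bullet> n = 0 \<Longrightarrow> \<exists>k. w = k *\<^sub>R c' s"
      "\<And>y. y \<in> frontier D \<Longrightarrow> dist x y < d \<Longrightarrow> \<exists>s. \<bar>s - s0\<bar> < d \<and> y = c s"
      by (rule boundary_curve[OF smooth x]) blast
    have "((\<lambda>s. \<Psi> (t, c s)) has_field_derivative 0) (at s within ball s0 d)" if "s \<in> ball s0 d" for s
    proof -
      have s: "\<bar>s - s0\<bar> < d" using that by (simp add: dist_real_def abs_minus_commute)
      have Q: "(t, c s) \<in> Q" using c(3)[OF s] t by (simp add: frontier_def)
      obtain k where "u t (c s) = k *\<^sub>R c' s" using c(5)[OF s] slip t c(3)[OF s] by blast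
      \<comment> \<open>The gradient of \<Psi> is \<open>(u2, - u1)\<close>, orthogonal to
        \<open>u = k c'\<close>; if \<open>k = 0\<close> it vanishes altogether. Both cases hinge on
        \<open>d\<close> at the frontier point.\<close>
      then have "c' s $ 1 * D1 \<Psi> (t, c s) + c' s $ 2 * D2 \<Psi> (t, c s) = 0"
        by (simp add: d[OF Q] U_def)
      then show ?thesis
        using slice_frontier_curve[OF sm t c(3,4) s] by (simp add: has_field_derivative_at_within)
    qed
    from has_field_derivative_zero_constant[OF convex_ball this] obtain k
      where k: "\<And>s. s \<in> ball s0 d \<Longrightarrow> \<Psi> (t, c s) = k" by blast
    have "\<Psi> (t, x) = \<Psi> (t, y)" if y: "y \<in> frontier D" "dist y x < d" for y
    proof -
      obtain s where "\<bar>s - s0\<bar> < d" "y = c s" using c(6)[OF y(1)] y(2) by (auto simp: dist_commute)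
      then show ?thesis using k[of s] k[of s0] c(1,2) by (simp add: dist_real_def abs_minus_commute)
    qed
    then show ?thesis unfolding eventually_at using c(1) by blast
  qed
  define \<kappa> where "\<kappa> = \<Psi> (t, SOME x. x \<in> frontier D)"
  have \<kappa>: "\<Psi> (t, x) = \<kappa>" if x: "x \<in> frontier D" for x
    unfolding \<kappa>_def
    by (rule connected_local_const[OF connected_frontier_simply_connected[OF open_D bounded_D simply_connected_D] x])
      (use x loc in \<open>auto intro: someI\<close>)
  define \<psi> where "\<psi> x = \<Psi> (t, x) - \<kappa>" for x
  have sm\<psi>: "smooth_on (closure D) \<psi>"
    unfolding \<psi>_def using sm t by (intro smooth_intros) (auto simp: smooth_on_def intro: Ck_on_slice)
  have pd: "pderiv_at i \<psi> x = ddir Q (0, axis i 1) \<Psi> (t, x)" if x: "x \<in> D" for i x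
  proof -
    have "(\<psi> has_derivative (\<lambda>v. ddir Q (0, v) \<Psi> (t, x))) (at x)"
      unfolding \<psi>_def using has_derivative_diff[OF slice_space[OF sm t x] has_derivative_const, of \<kappa>] by simp
    then show ?thesis by (rule pderiv_at_eqI)
  qed
  have pd': "pderiv_at 1 \<psi> x = U 2 (t, x)" "pderiv_at 2 \<psi> x = - U 1 (t, x)" if "x \<in> D" for x
    using pd[OF that] d[of "(t, x)"] t D_subset[OF that] by auto
  have sol: "dirichlet_solution D (\<rho> t) (curl (\<lambda>x. \<rho> t x *\<^sub>R u t x)) \<psi>"
    unfolding dirichlet_solution_def
  proof (intro conjI ballI)
    show "Ck_on 2 D \<psi>" using smooth_on_subset[OF sm\<psi> closure_subset] by (simp add: smooth_on_def)
    show "continuous_on (closure D) \<psi>" by (rule smooth_on_imp_continuous_on[OF sm\<psi>])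
    show "\<psi> x = 0" if "x \<in> frontier D" for x using \<kappa>[OF that] by (simp add: \<psi>_def)
    fix x assume x: "x \<in> D"
    have "pderiv_at 1 (\<lambda>y. (\<rho> t y *\<^sub>R grad \<psi> y) $ 1) x = D1 (m 2) (t, x)"
      by (rule pderiv_at_eq[OF smooth_m t x]) (simp add: grad_def pd' m_def r_def)
    moreover have "pderiv_at 2 (\<lambda>y. (\<rho> t y *\<^sub>R grad \<psi> y) $ 2) x = D2 (\<lambda>z. - m 1 z) (t, x)"
      by (rule pderiv_at_eq[OF smooth_on_uminus[OF smooth_m] t x]) (simp add: grad_def pd' m_def r_def)
    moreover have "D2 (\<lambda>z. - m 1 z) (t, x) = - D2 (m 1) (t, x)"
      by (rule ddir_uminus[OF smooth_m]) (use t x D_subset in auto)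
    ultimately show "L_op (\<rho> t) \<psi> x = curl (\<lambda>x. \<rho> t x *\<^sub>R u t x) x"
      using curl_eq_vort[OF t x] by (simp add: L_op_def diverg_def vort_def)
  qed
  obtain M where M: "\<And>z. z \<in> Q \<Longrightarrow> \<bar>D1 r z\<bar> \<le> M"
    using smooth_bounded[OF smooth_on_ddir[OF smooth_r]] by blast
  have "\<phi> x = \<psi> x" if "dirichlet_solution D (\<rho> t) (curl (\<lambda>x. \<rho> t x *\<^sub>R u t x)) \<phi>" "x \<in> closure D" for \<phi> x
  proof (rule dirichlet_solution_unique[OF open_D bounded_D _ c(1) _ _ that(1) sol that(2)])
    fix x assume x: "x \<in> D"
    show "(\<rho> t has_derivative (\<lambda>v. ddir Q (0, v) r (t, x))) (at x)"
      using slice_space[OF smooth_r t x] by (simp add: r_def)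
    show "c \<le> \<rho> t x" using c(2)[of "(t, x)"] t D_subset[OF x] by (simp add: r_def)
    show "\<bar>D1 r (t, x)\<bar> \<le> M" using M[of "(t, x)"] t D_subset[OF x] by simp
  qed
  then have "is_L_inv D (\<rho> t) (curl (\<lambda>x. \<rho> t x *\<^sub>R u t x)) \<psi>"
    using sol by (simp add: is_L_inv_def)
  moreover have "u t x = perp_grad \<psi> x" if "x \<in> D" for x
    using pd'[OF that] by (simp add: perp_grad_def vec_eq_iff forall_2 U_def)
  ultimately show ?thesis by blast
qed

text \<open>The divergence of \<open>perp_grad \<psi>\<close> is a difference of mixed derivatives.
  Since \<psi> is known to be C^2 on \<open>D\<close> alone,
  \<open>symmetric_second_derivative\<close> is applied directly in place of
  \<open>ddir_commute\<close>.\<close>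

lemma stream_function_divergence_free:
  assumes "Ck_on 2 D \<psi>" "\<And>x. x \<in> D \<Longrightarrow> u t x = perp_grad \<psi> x" and tx: "t \<in> {0..T}" "x \<in> D"
  shows "diverg (u t) x = 0"
proof -
  note C = Ck2_pderiv[OF open_D assms(1)]
  have "pderiv_at 1 (\<lambda>y. u t y $ 1) x = - pderiv_at 1 (pderiv_at 2 \<psi>) x"
  proof -
    have "((\<lambda>y. u t y $ 1) has_derivative (\<lambda>v. - (pderiv_at 1 (pderiv_at 2 \<psi>) x * v $ 1 + pderiv_at 2 (pderiv_at 2 \<psi>) x * v $ 2))) (at x)"
      by (rule has_derivative_transform_within_open[OF _ open_D tx(2)])
       (rule has_derivative_minus[OF C(2)[OF tx(2), of 2]], simp add: assms(2) perp_grad_def)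
    from pderiv_at_eqI[OF this, of 1] show ?thesis by (simp add: axis_def)
  qed
  moreover have "pderiv_at 2 (\<lambda>y. u t y $ 2) x = pderiv_at 2 (pderiv_at 1 \<psi>) x"
  proof -
    have "((\<lambda>y. u t y $ 2) has_derivative (\<lambda>v. pderiv_at 1 (pderiv_at 1 \<psi>) x * v $ 1 + pderiv_at 2 (pderiv_at 1 \<psi>) x * v $ 2)) (at x)"
      by (rule has_derivative_transform_within_open[OF _ open_D tx(2)])
       (rule C(2)[OF tx(2), of 1], simp add: assms(2) perp_grad_def)
    from pderiv_at_eqI[OF this, of 2] show ?thesis by (simp add: axis_def)
  qed
  moreover have "pderiv_at 2 (pderiv_at 1 \<psi>) x = pderiv_at 1 (pderiv_at 2 \<psi>) x"
  proof -
    have ax: "axis 1 1 $ (2::2) = (0::real)" "axis 2 1 $ (1::2) = (0::real)" "axis 1 1 $ (1::2) = (1::real)" "axis 2 1 $ (2::2) = (1::real)"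
      by (simp_all add: axis_def)
    have "(\<lambda>y v. pderiv_at 1 (pderiv_at 1 \<psi>) y * v $ 1 + pderiv_at 2 (pderiv_at 1 \<psi>) y * v $ 2) x (axis 2 1 :: real^2) =
      (\<lambda>y v. pderiv_at 1 (pderiv_at 2 \<psi>) y * v $ 1 + pderiv_at 2 (pderiv_at 2 \<psi>) y * v $ 2) x (axis 1 1 :: real^2)"
      by (rule symmetric_second_derivative[OF open_D tx(2) C(1), where v="axis 1 1" and w="axis 2 1"])
        (use C(2,3) in \<open>simp_all add: ax\<close>)
    then show ?thesis by (simp add: ax)
  qed
  ultimately show ?thesis by (simp add: diverg_def)
qed

theorem euler_iff_vorticity:
  assumes c: "c > 0" "\<And>x. x \<in> closure D \<Longrightarrow> c \<le> \<rho> 0 x"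
  shows "(\<exists>p. smooth_on Q (\<lambda>(t, x). p t x) \<and> euler_system D T u \<rho> p)
    \<longleftrightarrow> vorticity_system D T u \<rho> (\<lambda>t. curl (\<lambda>x. \<rho> t x *\<^sub>R u t x))"
proof
  assume "\<exists>p. smooth_on Q (\<lambda>(t, x). p t x) \<and> euler_system D T u \<rho> p"
  then obtain p where p: "smooth_on Q (\<lambda>(t, x). p t x)" and e: "euler_system D T u \<rho> p" by blast
  define P where "P z = p (fst z) (snd z)" for z
  have smP: "smooth_on Q P" using p by (simp add: P_def[abs_def] case_prod_beta')
  have tr: "transport_eq D T u \<rho>" using e by (simp add: euler_system_def)
  have div0: "D1 (U 1) z + D2 (U 2) z = 0" if "z \<in> Q" for z
    using divergence_free_on_Q[OF _ that] e by (simp add: euler_system_def)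
  have mom: "mom i z + ddir Q (0, axis i 1) P z = 0" if "z \<in> Q" for i z
  proof (rule eq_on_Q[OF _ _ _ that])
    show "continuous_on Q (\<lambda>z. mom i z + ddir Q (0, axis i 1) P z)"
      by (intro continuous_intros continuous_ddir smP smooth_on_imp_continuous_on[OF smooth_mom])
    fix t x assume tx: "t \<in> {0..T}" "x \<in> D"
    have "pderiv_at j (p t) x = ddir Q (0, axis j 1) P (t, x)" for j
      by (rule pderiv_at_eq[OF smP tx]) (simp add: P_def)
    then have "grad (p t) x $ i = ddir Q (0, axis i 1) P (t, x)"
      using exhaust_2[of i] by (auto simp: grad_def)
    moreover have "(dt T (\<lambda>s y. \<rho> s y *\<^sub>R u s y) t x + tensor_div (\<lambda>y. \<rho> t y *\<^sub>R outer (u t y) (u t y)) x + grad (p t) x) $ i = 0"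
      using e tx by (simp add: euler_system_def)
    ultimately show "mom i (t, x) + ddir Q (0, axis i 1) P (t, x) = 0"
      using momentum_component[OF tx, of i] by simp
  qed simp
  \<comment> \<open>On \<open>Q\<close> the components of \<open>mom\<close> are those of a negative
    gradient, and mixed derivatives of the pressure commute.\<close>
  have curl0: "D1 (mom 2) z - D2 (mom 1) z = 0" if z: "z \<in> Q" for z
  proof -
    have eq: "mom i z = - ddir Q (0, axis i 1) P z" if "z \<in> Q" for i z using mom[OF that, of i] by simp
    have "ddir Q v (mom i) z = - ddir Q v (ddir Q (0, axis i 1) P) z" for v i
      using ddir_cong[OF smooth_mom eq z] ddir_uminus[OF smooth_on_ddir[OF smP] z] by simp
    then show ?thesis using ddir_commute[OF smP z] by simp
  qed
  have "dt T (\<lambda>t. curl (\<lambda>x. \<rho> t x *\<^sub>R u t x)) t x + u t x \<bullet> grad (curl (\<lambda>x. \<rho> t x *\<^sub>R u t x)) x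
      + cross2 (grad (\<lambda>y. (norm (u t y))\<^sup>2 / 2) x) (grad (\<rho> t) x) = 0" if tx: "t \<in> {0..T}" "x \<in> D" for t x
  proof -
    have z: "(t, x) \<in> Q" using tx D_subset by auto
    show ?thesis using vorticity_equation_iff[OF tx] curl_momentum[OF div0 z] curl0[OF z] by simp
  qed
  moreover have "\<exists>\<psi>. is_L_inv D (\<rho> t) (curl (\<lambda>x. \<rho> t x *\<^sub>R u t x)) \<psi> \<and> (\<forall>x\<in>D. u t x = perp_grad \<psi> x)"
    if t: "t \<in> {0..T}" for t
    by (rule stream_function[OF div0 t c(1) density_lower_bound[OF tr c(2)]])
  ultimately show "vorticity_system D T u \<rho> (\<lambda>t. curl (\<lambda>x. \<rho> t x *\<^sub>R u t x))"
    using tr unfolding vorticity_system_def by blast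
next
  assume v: "vorticity_system D T u \<rho> (\<lambda>t. curl (\<lambda>x. \<rho> t x *\<^sub>R u t x))"
  have div: "diverg (u t) x = 0" if tx: "t \<in> {0..T}" "x \<in> D" for t x
  proof -
    obtain \<psi> where "is_L_inv D (\<rho> t) (curl (\<lambda>x. \<rho> t x *\<^sub>R u t x)) \<psi>" "\<forall>x\<in>D. u t x = perp_grad \<psi> x"
      using v tx(1) unfolding vorticity_system_def by blast
    then show ?thesis
      using stream_function_divergence_free[of \<psi> t x] tx by (simp add: is_L_inv_def dirichlet_solution_def)
  qed
  have div0: "D1 (U 1) z + D2 (U 2) z = 0" if "z \<in> Q" for z
    by (rule divergence_free_on_Q[OF div that])
  have closed: "D1 (mom 2) z = D2 (mom 1) z" if "z \<in> Q" for z
  \<comment> \<open>On \<open>D\<close> the vorticity equation says exactly that the curl of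
    \<open>mom\<close> vanishes; continuity extends this to the closed cylinder, where
    \<open>closed_form\<close> requires it.\<close>
  proof (rule eq_on_Q[OF _ _ _ that])
    fix t x assume tx: "t \<in> {0..T}" "x \<in> D"
    have "(t, x) \<in> Q" using tx D_subset by auto
    from curl_momentum[OF div0 this] vorticity_equation_iff[OF tx] v tx
    show "D1 (mom 2) (t, x) = D2 (mom 1) (t, x)" unfolding vorticity_system_def by auto
  qed (auto intro!: continuous_ddir smooth_mom)
  \<comment> \<open>Its potential is the pressure: its gradient cancels \<open>mom\<close>.\<close>
  have "closed_form (\<lambda>z. - mom 1 z) (\<lambda>z. - mom 2 z)"
    unfolding closed_form_def using closed
    by (auto simp: ddir_uminus[OF smooth_mom] intro!: smooth_on_uminus smooth_mom)
  then obtain P where P: "smooth_on Q P" "\<And>z. z \<in> Q \<Longrightarrow> D1 P z = - mom 1 z" "\<And>z. z \<in> Q \<Longrightarrow> D2 P z = - mom 2 z"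
    by (rule smooth_potential) blast
  define p where "p t x = P (t, x)" for t x
  have "dt T (\<lambda>s y. \<rho> s y *\<^sub>R u s y) t x + tensor_div (\<lambda>y. \<rho> t y *\<^sub>R outer (u t y) (u t y)) x + grad (p t) x = 0"
    if tx: "t \<in> {0..T}" "x \<in> D" for t x
  proof -
    have z: "(t, x) \<in> Q" using tx D_subset by auto
    have "pderiv_at j (p t) x = ddir Q (0, axis j 1) P (t, x)" for j
      by (rule pderiv_at_eq[OF P(1) tx]) (simp add: p_def)
    then have "grad (p t) x $ i = - mom i (t, x)" for i
      using exhaust_2[of i] P(2,3)[OF z] by (auto simp: grad_def)
    then show ?thesis
      using momentum_component[OF tx] by (simp add: vec_eq_iff)
  qed
  moreover have "smooth_on Q (\<lambda>(t, x). p t x)" using P(1) by (simp add: p_def)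
  ultimately show "\<exists>p. smooth_on Q (\<lambda>(t, x). p t x) \<and> euler_system D T u \<rho> p"
    using div v unfolding euler_system_def vorticity_system_def by blast
qed

end

theorem mainTheorem3:
  fixes D :: "(real^2) set" and T C1 :: real
    and \<rho>0 :: "real^2 \<Rightarrow> real"
    and u :: "real \<Rightarrow> real^2 \<Rightarrow> real^2" and \<rho> :: "real \<Rightarrow> real^2 \<Rightarrow> real"
  assumes "smooth_domain D" and "bounded D" and "simply_connected D"
    and "smooth_on (closure D) \<rho>0"
    and "C1 > 1" and "\<forall>x\<in>closure D. 1 / C1 \<le> \<rho>0 x \<and> \<rho>0 x \<le> C1"
    and "T > 0"
    and "smooth_on ({0..T} \<times> closure D) (\<lambda>(t, x). u t x)"
    and "smooth_on ({0..T} \<times> closure D) (\<lambda>(t, x). \<rho> t x)"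
    and "\<forall>t\<in>{0..T}. \<forall>x\<in>frontier D. \<forall>n. unit_normal D x n \<longrightarrow> u t x \<bullet> n = 0"
    and "\<forall>x\<in>closure D. \<rho> 0 x = \<rho>0 x"
  shows "(\<exists>p. smooth_on ({0..T} \<times> closure D) (\<lambda>(t, x). p t x) \<and> euler_system D T u \<rho> p)
    \<longleftrightarrow> vorticity_system D T u \<rho> (\<lambda>t. curl (\<lambda>x. \<rho> t x *\<^sub>R u t x))"
proof -
  interpret euler_flow D T u \<rho>
    using assms by unfold_locales auto
  show ?thesis
    by (rule euler_iff_vorticity[of "1 / C1"]) (use assms in auto)
qed

end
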